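(* Let $\mathrm S$ be a dependent type theory admitting all the rules of two-dimensional type theory $\mathrm{ML}_2$. For each context $\Gamma$ of $\mathrm S$, the object $\mathbf 1_\Gamma\in\mathfrak T_{\mathrm S}(\Gamma)$ given by $\Gamma\vdash\mathbf 1\ \mathsf{type}$ provides a retract bireflection of the object $\mathrm{id}_\Gamma\colon\Gamma\to\Gamma$ of $\mathfrak C_{\mathrm S}/\Gamma$ along the $2$-functor $E(\Gamma)\colon\mathfrak T_{\mathrm S}(\Gamma)\to\mathfrak C_{\mathrm S}/\Gamma$.
   Context: **Type theory.** $\mathrm S$ has judgement forms $A\ \mathsf{type}$, $a:A$, $A=B\ \mathsf{type}$, $a=b:A$ (definitional equality), relative to contexts $\Gamma=(x_1:A_1,\dots,x_n:A_n)$ with $A_i$ a type in context $(x_1:A_1,\dots,x_{i-1}:A_{i-1})$; equality rules (definitional equality is a congruence) and structural rules (weakening, contraction, exchange, substitution). All rules are relative to an arbitrary ambient context, and all operations are stable under substitution in it. Rules of $\mathrm{ML}_2$: - $\Sigma$: from $A$ and $x:A\vdash B(x)$ form $\Sigma(A,B)$; from $a:A$, $b:B(a)$ get $\langle a,b\rangle:\Sigma(A,B)$; from $z:\Sigma(A,B)\vdash C(z)\ \mathsf{type}$ and $x:A,y:B(x)\vdash d(x,y):C(\langle x,y\rangle)$ get $z:\Sigma(A,B)\vdash \mathrm E_d(z):C(z)$ with $\mathrm E_d(\langle x,y\rangle)=d(x,y)$. - Unit: $\mathbf 1\ \mathsf{type}$; $\star:\mathbf 1$; from $z:\mathbf 1\vdash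 C(z)\ \mathsf{type}$ and $d:C(\star)$ get $z:\mathbf 1\vdash\mathrm U_d(z):C(z)$ with $\mathrm U_d(\star)=d$. - Identity: from $a,b:A$ form $\mathrm{Id}_A(a,b)$; $\mathrm r(a):\mathrm{Id}_A(a,a)$; from $x,y:A,p:\mathrm{Id}_A(x,y)\vdash C(x,y,p)\ \mathsf{type}$ and $x:A\vdash d(x):C(x,x,\mathrm r(x))$ get $x,y:A,p:\mathrm{Id}_A(x,y)\vdash\mathrm J_d(x,y,p):C(x,y,p)$ with $\mathrm J_d(x,x,\mathrm r(x))=d(x)$. - $\Pi$: form $\Pi(A,B)$; from $x:A\vdash f(x):B(x)$ get $\lambda f:\Pi(A,B)$; from $m:\Pi(A,B)$ get $y:A\vdash m\cdot y:B(y)$; $(\lambda f)\cdot y=f(y)$. - Discrete identity types: if $p,q:\mathrm{Id}_A(a,b)$ and $\alpha:\mathrm{Id}(p,q)$ then $p=q$ and $\alpha=\mathrm r(p)$. - Function extensionality: from $m,n:\Pi(A,B)$ and $x:A\vdash p(x):\mathrm{Id}(m\cdot x,n\cdot x)$ get $\mathsf{ext}(m,n,p):\mathrm{Id}(m,n)$; $\mathsf{ext}(m,m,[x]\mathrm r(m\cdot x))=\mathrm r(m)$; $\mathsf{ext}(m,n,p)\ast x=p(x)$, where $p\ast a:=\mathrm J_{[x]\mathrm r(x\cdot a)}(m,n,p)$. By $\Pi$-abstracting over a telescope $\Delta$ one derives extended identity elimination/computation, in which $C$ and the conclusion live in context $x,y:A,p:\mathrm{Id}_A(x,y),\Delta$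 and $d$ in context $x:A,\Delta[x,x,\mathrm r(x)/x,y,p]$. Vector notation is used: an element $a:\Gamma$ of a context is a list of terms. **Identity contexts.** The identity rules extend to contexts by induction on length. For a single type, elimination into a context $\Theta=(u:\Lambda,v:D(u))$ is componentwise: from $d=(d_1,d_2)$ form $\mathrm J_{d_1}$, then $\mathrm J_{d_2}$ into $D(x,y,p,\mathrm J_{d_1}(x,y,p))$. $\mathrm{Id}_{()}=()$, with $\mathrm J_d=d$. For $\Phi=(x:\Lambda,y:D(x))$: transport $p^*(z):\Upsilon(x)$ for $p:\mathrm{Id}_\Lambda(x,x')$, $z:\Upsilon(x')$ is defined by $\mathrm{Id}_\Lambda$-elimination from $\mathrm r(x)^*(z)=z$; $\mathrm{Id}_\Phi((x,y),(x',y')):=(p:\mathrm{Id}_\Lambda(x,x'),\,q:\mathrm{Id}_{D(x)}(y,p^*y'))$; $\mathrm r(x,y):=(\mathrm r(x),\mathrm r(y))$; elimination for $\mathrm{Id}_\Phi$: first apply elimination for $\mathrm{Id}_{D(x)}$ to $d$, giving $d'(x,y,y',q)$, then $\mathrm{Id}_\Lambda$-elimination with post-context $(y,y',q)$ to $d'$. **The 2-category $\mathfrak C_{\mathrm S}$.** (Modulo $\alpha$-conversion and definitional equality.) Objects: contexts. 1-cells $\Gamma\to\Delta$: judgements $x:\Gamma\vdash f(x):\Delta$, composed by substitution. 2-cells $f\Rightarrow g$: judgements $x:\Gamma\vdash\alpha(x):\mathrm{Id}_\Delta(fx,gx)$. Here $q\circ p$ is defined by elimination on $q$ with $\mathrm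 r(y)\circ p=p$, and $h^\bullet(p):\mathrm{Id}_\Delta(hx,hy)$ by elimination on $p$ with $h^\bullet(\mathrm r(x))=\mathrm r(hx)$; vertical composition is $\beta(x)\circ\alpha(x)$, identities are $\mathrm r(fx)$, whiskerings are $(\alpha k)(x)=\alpha(kx)$, $(h\alpha)(x)=h^\bullet(\alpha(x))$. The slice $\mathfrak C_{\mathrm S}/\Gamma$ has strictly commuting triangles as 1-cells and, as 2-cells, those whose composite with the structure map to $\Gamma$ is an identity. For a type $A$ in context $\Gamma$: $\Gamma.A=(x:\Gamma,y:A(x))$, with projection $\pi_A\colon\Gamma.A\to\Gamma$. **The fibre 2-category $\mathfrak T_{\mathrm S}(\Gamma)$ and $E(\Gamma)$.** Objects: types $A$ in context $\Gamma$. 1-cells $A\to B$: judgements $x:\Gamma,y:A(x)\vdash f(x,y):B(x)$. 2-cells $f\Rightarrow g$: judgements $x:\Gamma,y:A(x)\vdash\alpha(x,y):\mathrm{Id}_{B(x)}(f(x,y),g(x,y))$, with compositions defined from $\circ$, $\mathrm r$ and $(-)^\bullet$ as in $\mathfrak C_{\mathrm S}$. $E(\Gamma)$ sends $A$ to $\pi_A\colon\Gamma.A\to\Gamma$, $f$ to $(x,y)\mapsto(x,f(x,y))$, and $\alpha$ to $(x,y)\mapsto(\mathrm r(x),\alpha(x,y))$. **Retract bireflections.** A functor $P$ is a *surjective equivalence* if there are a functor $I$ with $PI=\mathrm{id}$ and an isomorphism $\theta\colon\mathrm{id}\Rightarrow IP$ with $\theta I=\mathrm{id}_I$, $P\theta=\mathrm{id}_P$.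 For a 2-functor $U\colon\mathbf K\to\mathbf L$ and $x\in\mathbf L$, a *retract bireflection* of $x$ along $U$ is an object $Fx\in\mathbf K$ with a morphism $\eta_x\colon x\to UFx$ such that for each $y\in\mathbf K$ the functor $\mathbf K(Fx,y)\to\mathbf L(x,Uy)$, $h\mapsto Uh\circ\eta_x$, is a surjective equivalence of categories. *)

theory Defs
  imports Main
begin

section \<open>Raw syntax\<close>

text \<open>
  Expressions modulo alpha-conversion, with de Bruijn indices. Types and terms share one syntactic
  class, and terms carry no type annotations. A constructor binds the following number of variables in its arguments:
  \<open>SigT A B\<close>: 0, 1; \<open>SplitT d c\<close> (the term \<open>E_d(c)\<close>): 2, 0; \<open>JT d a b p\<close> (the term \<open>J_d(a, b, p)\<close>):
  1, 0, 0, 0; \<open>PiT A B\<close>: 0, 1; \<open>LamT f\<close>: 1; \<open>ExtT m n p\<close>: 0, 0, 1; and none otherwise. The constructor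
  \<open>OpT\<close> provides arbitrary further operators of a theory, with a binding arity for each argument.
\<close>

datatype 's expr =
    Var nat
  | SigT "'s expr" "'s expr"
  | PairT "'s expr" "'s expr"
  | SplitT "'s expr" "'s expr"
  | UnitT
  | StarT
  | UnitElimT "'s expr" "'s expr"
  | IdT "'s expr" "'s expr" "'s expr"
  | ReflT "'s expr"
  | JT "'s expr" "'s expr" "'s expr" "'s expr"
  | PiT "'s expr" "'s expr"
  | LamT "'s expr"
  | AppT "'s expr" "'s expr"
  | ExtT "'s expr" "'s expr" "'s expr"
  | OpT 's "(nat \<times> 's expr) list"

definition up_ren :: "nat \<Rightarrow> (nat \<Rightarrow> nat) \<Rightarrow> nat \<Rightarrow> nat" where
  "up_ren n f i = (if i < n then i else f (i - n) + n)"

fun ren :: "(nat \<Rightarrow> nat) \<Rightarrow> 's expr \<Rightarrow> 's expr" where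
  "ren f (Var i) = Var (f i)"
| "ren f (SigT A B) = SigT (ren f A) (ren (up_ren 1 f) B)"
| "ren f (PairT a b) = PairT (ren f a) (ren f b)"
| "ren f (SplitT d c) = SplitT (ren (up_ren 2 f) d) (ren f c)"
| "ren f UnitT = UnitT"
| "ren f StarT = StarT"
| "ren f (UnitElimT d c) = UnitElimT (ren f d) (ren f c)"
| "ren f (IdT A a b) = IdT (ren f A) (ren f a) (ren f b)"
| "ren f (ReflT a) = ReflT (ren f a)"
| "ren f (JT d a b p) = JT (ren (up_ren 1 f) d) (ren f a) (ren f b) (ren f p)"
| "ren f (PiT A B) = PiT (ren f A) (ren (up_ren 1 f) B)"
| "ren f (LamT t) = LamT (ren (up_ren 1 f) t)"
| "ren f (AppT m a) = AppT (ren f m) (ren f a)"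
| "ren f (ExtT m n p) = ExtT (ren f m) (ren f n) (ren (up_ren 1 f) p)"
| "ren f (OpT c as) = OpT c (map (\<lambda>(n, e). (n, ren (up_ren n f) e)) as)"

text \<open>
  \<open>wk c m e\<close> inserts \<open>m\<close> fresh variables into the ambient context of \<open>e\<close>, just outside its \<open>c\<close>
  innermost variables.
\<close>

definition wk :: "nat \<Rightarrow> nat \<Rightarrow> 's expr \<Rightarrow> 's expr" where
  "wk c m = ren (\<lambda>i. if i < c then i else i + m)"

abbreviation lift :: "nat \<Rightarrow> 's expr \<Rightarrow> 's expr" where
  "lift \<equiv> wk 0"

definition up_sub :: "nat \<Rightarrow> (nat \<Rightarrow> 's expr) \<Rightarrow> nat \<Rightarrow> 's expr" where
  "up_sub n \<sigma> i = (if i < n then Var i else lift n (\<sigma> (i - n)))"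

fun sub :: "(nat \<Rightarrow> 's expr) \<Rightarrow> 's expr \<Rightarrow> 's expr" where
  "sub \<sigma> (Var i) = \<sigma> i"
| "sub \<sigma> (SigT A B) = SigT (sub \<sigma> A) (sub (up_sub 1 \<sigma>) B)"
| "sub \<sigma> (PairT a b) = PairT (sub \<sigma> a) (sub \<sigma> b)"
| "sub \<sigma> (SplitT d c) = SplitT (sub (up_sub 2 \<sigma>) d) (sub \<sigma> c)"
| "sub \<sigma> UnitT = UnitT"
| "sub \<sigma> StarT = StarT"
| "sub \<sigma> (UnitElimT d c) = UnitElimT (sub \<sigma> d) (sub \<sigma> c)"
| "sub \<sigma> (IdT A a b) = IdT (sub \<sigma> A) (sub \<sigma> a) (sub \<sigma> b)"
| "sub \<sigma> (ReflT a) = ReflT (sub \<sigma> a)"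
| "sub \<sigma> (JT d a b p) = JT (sub (up_sub 1 \<sigma>) d) (sub \<sigma> a) (sub \<sigma> b) (sub \<sigma> p)"
| "sub \<sigma> (PiT A B) = PiT (sub \<sigma> A) (sub (up_sub 1 \<sigma>) B)"
| "sub \<sigma> (LamT t) = LamT (sub (up_sub 1 \<sigma>) t)"
| "sub \<sigma> (AppT m a) = AppT (sub \<sigma> m) (sub \<sigma> a)"
| "sub \<sigma> (ExtT m n p) = ExtT (sub \<sigma> m) (sub \<sigma> n) (sub (up_sub 1 \<sigma>) p)"
| "sub \<sigma> (OpT c as) = OpT c (map (\<lambda>(n, e). (n, sub (up_sub n \<sigma>) e)) as)"

text \<open>
  Lists of terms, contexts and telescopes have their \<^emph>\<open>innermost\<close> (last declared) entry at the head,
  so that \<open>Var i\<close> is the variable at position \<open>i\<close>. If \<open>\<Theta>\<close> is a telescope over \<open>\<Gamma>\<close>, \<open>\<Delta>\<close> is a telescope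
  of length \<open>k\<close> over \<open>\<Gamma>\<close>, and \<open>ts\<close> is a list of terms for \<open>\<Theta>\<close> in context \<open>\<Gamma>, \<Delta>\<close>, then \<open>inst k ts\<close> takes
  expressions over \<open>\<Gamma>, \<Theta>\<close> to expressions over \<open>\<Gamma>, \<Delta>\<close>.
\<close>

definition inst :: "nat \<Rightarrow> 's expr list \<Rightarrow> 's expr \<Rightarrow> 's expr" where
  "inst k ts = sub (\<lambda>i. if i < length ts then ts ! i else Var (i - length ts + k))"

text \<open>\<open>scoped n e\<close>: all free variables of \<open>e\<close> are among the \<open>n\<close> innermost ones.\<close>

fun scoped :: "nat \<Rightarrow> 's expr \<Rightarrow> bool" where
  "scoped n (Var i) = (i < n)"
| "scoped n (SigT A B) = (scoped n A \<and> scoped (n + 1) B)"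
| "scoped n (PairT a b) = (scoped n a \<and> scoped n b)"
| "scoped n (SplitT d c) = (scoped (n + 2) d \<and> scoped n c)"
| "scoped n UnitT = True"
| "scoped n StarT = True"
| "scoped n (UnitElimT d c) = (scoped n d \<and> scoped n c)"
| "scoped n (IdT A a b) = (scoped n A \<and> scoped n a \<and> scoped n b)"
| "scoped n (ReflT a) = scoped n a"
| "scoped n (JT d a b p) = (scoped (n + 1) d \<and> scoped n a \<and> scoped n b \<and> scoped n p)"
| "scoped n (PiT A B) = (scoped n A \<and> scoped (n + 1) B)"
| "scoped n (LamT t) = scoped (n + 1) t"
| "scoped n (AppT m a) = (scoped n m \<and> scoped n a)"
| "scoped n (ExtT l m p) = (scoped n l \<and> scoped n m \<and> scoped (n + 1) p)"
| "scoped n (OpT c as) = (\<forall>(m, e) \<in> set as. scoped (n + m) e)"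


section \<open>Dependent type theories\<close>

datatype 's judgement =
    Ty "'s expr"
  | Tm "'s expr" "'s expr"
  | TyEq "'s expr" "'s expr"
  | TmEq "'s expr" "'s expr" "'s expr"

text \<open>
  Informally: \<open>A type\<close>; \<open>a : A\<close>; \<open>A = B type\<close>; \<open>a = b : A\<close> (written \<open>Tm a A\<close> and \<open>TmEq a b A\<close>, with the type
  last).
\<close>

fun sub_judgement :: "('s expr \<Rightarrow> 's expr) \<Rightarrow> 's judgement \<Rightarrow> 's judgement" where
  "sub_judgement f (Ty A) = Ty (f A)"
| "sub_judgement f (Tm a A) = Tm (f a) (f A)"
| "sub_judgement f (TyEq A B) = TyEq (f A) (f B)"
| "sub_judgement f (TmEq a b A) = TmEq (f a) (f b) (f A)"

fun scoped_judgement :: "nat \<Rightarrow> 's judgement \<Rightarrow> bool" where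
  "scoped_judgement n (Ty A) = scoped n A"
| "scoped_judgement n (Tm a A) = (scoped n a \<and> scoped n A)"
| "scoped_judgement n (TyEq A B) = (scoped n A \<and> scoped n B)"
| "scoped_judgement n (TmEq a b A) = (scoped n a \<and> scoped n b \<and> scoped n A)"

text \<open>A theory is given by its set of derivable judgements in context.\<close>

type_synonym 's ttheory = "('s expr list \<times> 's judgement) set"

abbreviation derives :: "'s expr list \<Rightarrow> 's ttheory \<Rightarrow> 's judgement \<Rightarrow> bool"
    ("(_ \<turnstile>\<^bsub>_\<^esub> _)" [51, 0, 51] 50) where
  "\<Gamma> \<turnstile>\<^bsub>S\<^esub> J \<equiv> (\<Gamma>, J) \<in> S"

fun ctx :: "'s ttheory \<Rightarrow> 's expr list \<Rightarrow> bool" where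
  "ctx S [] = True"
| "ctx S (A # \<Gamma>) = (ctx S \<Gamma> \<and> (\<Gamma> \<turnstile>\<^bsub>S\<^esub> Ty A))"

text \<open>
  \<open>el S \<Gamma> \<Theta> ts\<close> is the vector judgement \<open>\<Gamma> \<turnstile> ts : \<Theta>\<close>, for \<open>\<Theta>\<close> a telescope over \<open>\<Gamma>\<close>
  (a context, being closed, is a telescope over any \<open>\<Gamma>\<close>, with no index shift), and
  \<open>el_eq S \<Gamma> \<Theta> ts us\<close> is \<open>\<Gamma> \<turnstile> ts = us : \<Theta>\<close>.
\<close>

fun el :: "'s ttheory \<Rightarrow> 's expr list \<Rightarrow> 's expr list \<Rightarrow> 's expr list \<Rightarrow> bool" where
  "el S \<Gamma> [] [] = True"
| "el S \<Gamma> (D # \<Theta>) (t # ts) = (el S \<Gamma> \<Theta> ts \<and> (\<Gamma> \<turnstile>\<^bsub>S\<^esub> Tm t (inst 0 ts D)))"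
| "el S \<Gamma> _ _ = False"

fun el_eq :: "'s ttheory \<Rightarrow> 's expr list \<Rightarrow> 's expr list \<Rightarrow> 's expr list \<Rightarrow> 's expr list \<Rightarrow> bool" where
  "el_eq S \<Gamma> [] [] [] = True"
| "el_eq S \<Gamma> (D # \<Theta>) (t # ts) (u # us) =
    (el_eq S \<Gamma> \<Theta> ts us \<and> (\<Gamma> \<turnstile>\<^bsub>S\<^esub> TmEq t u (inst 0 ts D)))"
| "el_eq S \<Gamma> _ _ _ = False"

text \<open>
  Weakening, contraction, exchange and substitution are the instances of \<open>substitution\<close> in which \<open>ts\<close>
  omits, repeats or permutes variables, or inserts a term (together with \<open>variable\<close>).
\<close>

locale dependent_type_theory =
  fixes S :: "'s ttheory"
  assumes scope: "\<Gamma> \<turnstile>\<^bsub>S\<^esub> J \<Longrightarrow> scoped_judgement (length \<Gamma>) J"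
    and presup_ctx: "\<Gamma> \<turnstile>\<^bsub>S\<^esub> J \<Longrightarrow> ctx S \<Gamma>"
    and presup_Tm: "\<Gamma> \<turnstile>\<^bsub>S\<^esub> Tm a A \<Longrightarrow> \<Gamma> \<turnstile>\<^bsub>S\<^esub> Ty A"
    and presup_TyEq: "\<Gamma> \<turnstile>\<^bsub>S\<^esub> TyEq A B \<Longrightarrow> (\<Gamma> \<turnstile>\<^bsub>S\<^esub> Ty A) \<and> (\<Gamma> \<turnstile>\<^bsub>S\<^esub> Ty B)"
    and presup_TmEq: "\<Gamma> \<turnstile>\<^bsub>S\<^esub> TmEq a b A \<Longrightarrow> (\<Gamma> \<turnstile>\<^bsub>S\<^esub> Tm a A) \<and> (\<Gamma> \<turnstile>\<^bsub>S\<^esub> Tm b A)"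
    and TyEq_refl: "\<Gamma> \<turnstile>\<^bsub>S\<^esub> Ty A \<Longrightarrow> \<Gamma> \<turnstile>\<^bsub>S\<^esub> TyEq A A"
    and TyEq_sym: "\<Gamma> \<turnstile>\<^bsub>S\<^esub> TyEq A B \<Longrightarrow> \<Gamma> \<turnstile>\<^bsub>S\<^esub> TyEq B A"
    and TyEq_trans: "\<Gamma> \<turnstile>\<^bsub>S\<^esub> TyEq A B \<Longrightarrow> \<Gamma> \<turnstile>\<^bsub>S\<^esub> TyEq B C \<Longrightarrow> \<Gamma> \<turnstile>\<^bsub>S\<^esub> TyEq A C"
    and TmEq_refl: "\<Gamma> \<turnstile>\<^bsub>S\<^esub> Tm a A \<Longrightarrow> \<Gamma> \<turnstile>\<^bsub>S\<^esub> TmEq a a A"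
    and TmEq_sym: "\<Gamma> \<turnstile>\<^bsub>S\<^esub> TmEq a b A \<Longrightarrow> \<Gamma> \<turnstile>\<^bsub>S\<^esub> TmEq b a A"
    and TmEq_trans: "\<Gamma> \<turnstile>\<^bsub>S\<^esub> TmEq a b A \<Longrightarrow> \<Gamma> \<turnstile>\<^bsub>S\<^esub> TmEq b c A \<Longrightarrow> \<Gamma> \<turnstile>\<^bsub>S\<^esub> TmEq a c A"
    and Tm_conv: "\<Gamma> \<turnstile>\<^bsub>S\<^esub> Tm a A \<Longrightarrow> \<Gamma> \<turnstile>\<^bsub>S\<^esub> TyEq A B \<Longrightarrow> \<Gamma> \<turnstile>\<^bsub>S\<^esub> Tm a B"
    and TmEq_conv: "\<Gamma> \<turnstile>\<^bsub>S\<^esub> TmEq a b A \<Longrightarrow> \<Gamma> \<turnstile>\<^bsub>S\<^esub> TyEq A B \<Longrightarrow> \<Gamma> \<turnstile>\<^bsub>S\<^esub> TmEq a b B"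
    and variable: "ctx S \<Gamma> \<Longrightarrow> i < length \<Gamma> \<Longrightarrow> \<Gamma> \<turnstile>\<^bsub>S\<^esub> Tm (Var i) (lift (i + 1) (\<Gamma> ! i))"
    and substitution:
      "\<Delta> \<turnstile>\<^bsub>S\<^esub> J \<Longrightarrow> ctx S \<Gamma> \<Longrightarrow> el S \<Gamma> \<Delta> ts \<Longrightarrow> \<Gamma> \<turnstile>\<^bsub>S\<^esub> sub_judgement (inst 0 ts) J"
    and substitution_cong_Ty:
      "\<Delta> \<turnstile>\<^bsub>S\<^esub> Ty A \<Longrightarrow> ctx S \<Gamma> \<Longrightarrow> el_eq S \<Gamma> \<Delta> ts us \<Longrightarrow> \<Gamma> \<turnstile>\<^bsub>S\<^esub> TyEq (inst 0 ts A) (inst 0 us A)"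
    and substitution_cong_Tm:
      "\<Delta> \<turnstile>\<^bsub>S\<^esub> Tm a A \<Longrightarrow> ctx S \<Gamma> \<Longrightarrow> el_eq S \<Gamma> \<Delta> ts us \<Longrightarrow>
        \<Gamma> \<turnstile>\<^bsub>S\<^esub> TmEq (inst 0 ts a) (inst 0 us a) (inst 0 ts A)"

text \<open>The context extension \<open>x, y : A, p : Id_A(x, y)\<close>.\<close>

abbreviation Id_tele :: "'s expr \<Rightarrow> 's expr list" where
  "Id_tele A \<equiv> [IdT (lift 2 A) (Var 1) (Var 0), lift 1 A, A]"

text \<open>The term \<open>p * a\<close>, obtained from \<open>p : Id(m, n)\<close> by \<open>J\<close> from \<open>[x] r(x \<sqdot> a)\<close>.\<close>

definition happ :: "'s expr \<Rightarrow> 's expr \<Rightarrow> 's expr \<Rightarrow> 's expr \<Rightarrow> 's expr" where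
  "happ m n p a = JT (ReflT (AppT (Var 0) (lift 1 a))) m n p"

text \<open>
  Eliminators are stated with an arbitrary term in place of the eliminated variable; all operations
  commute with substitution by definition of \<open>sub\<close>.
\<close>

locale ML2 = dependent_type_theory S for S :: "'s ttheory" +
  \<comment> \<open>dependent sums\<close>
  assumes Sig_form: "\<Gamma> \<turnstile>\<^bsub>S\<^esub> Ty A \<Longrightarrow> A # \<Gamma> \<turnstile>\<^bsub>S\<^esub> Ty B \<Longrightarrow> \<Gamma> \<turnstile>\<^bsub>S\<^esub> Ty (SigT A B)"
    and Sig_form_cong:
      "\<Gamma> \<turnstile>\<^bsub>S\<^esub> TyEq A A' \<Longrightarrow> A # \<Gamma> \<turnstile>\<^bsub>S\<^esub> TyEq B B' \<Longrightarrow> \<Gamma> \<turnstile>\<^bsub>S\<^esub> TyEq (SigT A B) (SigT A' B')"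
    and Sig_intro:
      "A # \<Gamma> \<turnstile>\<^bsub>S\<^esub> Ty B \<Longrightarrow> \<Gamma> \<turnstile>\<^bsub>S\<^esub> Tm a A \<Longrightarrow> \<Gamma> \<turnstile>\<^bsub>S\<^esub> Tm b (inst 0 [a] B) \<Longrightarrow>
        \<Gamma> \<turnstile>\<^bsub>S\<^esub> Tm (PairT a b) (SigT A B)"
    and Sig_intro_cong:
      "A # \<Gamma> \<turnstile>\<^bsub>S\<^esub> Ty B \<Longrightarrow> \<Gamma> \<turnstile>\<^bsub>S\<^esub> TmEq a a' A \<Longrightarrow> \<Gamma> \<turnstile>\<^bsub>S\<^esub> TmEq b b' (inst 0 [a] B) \<Longrightarrow>
        \<Gamma> \<turnstile>\<^bsub>S\<^esub> TmEq (PairT a b) (PairT a' b') (SigT A B)"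
    and Sig_elim:
      "A # \<Gamma> \<turnstile>\<^bsub>S\<^esub> Ty B \<Longrightarrow> SigT A B # \<Gamma> \<turnstile>\<^bsub>S\<^esub> Ty C \<Longrightarrow>
        B # A # \<Gamma> \<turnstile>\<^bsub>S\<^esub> Tm d (inst 2 [PairT (Var 1) (Var 0)] C) \<Longrightarrow> \<Gamma> \<turnstile>\<^bsub>S\<^esub> Tm c (SigT A B) \<Longrightarrow>
        \<Gamma> \<turnstile>\<^bsub>S\<^esub> Tm (SplitT d c) (inst 0 [c] C)"
    and Sig_elim_cong:
      "A # \<Gamma> \<turnstile>\<^bsub>S\<^esub> Ty B \<Longrightarrow> SigT A B # \<Gamma> \<turnstile>\<^bsub>S\<^esub> Ty C \<Longrightarrow>
        B # A # \<Gamma> \<turnstile>\<^bsub>S\<^esub> TmEq d d' (inst 2 [PairT (Var 1) (Var 0)] C) \<Longrightarrow>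
        \<Gamma> \<turnstile>\<^bsub>S\<^esub> TmEq c c' (SigT A B) \<Longrightarrow>
        \<Gamma> \<turnstile>\<^bsub>S\<^esub> TmEq (SplitT d c) (SplitT d' c') (inst 0 [c] C)"
    and Sig_comp:
      "A # \<Gamma> \<turnstile>\<^bsub>S\<^esub> Ty B \<Longrightarrow> SigT A B # \<Gamma> \<turnstile>\<^bsub>S\<^esub> Ty C \<Longrightarrow>
        B # A # \<Gamma> \<turnstile>\<^bsub>S\<^esub> Tm d (inst 2 [PairT (Var 1) (Var 0)] C) \<Longrightarrow>
        \<Gamma> \<turnstile>\<^bsub>S\<^esub> Tm a A \<Longrightarrow> \<Gamma> \<turnstile>\<^bsub>S\<^esub> Tm b (inst 0 [a] B) \<Longrightarrow>
        \<Gamma> \<turnstile>\<^bsub>S\<^esub> TmEq (SplitT d (PairT a b)) (inst 0 [b, a] d) (inst 0 [PairT a b] C)"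
  \<comment> \<open>unit type\<close>
    and Unit_form: "ctx S \<Gamma> \<Longrightarrow> \<Gamma> \<turnstile>\<^bsub>S\<^esub> Ty UnitT"
    and Unit_intro: "ctx S \<Gamma> \<Longrightarrow> \<Gamma> \<turnstile>\<^bsub>S\<^esub> Tm StarT UnitT"
    and Unit_elim:
      "UnitT # \<Gamma> \<turnstile>\<^bsub>S\<^esub> Ty C \<Longrightarrow> \<Gamma> \<turnstile>\<^bsub>S\<^esub> Tm d (inst 0 [StarT] C) \<Longrightarrow> \<Gamma> \<turnstile>\<^bsub>S\<^esub> Tm c UnitT \<Longrightarrow>
        \<Gamma> \<turnstile>\<^bsub>S\<^esub> Tm (UnitElimT d c) (inst 0 [c] C)"
    and Unit_elim_cong:
      "UnitT # \<Gamma> \<turnstile>\<^bsub>S\<^esub> Ty C \<Longrightarrow> \<Gamma> \<turnstile>\<^bsub>S\<^esub> TmEq d d' (inst 0 [StarT] C) \<Longrightarrow> \<Gamma> \<turnstile>\<^bsub>S\<^esub> TmEq c c' UnitT \<Longrightarrow>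
        \<Gamma> \<turnstile>\<^bsub>S\<^esub> TmEq (UnitElimT d c) (UnitElimT d' c') (inst 0 [c] C)"
    and Unit_comp:
      "UnitT # \<Gamma> \<turnstile>\<^bsub>S\<^esub> Ty C \<Longrightarrow> \<Gamma> \<turnstile>\<^bsub>S\<^esub> Tm d (inst 0 [StarT] C) \<Longrightarrow>
        \<Gamma> \<turnstile>\<^bsub>S\<^esub> TmEq (UnitElimT d StarT) d (inst 0 [StarT] C)"
  \<comment> \<open>identity types\<close>
    and Id_form: "\<Gamma> \<turnstile>\<^bsub>S\<^esub> Tm a A \<Longrightarrow> \<Gamma> \<turnstile>\<^bsub>S\<^esub> Tm b A \<Longrightarrow> \<Gamma> \<turnstile>\<^bsub>S\<^esub> Ty (IdT A a b)"
    and Id_form_cong: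
      "\<Gamma> \<turnstile>\<^bsub>S\<^esub> TyEq A A' \<Longrightarrow> \<Gamma> \<turnstile>\<^bsub>S\<^esub> TmEq a a' A \<Longrightarrow> \<Gamma> \<turnstile>\<^bsub>S\<^esub> TmEq b b' A \<Longrightarrow>
        \<Gamma> \<turnstile>\<^bsub>S\<^esub> TyEq (IdT A a b) (IdT A' a' b')"
    and Id_intro: "\<Gamma> \<turnstile>\<^bsub>S\<^esub> Tm a A \<Longrightarrow> \<Gamma> \<turnstile>\<^bsub>S\<^esub> Tm (ReflT a) (IdT A a a)"
    and Id_intro_cong:
      "\<Gamma> \<turnstile>\<^bsub>S\<^esub> TmEq a a' A \<Longrightarrow> \<Gamma> \<turnstile>\<^bsub>S\<^esub> TmEq (ReflT a) (ReflT a') (IdT A a a)"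
    and Id_elim:
      "Id_tele A @ \<Gamma> \<turnstile>\<^bsub>S\<^esub> Ty C \<Longrightarrow> A # \<Gamma> \<turnstile>\<^bsub>S\<^esub> Tm d (inst 1 [ReflT (Var 0), Var 0, Var 0] C) \<Longrightarrow>
        \<Gamma> \<turnstile>\<^bsub>S\<^esub> Tm a A \<Longrightarrow> \<Gamma> \<turnstile>\<^bsub>S\<^esub> Tm b A \<Longrightarrow> \<Gamma> \<turnstile>\<^bsub>S\<^esub> Tm p (IdT A a b) \<Longrightarrow>
        \<Gamma> \<turnstile>\<^bsub>S\<^esub> Tm (JT d a b p) (inst 0 [p, b, a] C)"
    and Id_elim_cong:
      "Id_tele A @ \<Gamma> \<turnstile>\<^bsub>S\<^esub> Ty C \<Longrightarrow>
        A # \<Gamma> \<turnstile>\<^bsub>S\<^esub> TmEq d d' (inst 1 [ReflT (Var 0), Var 0, Var 0] C) \<Longrightarrow>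
        \<Gamma> \<turnstile>\<^bsub>S\<^esub> TmEq a a' A \<Longrightarrow> \<Gamma> \<turnstile>\<^bsub>S\<^esub> TmEq b b' A \<Longrightarrow> \<Gamma> \<turnstile>\<^bsub>S\<^esub> TmEq p p' (IdT A a b) \<Longrightarrow>
        \<Gamma> \<turnstile>\<^bsub>S\<^esub> TmEq (JT d a b p) (JT d' a' b' p') (inst 0 [p, b, a] C)"
    and Id_comp:
      "Id_tele A @ \<Gamma> \<turnstile>\<^bsub>S\<^esub> Ty C \<Longrightarrow> A # \<Gamma> \<turnstile>\<^bsub>S\<^esub> Tm d (inst 1 [ReflT (Var 0), Var 0, Var 0] C) \<Longrightarrow>
        \<Gamma> \<turnstile>\<^bsub>S\<^esub> Tm a A \<Longrightarrow>
        \<Gamma> \<turnstile>\<^bsub>S\<^esub> TmEq (JT d a a (ReflT a)) (inst 0 [a] d) (inst 0 [ReflT a, a, a] C)"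
  \<comment> \<open>dependent products\<close>
    and Pi_form: "\<Gamma> \<turnstile>\<^bsub>S\<^esub> Ty A \<Longrightarrow> A # \<Gamma> \<turnstile>\<^bsub>S\<^esub> Ty B \<Longrightarrow> \<Gamma> \<turnstile>\<^bsub>S\<^esub> Ty (PiT A B)"
    and Pi_form_cong:
      "\<Gamma> \<turnstile>\<^bsub>S\<^esub> TyEq A A' \<Longrightarrow> A # \<Gamma> \<turnstile>\<^bsub>S\<^esub> TyEq B B' \<Longrightarrow> \<Gamma> \<turnstile>\<^bsub>S\<^esub> TyEq (PiT A B) (PiT A' B')"
    and Pi_intro: "A # \<Gamma> \<turnstile>\<^bsub>S\<^esub> Tm f B \<Longrightarrow> \<Gamma> \<turnstile>\<^bsub>S\<^esub> Tm (LamT f) (PiT A B)"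
    and Pi_intro_cong: "A # \<Gamma> \<turnstile>\<^bsub>S\<^esub> TmEq f f' B \<Longrightarrow> \<Gamma> \<turnstile>\<^bsub>S\<^esub> TmEq (LamT f) (LamT f') (PiT A B)"
    and Pi_elim:
      "A # \<Gamma> \<turnstile>\<^bsub>S\<^esub> Ty B \<Longrightarrow> \<Gamma> \<turnstile>\<^bsub>S\<^esub> Tm m (PiT A B) \<Longrightarrow> \<Gamma> \<turnstile>\<^bsub>S\<^esub> Tm a A \<Longrightarrow>
        \<Gamma> \<turnstile>\<^bsub>S\<^esub> Tm (AppT m a) (inst 0 [a] B)"
    and Pi_elim_cong:
      "A # \<Gamma> \<turnstile>\<^bsub>S\<^esub> Ty B \<Longrightarrow> \<Gamma> \<turnstile>\<^bsub>S\<^esub> TmEq m m' (PiT A B) \<Longrightarrow> \<Gamma> \<turnstile>\<^bsub>S\<^esub> TmEq a a' A \<Longrightarrow>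
        \<Gamma> \<turnstile>\<^bsub>S\<^esub> TmEq (AppT m a) (AppT m' a') (inst 0 [a] B)"
    and Pi_comp:
      "A # \<Gamma> \<turnstile>\<^bsub>S\<^esub> Tm f B \<Longrightarrow> \<Gamma> \<turnstile>\<^bsub>S\<^esub> Tm a A \<Longrightarrow>
        \<Gamma> \<turnstile>\<^bsub>S\<^esub> TmEq (AppT (LamT f) a) (inst 0 [a] f) (inst 0 [a] B)"
  \<comment> \<open>discrete identity types\<close>
    and Id_disc:
      "\<Gamma> \<turnstile>\<^bsub>S\<^esub> Tm a A \<Longrightarrow> \<Gamma> \<turnstile>\<^bsub>S\<^esub> Tm b A \<Longrightarrow> \<Gamma> \<turnstile>\<^bsub>S\<^esub> Tm p (IdT A a b) \<Longrightarrow> \<Gamma> \<turnstile>\<^bsub>S\<^esub> Tm q (IdT A a b) \<Longrightarrow>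
        \<Gamma> \<turnstile>\<^bsub>S\<^esub> Tm \<alpha> (IdT (IdT A a b) p q) \<Longrightarrow> \<Gamma> \<turnstile>\<^bsub>S\<^esub> TmEq p q (IdT A a b)"
    and Id_disc_refl:
      "\<Gamma> \<turnstile>\<^bsub>S\<^esub> Tm a A \<Longrightarrow> \<Gamma> \<turnstile>\<^bsub>S\<^esub> Tm b A \<Longrightarrow> \<Gamma> \<turnstile>\<^bsub>S\<^esub> Tm p (IdT A a b) \<Longrightarrow> \<Gamma> \<turnstile>\<^bsub>S\<^esub> Tm q (IdT A a b) \<Longrightarrow>
        \<Gamma> \<turnstile>\<^bsub>S\<^esub> Tm \<alpha> (IdT (IdT A a b) p q) \<Longrightarrow>
        \<Gamma> \<turnstile>\<^bsub>S\<^esub> TmEq \<alpha> (ReflT p) (IdT (IdT A a b) p q)"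
  \<comment> \<open>function extensionality\<close>
    and ext_intro:
      "A # \<Gamma> \<turnstile>\<^bsub>S\<^esub> Ty B \<Longrightarrow> \<Gamma> \<turnstile>\<^bsub>S\<^esub> Tm m (PiT A B) \<Longrightarrow> \<Gamma> \<turnstile>\<^bsub>S\<^esub> Tm n (PiT A B) \<Longrightarrow>
        A # \<Gamma> \<turnstile>\<^bsub>S\<^esub> Tm p (IdT B (AppT (lift 1 m) (Var 0)) (AppT (lift 1 n) (Var 0))) \<Longrightarrow>
        \<Gamma> \<turnstile>\<^bsub>S\<^esub> Tm (ExtT m n p) (IdT (PiT A B) m n)"
    and ext_intro_cong:
      "A # \<Gamma> \<turnstile>\<^bsub>S\<^esub> Ty B \<Longrightarrow> \<Gamma> \<turnstile>\<^bsub>S\<^esub> TmEq m m' (PiT A B) \<Longrightarrow> \<Gamma> \<turnstile>\<^bsub>S\<^esub> TmEq n n' (PiT A B) \<Longrightarrow>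
        A # \<Gamma> \<turnstile>\<^bsub>S\<^esub> TmEq p p' (IdT B (AppT (lift 1 m) (Var 0)) (AppT (lift 1 n) (Var 0))) \<Longrightarrow>
        \<Gamma> \<turnstile>\<^bsub>S\<^esub> TmEq (ExtT m n p) (ExtT m' n' p') (IdT (PiT A B) m n)"
    and ext_refl:
      "A # \<Gamma> \<turnstile>\<^bsub>S\<^esub> Ty B \<Longrightarrow> \<Gamma> \<turnstile>\<^bsub>S\<^esub> Tm m (PiT A B) \<Longrightarrow>
        \<Gamma> \<turnstile>\<^bsub>S\<^esub> TmEq (ExtT m m (ReflT (AppT (lift 1 m) (Var 0)))) (ReflT m) (IdT (PiT A B) m m)"
    and ext_app:
      "A # \<Gamma> \<turnstile>\<^bsub>S\<^esub> Ty B \<Longrightarrow> \<Gamma> \<turnstile>\<^bsub>S\<^esub> Tm m (PiT A B) \<Longrightarrow> \<Gamma> \<turnstile>\<^bsub>S\<^esub> Tm n (PiT A B) \<Longrightarrow>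
        A # \<Gamma> \<turnstile>\<^bsub>S\<^esub> Tm p (IdT B (AppT (lift 1 m) (Var 0)) (AppT (lift 1 n) (Var 0))) \<Longrightarrow>
        A # \<Gamma> \<turnstile>\<^bsub>S\<^esub> TmEq (happ (lift 1 m) (lift 1 n) (lift 1 (ExtT m n p)) (Var 0)) p
          (IdT B (AppT (lift 1 m) (Var 0)) (AppT (lift 1 n) (Var 0)))"


section \<open>Identity contexts\<close>

fun lams :: "nat \<Rightarrow> 's expr \<Rightarrow> 's expr" where
  "lams 0 e = e"
| "lams (Suc n) e = lams n (LamT e)"

fun apps :: "'s expr \<Rightarrow> 's expr list \<Rightarrow> 's expr" where
  "apps m [] = m"
| "apps m (t # ts) = AppT (apps m ts) t"

text \<open>
  Extended identity elimination: \<open>d\<close> lives in a context \<open>x : A, \<Delta>[x, x, r(x)]\<close> with \<open>\<Delta>\<close> of length \<open>n\<close>, and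
  \<open>\<delta>\<close> is a list of terms for \<open>\<Delta>[a, b, p]\<close>.
\<close>

definition J_ext :: "nat \<Rightarrow> 's expr \<Rightarrow> 's expr \<Rightarrow> 's expr \<Rightarrow> 's expr \<Rightarrow> 's expr list \<Rightarrow> 's expr" where
  "J_ext n d a b p \<delta> = apps (JT (lams n d) a b p) \<delta>"

text \<open>
  Elimination for the identity context of \<open>\<Phi>\<close> with a post-context \<open>\<Delta>\<close> of length \<open>n\<close>, into a context. The
  list \<open>ds\<close> has its components in context \<open>x : \<Phi>, \<Delta>[x, x, r(x)]\<close>. For \<open>\<Phi> = (x : \<Lambda>, y : D(x))\<close>, the terms
  \<open>d'\<close> of the recursive call live in context \<open>x : \<Lambda>, y : D(x), y' : D(x), q : Id(y, y'), \<Delta>\<close>, in which the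
  variables \<open>y, y', q\<close> are \<open>Var (n + 2), Var (n + 1), Var n\<close>; they come from elimination for the single
  type \<open>D(x)\<close> applied to \<open>ds\<close>, which is componentwise. The call then eliminates over \<open>\<Lambda>\<close> with post-context
  \<open>y, y', q, \<Delta>\<close>. In the last equation the identity context is the empty one.
\<close>

fun J_ctx :: "nat \<Rightarrow> 's expr list \<Rightarrow> 's expr list \<Rightarrow> 's expr list \<Rightarrow> 's expr list \<Rightarrow> 's expr list \<Rightarrow> 's expr list"
  where
  "J_ctx n ds (y # xs) (y' # xs') (q # ps) \<delta> =
    J_ctx (n + 3)
      (map (\<lambda>d. J_ext n (wk (n + 1) (n + 3) d) (Var (n + 2)) (Var (n + 1)) (Var n) (map Var [0..<n])) ds)
      xs xs' ps (\<delta> @ [q, y', y])"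
| "J_ctx n ds _ _ _ \<delta> = map (inst 0 \<delta>) ds"

text \<open>The transport \<open>p\<^sup>*(z) : \<Upsilon>(x)\<close> of \<open>z : \<Upsilon>(x')\<close> along \<open>p : Id(x, x')\<close>.\<close>

definition transport :: "'s expr list \<Rightarrow> 's expr list \<Rightarrow> 's expr list \<Rightarrow> 's expr \<Rightarrow> 's expr" where
  "transport xs xs' ps z = hd (J_ctx 1 [Var 0] xs xs' ps [z])"

text \<open>\<open>Id_ctx \<Phi> xs xs'\<close> is a telescope over the ambient context of \<open>xs\<close> and \<open>xs'\<close>.\<close>

fun Id_ctx :: "'s expr list \<Rightarrow> 's expr list \<Rightarrow> 's expr list \<Rightarrow> 's expr list" where
  "Id_ctx (D # \<Lambda>) (y # xs) (y' # xs') =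
    (let k = length \<Lambda> in
      IdT (lift k (inst 0 xs D)) (lift k y)
        (transport (map (lift k) xs) (map (lift k) xs') (map Var [0..<k]) (lift k y'))
      # Id_ctx \<Lambda> xs xs')"
| "Id_ctx _ _ _ = []"

text \<open>
  \<open>comp_ctx ys zs qs ps\<close> is \<open>q \<circ> p : Id(x, z)\<close> for \<open>p : Id(x, y)\<close> and \<open>q : Id(y, z)\<close>, by elimination on \<open>q\<close>
  with post-context \<open>p\<close>; \<open>ap_ctx h xs ys ps\<close> is \<open>h\<^sup>\<bullet>(p) : Id(h x, h y)\<close> for \<open>p : Id(x, y)\<close>, where \<open>h\<close> is a
  list of terms in the context to which \<open>x\<close> and \<open>y\<close> belong.
\<close>

definition comp_ctx :: "'s expr list \<Rightarrow> 's expr list \<Rightarrow> 's expr list \<Rightarrow> 's expr list \<Rightarrow> 's expr list" where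
  "comp_ctx ys zs qs ps = J_ctx (length ps) (map Var [0..<length ps]) ys zs qs ps"

definition ap_ctx :: "'s expr list \<Rightarrow> 's expr list \<Rightarrow> 's expr list \<Rightarrow> 's expr list \<Rightarrow> 's expr list" where
  "ap_ctx h xs ys ps = J_ctx 0 (map ReflT h) xs ys ps []"


section \<open>2-categories\<close>

text \<open>
  Hom-sets and operations are indexed by the relevant objects (and 1-cells), so hom-sets need not be
  disjoint. In \<open>Cmp C a b c g f\<close> the arrows are \<open>f : a \<rightarrow> b\<close> and \<open>g : b \<rightarrow> c\<close>.
\<close>

record ('o, 'a) cat =
  Ob :: "'o set"
  Hom :: "'o \<Rightarrow> 'o \<Rightarrow> 'a set"
  Idt :: "'o \<Rightarrow> 'a"
  Cmp :: "'o \<Rightarrow> 'o \<Rightarrow> 'o \<Rightarrow> 'a \<Rightarrow> 'a \<Rightarrow> 'a"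

definition category :: "('o, 'a) cat \<Rightarrow> bool" where
  "category C \<longleftrightarrow>
    (\<forall>a\<in>Ob C. Idt C a \<in> Hom C a a) \<and>
    (\<forall>a\<in>Ob C. \<forall>b\<in>Ob C. \<forall>c\<in>Ob C. \<forall>f\<in>Hom C a b. \<forall>g\<in>Hom C b c. Cmp C a b c g f \<in> Hom C a c) \<and>
    (\<forall>a\<in>Ob C. \<forall>b\<in>Ob C. \<forall>f\<in>Hom C a b. Cmp C a a b f (Idt C a) = f \<and> Cmp C a b b (Idt C b) f = f) \<and>
    (\<forall>a\<in>Ob C. \<forall>b\<in>Ob C. \<forall>c\<in>Ob C. \<forall>d\<in>Ob C. \<forall>f\<in>Hom C a b. \<forall>g\<in>Hom C b c. \<forall>h\<in>Hom C c d.
      Cmp C a c d h (Cmp C a b c g f) = Cmp C a b d (Cmp C b c d h g) f)"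

record ('o, 'a, 'p, 'b) functor_data =
  FOb :: "'o \<Rightarrow> 'p"
  FHom :: "'o \<Rightarrow> 'o \<Rightarrow> 'a \<Rightarrow> 'b"

definition is_functor :: "('o, 'a) cat \<Rightarrow> ('p, 'b) cat \<Rightarrow> ('o, 'a, 'p, 'b) functor_data \<Rightarrow> bool" where
  "is_functor C D P \<longleftrightarrow>
    (\<forall>a\<in>Ob C. FOb P a \<in> Ob D) \<and>
    (\<forall>a\<in>Ob C. \<forall>b\<in>Ob C. \<forall>f\<in>Hom C a b. FHom P a b f \<in> Hom D (FOb P a) (FOb P b)) \<and>
    (\<forall>a\<in>Ob C. FHom P a a (Idt C a) = Idt D (FOb P a)) \<and>
    (\<forall>a\<in>Ob C. \<forall>b\<in>Ob C. \<forall>c\<in>Ob C. \<forall>f\<in>Hom C a b. \<forall>g\<in>Hom C b c.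
      FHom P a c (Cmp C a b c g f) =
        Cmp D (FOb P a) (FOb P b) (FOb P c) (FHom P b c g) (FHom P a b f))"

definition functor_comp ::
  "('p, 'b, 'q, 'c) functor_data \<Rightarrow> ('o, 'a, 'p, 'b) functor_data \<Rightarrow> ('o, 'a, 'q, 'c) functor_data" where
  "functor_comp Q P =
    \<lparr> FOb = (\<lambda>a. FOb Q (FOb P a)),
      FHom = (\<lambda>a b f. FHom Q (FOb P a) (FOb P b) (FHom P a b f)) \<rparr>"

definition functor_id :: "('o, 'a, 'o, 'a) functor_data" where
  "functor_id = \<lparr> FOb = (\<lambda>a. a), FHom = (\<lambda>a b f. f) \<rparr>"

definition functor_eq ::
  "('o, 'a) cat \<Rightarrow> ('o, 'a, 'p, 'b) functor_data \<Rightarrow> ('o, 'a, 'p, 'b) functor_data \<Rightarrow> bool" where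
  "functor_eq C P Q \<longleftrightarrow>
    (\<forall>a\<in>Ob C. FOb P a = FOb Q a) \<and>
    (\<forall>a\<in>Ob C. \<forall>b\<in>Ob C. \<forall>f\<in>Hom C a b. FHom P a b f = FHom Q a b f)"

definition natural_iso ::
  "('o, 'a) cat \<Rightarrow> ('p, 'b) cat \<Rightarrow> ('o, 'a, 'p, 'b) functor_data \<Rightarrow> ('o, 'a, 'p, 'b) functor_data \<Rightarrow>
    ('o \<Rightarrow> 'b) \<Rightarrow> bool" where
  "natural_iso C D P Q \<theta> \<longleftrightarrow>
    (\<forall>a\<in>Ob C. \<theta> a \<in> Hom D (FOb P a) (FOb Q a)) \<and>
    (\<forall>a\<in>Ob C. \<forall>b\<in>Ob C. \<forall>f\<in>Hom C a b.
      Cmp D (FOb P a) (FOb P b) (FOb Q b) (\<theta> b) (FHom P a b f) =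
      Cmp D (FOb P a) (FOb Q a) (FOb Q b) (FHom Q a b f) (\<theta> a)) \<and>
    (\<forall>a\<in>Ob C. \<exists>\<phi>\<in>Hom D (FOb Q a) (FOb P a).
      Cmp D (FOb P a) (FOb Q a) (FOb P a) \<phi> (\<theta> a) = Idt D (FOb P a) \<and>
      Cmp D (FOb Q a) (FOb P a) (FOb Q a) (\<theta> a) \<phi> = Idt D (FOb Q a))"

definition surjective_equivalence ::
  "('o, 'a) cat \<Rightarrow> ('p, 'b) cat \<Rightarrow> ('o, 'a, 'p, 'b) functor_data \<Rightarrow> bool" where
  "surjective_equivalence C D P \<longleftrightarrow>
    category C \<and> category D \<and> is_functor C D P \<and>
    (\<exists>I \<theta>. is_functor D C I \<and> functor_eq D (functor_comp P I) functor_id \<and>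
      natural_iso C C functor_id (functor_comp I P) \<theta> \<and>
      (\<forall>d\<in>Ob D. \<theta> (FOb I d) = Idt C (FOb I d)) \<and>
      (\<forall>c\<in>Ob C. FHom P c (FOb I (FOb P c)) (\<theta> c) = Idt D (FOb P c)))"

text \<open>
  The data of a 2-category. \<open>whisk_r K X Y Z f g \<alpha> k\<close> is \<open>\<alpha> k : f k \<Rightarrow> g k\<close> for \<open>k : X \<rightarrow> Y\<close> and
  \<open>\<alpha> : f \<Rightarrow> g : Y \<rightarrow> Z\<close>; \<open>whisk_l K X Y Z h f g \<alpha>\<close> is \<open>h \<alpha> : h f \<Rightarrow> h g\<close> for \<open>\<alpha> : f \<Rightarrow> g : X \<rightarrow> Y\<close> and
  \<open>h : Y \<rightarrow> Z\<close>.
\<close>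

record ('o, 'm, 'c) two_cat =
  Ob2 :: "'o set"
  Hom2 :: "'o \<Rightarrow> 'o \<Rightarrow> ('m, 'c) cat"
  Id1 :: "'o \<Rightarrow> 'm"
  Cmp1 :: "'o \<Rightarrow> 'o \<Rightarrow> 'o \<Rightarrow> 'm \<Rightarrow> 'm \<Rightarrow> 'm"
  whisk_r :: "'o \<Rightarrow> 'o \<Rightarrow> 'o \<Rightarrow> 'm \<Rightarrow> 'm \<Rightarrow> 'c \<Rightarrow> 'm \<Rightarrow> 'c"
  whisk_l :: "'o \<Rightarrow> 'o \<Rightarrow> 'o \<Rightarrow> 'm \<Rightarrow> 'm \<Rightarrow> 'm \<Rightarrow> 'c \<Rightarrow> 'c"

record ('o, 'm, 'c, 'p, 'n, 'd) two_functor =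
  U_ob :: "'o \<Rightarrow> 'p"
  U_1 :: "'o \<Rightarrow> 'o \<Rightarrow> 'm \<Rightarrow> 'n"
  U_2 :: "'o \<Rightarrow> 'o \<Rightarrow> 'm \<Rightarrow> 'm \<Rightarrow> 'c \<Rightarrow> 'd"

text \<open>The functor \<open>K(F, y) \<rightarrow> L(x, U y)\<close> sending \<open>h\<close> to \<open>U h \<circ> \<eta>\<close>.\<close>

definition precomp_functor ::
  "('p, 'n, 'd) two_cat \<Rightarrow> ('o, 'm, 'c, 'p, 'n, 'd) two_functor \<Rightarrow> 'p \<Rightarrow> 'o \<Rightarrow> 'n \<Rightarrow> 'o \<Rightarrow>
    ('m, 'c, 'n, 'd) functor_data" where
  "precomp_functor L U x F \<eta> y =
    \<lparr> FOb = (\<lambda>h. Cmp1 L x (U_ob U F) (U_ob U y) (U_1 U F y h) \<eta>),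
      FHom = (\<lambda>h h' \<alpha>.
        whisk_r L x (U_ob U F) (U_ob U y) (U_1 U F y h) (U_1 U F y h') (U_2 U F y h h' \<alpha>) \<eta>) \<rparr>"

definition retract_bireflection ::
  "('o, 'm, 'c) two_cat \<Rightarrow> ('p, 'n, 'd) two_cat \<Rightarrow> ('o, 'm, 'c, 'p, 'n, 'd) two_functor \<Rightarrow>
    'p \<Rightarrow> 'o \<Rightarrow> 'n \<Rightarrow> bool" where
  "retract_bireflection K L U x F \<eta> \<longleftrightarrow>
    x \<in> Ob2 L \<and> F \<in> Ob2 K \<and> \<eta> \<in> Ob (Hom2 L x (U_ob U F)) \<and>
    (\<forall>y\<in>Ob2 K.
      surjective_equivalence (Hom2 K F y) (Hom2 L x (U_ob U y)) (precomp_functor L U x F \<eta> y))"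

text \<open>
  The slice 2-category: objects are pairs \<open>(X, f)\<close> with \<open>f : X \<rightarrow> c\<close>; a 2-cell \<open>\<alpha> : k \<Rightarrow> k'\<close> between
  1-cells over \<open>c\<close> must satisfy \<open>g \<alpha> = 1\<close>, where \<open>g\<close> is the structure map of the target.
\<close>

definition slice :: "('o, 'm, 'c) two_cat \<Rightarrow> 'o \<Rightarrow> ('o \<times> 'm, 'm, 'c) two_cat" where
  "slice K c =
    \<lparr> Ob2 = {(X, f). X \<in> Ob2 K \<and> f \<in> Ob (Hom2 K X c)},
      Hom2 = (\<lambda>(X, f) (Y, g).
        \<lparr> Ob = {k \<in> Ob (Hom2 K X Y). Cmp1 K X Y c g k = f},
          Hom = (\<lambda>k k'. {\<alpha> \<in> Hom (Hom2 K X Y) k k'. whisk_l K X Y c g k k' \<alpha> = Idt (Hom2 K X c) f}),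
          Idt = Idt (Hom2 K X Y),
          Cmp = Cmp (Hom2 K X Y) \<rparr>),
      Id1 = (\<lambda>(X, _). Id1 K X),
      Cmp1 = (\<lambda>(X, _) (Y, _) (Z, _). Cmp1 K X Y Z),
      whisk_r = (\<lambda>(X, _) (Y, _) (Z, _). whisk_r K X Y Z),
      whisk_l = (\<lambda>(X, _) (Y, _) (Z, _). whisk_l K X Y Z) \<rparr>"


section \<open>The 2-categories of a type theory\<close>

text \<open>
  Cells are equivalence classes of judgements modulo definitional equality; operations on them are
  computed on arbitrarily chosen representatives. Objects are represented by contexts and types
  themselves, since equality of objects is never used.
\<close>

definition rep :: "'a set \<Rightarrow> 'a" where
  "rep F = (SOME f. f \<in> F)"

definition el_class :: "'s ttheory \<Rightarrow> 's expr list \<Rightarrow> 's expr list \<Rightarrow> 's expr list \<Rightarrow> 's expr list set" where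
  "el_class S \<Gamma> \<Theta> ts = {us. el_eq S \<Gamma> \<Theta> ts us}"

definition tm_class :: "'s ttheory \<Rightarrow> 's expr list \<Rightarrow> 's expr \<Rightarrow> 's expr \<Rightarrow> 's expr set" where
  "tm_class S \<Gamma> A a = {b. \<Gamma> \<turnstile>\<^bsub>S\<^esub> TmEq a b A}"

definition ctx_hom :: "'s ttheory \<Rightarrow> 's expr list \<Rightarrow> 's expr list \<Rightarrow> ('s expr list set, 's expr list set) cat" where
  "ctx_hom S \<Gamma> \<Delta> =
    \<lparr> Ob = {el_class S \<Gamma> \<Delta> f |f. el S \<Gamma> \<Delta> f},
      Hom = (\<lambda>F G. {el_class S \<Gamma> (Id_ctx \<Delta> (rep F) (rep G)) \<alpha> |\<alpha>. el S \<Gamma> (Id_ctx \<Delta> (rep F) (rep G)) \<alpha>}),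
      Idt = (\<lambda>F. el_class S \<Gamma> (Id_ctx \<Delta> (rep F) (rep F)) (map ReflT (rep F))),
      Cmp = (\<lambda>F G H \<beta> \<alpha>.
        el_class S \<Gamma> (Id_ctx \<Delta> (rep F) (rep H)) (comp_ctx (rep G) (rep H) (rep \<beta>) (rep \<alpha>))) \<rparr>"

text \<open>The 2-category of contexts.\<close>

definition ctx_two_cat :: "'s ttheory \<Rightarrow> ('s expr list, 's expr list set, 's expr list set) two_cat" where
  "ctx_two_cat S =
    \<lparr> Ob2 = {\<Gamma>. ctx S \<Gamma>},
      Hom2 = ctx_hom S,
      Id1 = (\<lambda>\<Gamma>. el_class S \<Gamma> \<Gamma> (map Var [0..<length \<Gamma>])),
      Cmp1 = (\<lambda>\<Gamma> \<Delta> \<Theta> G F. el_class S \<Gamma> \<Theta> (map (inst 0 (rep F)) (rep G))),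
      whisk_r = (\<lambda>\<Gamma> \<Delta> \<Theta> F G \<alpha> K.
        el_class S \<Gamma>
          (Id_ctx \<Theta> (map (inst 0 (rep K)) (rep F)) (map (inst 0 (rep K)) (rep G)))
          (map (inst 0 (rep K)) (rep \<alpha>))),
      whisk_l = (\<lambda>\<Gamma> \<Delta> \<Theta> H F G \<alpha>.
        el_class S \<Gamma>
          (Id_ctx \<Theta> (map (inst 0 (rep F)) (rep H)) (map (inst 0 (rep G)) (rep H)))
          (ap_ctx (rep H) (rep F) (rep G) (rep \<alpha>))) \<rparr>"

text \<open>
  The fibre 2-category over \<open>\<Gamma>\<close>. Here \<open>J_ext 1 (Var 0) g h \<beta> [\<alpha>]\<close> is the composite \<open>\<beta> \<circ> \<alpha>\<close>, and
  \<open>J_ext 0 (ReflT (wk 1 1 h)) f g \<alpha> []\<close> is \<open>h(x, -)\<^sup>\<bullet>(\<alpha>)\<close>, with \<open>h\<close> over \<open>\<Gamma>, B\<close> weakened to \<open>\<Gamma>, A, B\<close>.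
\<close>

definition fibre_hom :: "'s ttheory \<Rightarrow> 's expr list \<Rightarrow> 's expr \<Rightarrow> 's expr \<Rightarrow> ('s expr set, 's expr set) cat" where
  "fibre_hom S \<Gamma> A B =
    \<lparr> Ob = {tm_class S (A # \<Gamma>) (lift 1 B) f |f. A # \<Gamma> \<turnstile>\<^bsub>S\<^esub> Tm f (lift 1 B)},
      Hom = (\<lambda>F G. {tm_class S (A # \<Gamma>) (IdT (lift 1 B) (rep F) (rep G)) \<alpha> |\<alpha>.
        A # \<Gamma> \<turnstile>\<^bsub>S\<^esub> Tm \<alpha> (IdT (lift 1 B) (rep F) (rep G))}),
      Idt = (\<lambda>F. tm_class S (A # \<Gamma>) (IdT (lift 1 B) (rep F) (rep F)) (ReflT (rep F))),
      Cmp = (\<lambda>F G H \<beta> \<alpha>.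
        tm_class S (A # \<Gamma>) (IdT (lift 1 B) (rep F) (rep H))
          (J_ext 1 (Var 0) (rep G) (rep H) (rep \<beta>) [rep \<alpha>])) \<rparr>"

definition fibre_two_cat :: "'s ttheory \<Rightarrow> 's expr list \<Rightarrow> ('s expr, 's expr set, 's expr set) two_cat" where
  "fibre_two_cat S \<Gamma> =
    \<lparr> Ob2 = {A. \<Gamma> \<turnstile>\<^bsub>S\<^esub> Ty A},
      Hom2 = fibre_hom S \<Gamma>,
      Id1 = (\<lambda>A. tm_class S (A # \<Gamma>) (lift 1 A) (Var 0)),
      Cmp1 = (\<lambda>A B C G F. tm_class S (A # \<Gamma>) (lift 1 C) (inst 1 [rep F] (rep G))),
      whisk_r = (\<lambda>A B C F G \<alpha> K.
        tm_class S (A # \<Gamma>) (IdT (lift 1 C) (inst 1 [rep K] (rep F)) (inst 1 [rep K] (rep G)))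
          (inst 1 [rep K] (rep \<alpha>))),
      whisk_l = (\<lambda>A B C H F G \<alpha>.
        tm_class S (A # \<Gamma>) (IdT (lift 1 C) (inst 1 [rep F] (rep H)) (inst 1 [rep G] (rep H)))
          (J_ext 0 (ReflT (wk 1 1 (rep H))) (rep F) (rep G) (rep \<alpha>) [])) \<rparr>"

text \<open>
  The variables of \<open>\<Gamma>\<close> in a context \<open>\<Gamma>.A\<close>, that is, the terms of the projection from \<open>\<Gamma>.A\<close> to \<open>\<Gamma>\<close>.
\<close>

definition proj :: "'s expr list \<Rightarrow> 's expr list" where
  "proj \<Gamma> = map Var [1..<length \<Gamma> + 1]"

definition E_functor :: "'s ttheory \<Rightarrow> 's expr list \<Rightarrow>
    ('s expr, 's expr set, 's expr set, 's expr list \<times> 's expr list set, 's expr list set, 's expr list set)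
      two_functor" where
  "E_functor S \<Gamma> =
    \<lparr> U_ob = (\<lambda>A. (A # \<Gamma>, el_class S (A # \<Gamma>) \<Gamma> (proj \<Gamma>))),
      U_1 = (\<lambda>A B F. el_class S (A # \<Gamma>) (B # \<Gamma>) (rep F # proj \<Gamma>)),
      U_2 = (\<lambda>A B F G \<alpha>.
        el_class S (A # \<Gamma>) (Id_ctx (B # \<Gamma>) (rep F # proj \<Gamma>) (rep G # proj \<Gamma>))
          (rep \<alpha> # map ReflT (proj \<Gamma>))) \<rparr>"

end

theory Submission
  imports Defs
begin

text \<open>
  Composition with \<open>\<eta> = (x, \<star>)\<close> evaluates terms over \<open>\<Gamma>, z : 1\<close> at \<open>z = \<star>\<close>. Weakening is a strict section
  of it, and unit elimination from \<open>\<theta>(\<star>) = r(f(\<star>))\<close> gives the isomorphism \<open>\<theta>(z) : Id(f(z), f(\<star>))\<close>.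
  By discreteness of identity types, every elimination rule is also a uniqueness principle: two
  terms of an identity type are definitionally equal as soon as they agree on the canonical elements of
  the eliminated type. This yields all equations between 2-cells. In particular \<open>\<pi>\<^sup>\<bullet>(p, q) = p\<close> for the projection
  \<open>\<pi>\<close> from \<open>\<Gamma>.B\<close>, so the 2-cells of the slice between sections of \<open>\<pi>\<close> are exactly the vertical ones
  \<open>(r, q)\<close>, and these compose as the identifications \<open>q\<close> do. Hence the hom-category from the identity to \<open>\<pi>\<close>
  is the category of terms of type \<open>B\<close> over \<open>\<Gamma>\<close>.
\<close>

section \<open>Substitution calculus\<close>

text \<open>Two features of the setting shape the work. Elimination for an identity context is a
  recursion on raw syntax whose post-context grows by three variables at every step. To type it by
  induction, end points and identifications are interleaved in one context
  \<open>U \<Lambda>\<close>, over which \<open>J_ctx\<close> becomes the iterate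
  \<open>J_iter\<close> of a single-type elimination. The second feature is that operations on cells
  are computed on arbitrarily chosen representatives: boundaries agree only up to definitional
  equality, and every formula has to be shown independent of the choice. Here
  \<open>U \<Lambda>\<close> helps again, since a vector for it is an identification together with
  its end points, so that one equality of vectors compares cells and boundaries at once. Transport
  along reflexivity is likewise the identity only definitionally, so vertical identifications
  receive their plain identity type by conversion. To keep this bookkeeping away from the
  categorical argument, both hom-categories are presented by the predicate \<open>term_cat\<close>,
  and the surjective equivalence is proved for any categories so presented.\<close>

lemma up_sub_comp_Var: "up_sub n (\<lambda>i. Var (f i)) = (\<lambda>i. Var (up_ren n f i))"
  by (auto simp: up_sub_def up_ren_def wk_def)

lemma ren_eq_sub: "ren f e = sub (\<lambda>i. Var (f i)) e"
proof (induction e arbitrary: f)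
  case (OpT c as)
  then show ?case by (fastforce simp: up_sub_comp_Var)
qed (simp_all add: up_sub_comp_Var)

lemma up_sub_up_ren: "(\<lambda>i. up_sub n \<sigma> (up_ren n f i)) = up_sub n (\<lambda>i. \<sigma> (f i))"
  by (auto simp: up_sub_def up_ren_def)

text \<open>\<open>up_sub\<close> weakens by a renaming, so pushing a substitution under a binder
  needs the mixed laws for \<open>ren\<close> and \<open>sub\<close> before the law for two
  substitutions; hence the order of the composition laws.\<close>

lemma sub_ren: "sub \<sigma> (ren f e) = sub (\<lambda>i. \<sigma> (f i)) e"
proof (induction e arbitrary: f \<sigma>)
  case (OpT c as)
  then show ?case by (fastforce simp: up_sub_up_ren)
qed (simp_all add: up_sub_up_ren)

lemma ren_ren: "ren f (ren g e) = ren (\<lambda>i. f (g i)) e"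
  by (simp add: ren_eq_sub[of f] sub_ren) (simp add: ren_eq_sub)

lemma ren_up_sub: "(\<lambda>i. ren (up_ren n f) (up_sub n \<sigma> i)) = up_sub n (\<lambda>i. ren f (\<sigma> i))"
  by (auto simp: up_sub_def up_ren_def wk_def ren_ren)

lemma ren_sub: "ren f (sub \<sigma> e) = sub (\<lambda>i. ren f (\<sigma> i)) e"
proof (induction e arbitrary: f \<sigma>)
  case (OpT c as)
  then show ?case by (fastforce simp: ren_up_sub)
qed (simp_all add: ren_up_sub)

lemma sub_up_sub: "(\<lambda>i. sub (up_sub n \<sigma>) (up_sub n \<tau> i)) = up_sub n (\<lambda>i. sub \<sigma> (\<tau> i))"
  by (rule ext) (simp add: up_sub_def wk_def sub_ren ren_sub)

lemma sub_sub: "sub \<sigma> (sub \<tau> e) = sub (\<lambda>i. sub \<sigma> (\<tau> i)) e"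
proof (induction e arbitrary: \<sigma> \<tau>)
  case (OpT c as)
  then show ?case by (fastforce simp: sub_up_sub)
qed (simp_all add: sub_up_sub)

lemma up_sub_Var [simp]: "up_sub n Var = Var"
  by (auto simp: up_sub_def wk_def)

lemma sub_Var [simp]: "sub Var e = e"
proof (induction e)
  case (OpT c as)
  then show ?case by (auto intro!: map_idI)
qed simp_all

lemma sub_cong: "(\<And>i. \<sigma> i = \<tau> i) \<Longrightarrow> sub \<sigma> e = sub \<tau> e"
  by (metis ext)

lemma sub_id: "(\<And>i. \<sigma> i = Var i) \<Longrightarrow> sub \<sigma> e = e"
  using sub_cong[of \<sigma> Var] by simp

text \<open>The tail of a substitution is invisible to a scoped expression. This lets closed
  contexts move between ambient contexts without reindexing. Each binder raises \<open>n\<close> by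
  its arity, matching \<open>up_sub\<close>.\<close>

lemma sub_cong_scoped:
  "scoped n e \<Longrightarrow> (\<And>i. i < n \<Longrightarrow> \<sigma> i = \<tau> i) \<Longrightarrow> sub \<sigma> e = sub \<tau> e"
proof (induction e arbitrary: n \<sigma> \<tau>)
  case (OpT c as)
  have "sub (up_sub m \<sigma>) e = sub (up_sub m \<tau>) e" if "(m, e) \<in> set as" for m e
    using that OpT.prems by (intro OpT.IH[of "(m, e)" e "n + m"]) (auto simp: up_sub_def)
  then show ?case by auto
next
  case (SplitT d c)
  from SplitT.prems show ?case
    by (auto intro!: SplitT.IH(1)[of "n + 2"] SplitT.IH(2)[of n] simp: up_sub_def)
next
  case (SigT A B)
  from SigT.prems show ?case
    by (auto intro!: SigT.IH(1)[of n] SigT.IH(2)[of "n + 1"] simp: up_sub_def)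
next
  case (PiT A B)
  from PiT.prems show ?case
    by (auto intro!: PiT.IH(1)[of n] PiT.IH(2)[of "n + 1"] simp: up_sub_def)
next
  case (LamT t)
  from LamT.prems show ?case
    by (auto intro!: LamT.IH(1)[of "n + 1"] simp: up_sub_def)
next
  case (JT d a b p)
  from JT.prems show ?case
    by (auto intro!: JT.IH(1)[of "n + 1"] JT.IH(2-)[of n] simp: up_sub_def)
next
  case (ExtT l m p)
  from ExtT.prems show ?case
    by (auto intro!: ExtT.IH(3)[of "n + 1"] ExtT.IH(1,2)[of n] simp: up_sub_def)
next
  case (PairT a b) from PairT.prems show ?case by (auto intro!: PairT.IH(1,2)[of n])
next
  case (UnitElimT a b) from UnitElimT.prems show ?case by (auto intro!: UnitElimT.IH(1,2)[of n])
next
  case (IdT A a b) from IdT.prems show ?case by (auto intro!: IdT.IH(1-)[of n])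
next
  case (ReflT a) from ReflT.prems show ?case by (auto intro!: ReflT.IH(1-)[of n])
next
  case (AppT a b) from AppT.prems show ?case by (auto intro!: AppT.IH(1-)[of n])
qed auto

section \<open>Weakening as substitution, and substitutions given by a list and a tail\<close>

lemma wk_eq_sub: "wk c m = sub (\<lambda>i. if i < c then Var i else Var (i + m))"
  by (rule ext) (simp add: wk_def ren_eq_sub if_distrib cong: if_cong)

lemma wk_Var [simp]: "wk c m (Var i) = Var (if i < c then i else i + m)"
  by (simp add: wk_def)

lemma lift_sub: "lift n (sub \<sigma> e) = sub (\<lambda>i. lift n (\<sigma> i)) e"
  by (simp add: wk_eq_sub sub_sub)

lemma lift_lift: "lift m (lift n e) = lift (m + n) e"
  by (simp add: wk_eq_sub sub_sub add_ac)

lemma lift_0 [simp]: "lift 0 e = e"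
  by (simp add: wk_eq_sub)

lemma sub_lift: "sub \<sigma> (lift n e) = sub (\<lambda>i. \<sigma> (i + n)) e"
  by (simp add: wk_eq_sub sub_sub)

lemma sub_up_sub_lift: "sub (up_sub n \<sigma>) (lift n e) = lift n (sub \<sigma> e)"
  by (simp add: sub_lift lift_sub up_sub_def)

lemma up_sub_0 [simp]: "up_sub 0 \<sigma> = \<sigma>"
  by (auto simp: up_sub_def)

lemma up_sub_up_sub: "up_sub m (up_sub n \<sigma>) = up_sub (m + n) \<sigma>"
  by (rule ext) (auto simp: up_sub_def lift_lift)

definition scons :: "'s expr \<Rightarrow> (nat \<Rightarrow> 's expr) \<Rightarrow> nat \<Rightarrow> 's expr" where
  "scons t \<sigma> i = (case i of 0 \<Rightarrow> t | Suc j \<Rightarrow> \<sigma> j)"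

lemma scons_simps [simp]: "scons t \<sigma> 0 = t" "scons t \<sigma> (Suc i) = \<sigma> i"
  by (simp_all add: scons_def)

text \<open>Common form of all instantiations: with tail \<open>Var\<close> it is
  \<open>inst 0 ts\<close>, with tail a shift by one it is \<open>inst 1 ts\<close>, and a general
  tail substitutes in the ambient context at the same time.\<close>

definition lsub :: "'s expr list \<Rightarrow> (nat \<Rightarrow> 's expr) \<Rightarrow> nat \<Rightarrow> 's expr" where
  "lsub ts \<sigma> i = (if i < length ts then ts ! i else \<sigma> (i - length ts))"

lemma lsub_Nil [simp]: "lsub [] \<sigma> = \<sigma>"
  by (auto simp: lsub_def)

lemma lsub_Cons: "lsub (t # ts) \<sigma> = scons t (lsub ts \<sigma>)"
proof
  show "lsub (t # ts) \<sigma> i = scons t (lsub ts \<sigma>) i" for i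
    by (cases i) (auto simp: lsub_def)
qed

lemma lsub_append: "lsub (ts @ us) \<sigma> = lsub ts (lsub us \<sigma>)"
  by (rule ext) (auto simp: lsub_def nth_append)

lemma inst_eq_sub: "inst 0 ts = sub (lsub ts Var)"
  unfolding inst_def by (rule arg_cong[of _ _ sub]) (auto simp: lsub_def)

lemma sub_lsub: "(\<lambda>i. sub \<tau> (lsub ts \<sigma> i)) = lsub (map (sub \<tau>) ts) (\<lambda>i. sub \<tau> (\<sigma> i))"
  by (auto simp: lsub_def)

lemma lsub_shift: "(\<lambda>i. lsub ts \<sigma> (i + length ts)) = \<sigma>"
  by (auto simp: lsub_def)

lemma sub_lsub_lift: "sub (lsub ts \<sigma>) (lift (length ts) e) = sub \<sigma> e"
  by (simp add: sub_lift lsub_shift)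

lemma sub_lsub_up_sub: "length ts = n \<Longrightarrow> (\<lambda>i. sub (lsub ts \<sigma>) (up_sub n \<tau> i)) = lsub ts (\<lambda>i. sub \<sigma> (\<tau> i))"
  by (rule ext) (auto simp: up_sub_def sub_lsub_lift, auto simp: lsub_def)

lemma up_sub_Suc: "up_sub (Suc n) \<sigma> = scons (Var 0) (\<lambda>i. lift 1 (up_sub n \<sigma> i))"
  by (rule ext) (auto simp: scons_def up_sub_def lift_lift split: nat.split)

lemma inst_lift: "inst 0 [t] (lift 1 e) = e"
  using sub_lsub_lift[of "[t]"] by (simp add: inst_eq_sub)

fun subT :: "(nat \<Rightarrow> 's expr) \<Rightarrow> 's expr list \<Rightarrow> 's expr list" where
  "subT \<sigma> [] = []"
| "subT \<sigma> (D # \<Theta>) = sub (up_sub (length \<Theta>) \<sigma>) D # subT \<sigma> \<Theta>"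

lemma length_subT [simp]: "length (subT \<sigma> \<Theta>) = length \<Theta>"
  by (induction \<Theta>) auto

lemma subT_subT: "subT \<sigma> (subT \<tau> \<Theta>) = subT (\<lambda>i. sub \<sigma> (\<tau> i)) \<Theta>"
  by (induction \<Theta>) (auto simp: sub_sub sub_up_sub)

lemma subT_Var [simp]: "subT Var \<Theta> = \<Theta>"
  by (induction \<Theta>) auto

lemma subT_append: "subT \<sigma> (\<Theta> @ \<Delta>) = subT (up_sub (length \<Delta>) \<sigma>) \<Theta> @ subT \<sigma> \<Delta>"
  by (induction \<Theta>) (auto simp: up_sub_up_sub)

section \<open>Typed substitutions\<close>

text \<open>Typed substitutions are total functions constrained only on the variables of
  \<open>\<Delta>\<close>. Composition and lifting under binders are then plain operations on
  functions, and lists of terms reenter through \<open>lsub\<close>.\<close>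

definition msub :: "'s ttheory \<Rightarrow> 's expr list \<Rightarrow> (nat \<Rightarrow> 's expr) \<Rightarrow> 's expr list \<Rightarrow> bool" where
  "msub S \<Gamma> \<sigma> \<Delta> \<longleftrightarrow> ctx S \<Gamma> \<and> (\<forall>i < length \<Delta>. \<Gamma> \<turnstile>\<^bsub>S\<^esub> Tm (\<sigma> i) (sub \<sigma> (lift (i + 1) (\<Delta> ! i))))"

definition msub_eq ::
  "'s ttheory \<Rightarrow> 's expr list \<Rightarrow> (nat \<Rightarrow> 's expr) \<Rightarrow> (nat \<Rightarrow> 's expr) \<Rightarrow> 's expr list \<Rightarrow> bool" where
  "msub_eq S \<Gamma> \<sigma> \<tau> \<Delta> \<longleftrightarrow>
    ctx S \<Gamma> \<and> (\<forall>i < length \<Delta>. \<Gamma> \<turnstile>\<^bsub>S\<^esub> TmEq (\<sigma> i) (\<tau> i) (sub \<sigma> (lift (i + 1) (\<Delta> ! i))))"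

lemma msub_Nil [simp]: "msub S \<Gamma> \<sigma> [] \<longleftrightarrow> ctx S \<Gamma>"
  by (simp add: msub_def)

lemma all_less_Suc_length: "(\<forall>i < Suc n. P i) \<longleftrightarrow> P 0 \<and> (\<forall>i < n. P (Suc i))"
  using less_Suc_eq_0_disj by auto

lemma msub_Cons:
  "msub S \<Gamma> \<sigma> (A # \<Delta>) \<longleftrightarrow>
    msub S \<Gamma> (\<lambda>i. \<sigma> (Suc i)) \<Delta> \<and> (\<Gamma> \<turnstile>\<^bsub>S\<^esub> Tm (\<sigma> 0) (sub (\<lambda>i. \<sigma> (Suc i)) A))"
  by (auto simp: msub_def all_less_Suc_length sub_lift)

lemma msub_scons:
  "msub S \<Gamma> (scons t \<sigma>) (A # \<Delta>) \<longleftrightarrow> msub S \<Gamma> \<sigma> \<Delta> \<and> (\<Gamma> \<turnstile>\<^bsub>S\<^esub> Tm t (sub \<sigma> A))"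
  by (simp add: msub_Cons)

lemma msub_eq_Nil [simp]: "msub_eq S \<Gamma> \<sigma> \<tau> [] \<longleftrightarrow> ctx S \<Gamma>"
  by (simp add: msub_eq_def)

lemma msub_eq_Cons:
  "msub_eq S \<Gamma> \<sigma> \<tau> (A # \<Delta>) \<longleftrightarrow>
    msub_eq S \<Gamma> (\<lambda>i. \<sigma> (Suc i)) (\<lambda>i. \<tau> (Suc i)) \<Delta> \<and>
    (\<Gamma> \<turnstile>\<^bsub>S\<^esub> TmEq (\<sigma> 0) (\<tau> 0) (sub (\<lambda>i. \<sigma> (Suc i)) A))"
  by (auto simp: msub_eq_def all_less_Suc_length sub_lift)

lemma msub_eq_scons:
  "msub_eq S \<Gamma> (scons t \<sigma>) (scons u \<tau>) (A # \<Delta>) \<longleftrightarrow>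
    msub_eq S \<Gamma> \<sigma> \<tau> \<Delta> \<and> (\<Gamma> \<turnstile>\<^bsub>S\<^esub> TmEq t u (sub \<sigma> A))"
  by (simp add: msub_eq_Cons)

lemma ctx_appendD: "ctx S (\<Theta> @ \<Gamma>) \<Longrightarrow> ctx S \<Gamma>"
  by (induction \<Theta>) auto

text \<open>Bridge between the two presentations: a list for the telescope \<open>\<Theta>\<close>,
  with its types substituted along \<sigma>, extends \<sigma> to the longer context.\<close>

lemma msub_lsub:
  "length ts = length \<Theta> \<Longrightarrow>
    msub S \<Gamma> (lsub ts \<sigma>) (\<Theta> @ \<Delta>) \<longleftrightarrow> el S \<Gamma> (subT \<sigma> \<Theta>) ts \<and> msub S \<Gamma> \<sigma> \<Delta>"
proof (induction \<Theta> ts rule: list_induct2')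
  case (4 D \<Theta> t ts)
  then show ?case
    by (auto simp: lsub_Cons msub_scons inst_eq_sub sub_sub sub_lsub_up_sub)
qed auto

lemma msub_eq_lsub:
  "length ts = length \<Theta> \<Longrightarrow> length us = length \<Theta> \<Longrightarrow>
    msub_eq S \<Gamma> (lsub ts \<sigma>) (lsub us \<tau>) (\<Theta> @ \<Delta>) \<longleftrightarrow>
    el_eq S \<Gamma> (subT \<sigma> \<Theta>) ts us \<and> msub_eq S \<Gamma> \<sigma> \<tau> \<Delta>"
proof (induction \<Theta> arbitrary: ts us)
  case (Cons D \<Theta>)
  from Cons.prems obtain t ts' u us' where "ts = t # ts'" "us = u # us'"
    by (auto simp: length_Suc_conv)
  with Cons show ?case
    by (auto simp: lsub_Cons msub_eq_scons inst_eq_sub sub_sub sub_lsub_up_sub)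
qed auto

lemma el_length: "el S \<Gamma> \<Theta> ts \<Longrightarrow> length ts = length \<Theta>"
  by (induction S \<Gamma> \<Theta> ts rule: el.induct) auto

lemma el_eq_length: "el_eq S \<Gamma> \<Theta> ts us \<Longrightarrow> length ts = length \<Theta> \<and> length us = length \<Theta>"
  by (induction S \<Gamma> \<Theta> ts us rule: el_eq.induct) auto

context dependent_type_theory
begin

abbreviation derives_S (infix "\<turnstile>" 50) where
  "\<Gamma> \<turnstile> J \<equiv> \<Gamma> \<turnstile>\<^bsub>S\<^esub> J"

lemma presup_Ty_ctx: "\<Gamma> \<turnstile> Ty A \<Longrightarrow> ctx S (A # \<Gamma>)"
  using presup_ctx by auto

lemma ctx_scoped: "ctx S (\<Theta> @ D # \<Lambda>) \<Longrightarrow> scoped (length \<Lambda>) D"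
  using scope ctx_appendD[of S \<Theta>] by fastforce

text \<open>An entry of a context is scoped by its predecessors, so its substituted type reads only
  the values on declared variables.\<close>

lemma sub_ctx_irrelevant:
  assumes "ctx S \<Lambda>" and "\<And>i. i < length \<Lambda> \<Longrightarrow> \<sigma> i = \<tau> i"
  shows "msub S \<Gamma> \<sigma> \<Lambda> \<longleftrightarrow> msub S \<Gamma> \<tau> \<Lambda>"
  using assms
proof (induction \<Lambda> arbitrary: \<sigma> \<tau>)
  case (Cons D \<Lambda>)
  have sc: "scoped (length \<Lambda>) D"
    using ctx_scoped[of "[]"] Cons.prems by auto
  have "sub (\<lambda>i. \<sigma> (Suc i)) D = sub (\<lambda>i. \<tau> (Suc i)) D"
    using Cons.prems by (intro sub_cong_scoped[OF sc]) auto
  moreover have "msub S \<Gamma> (\<lambda>i. \<sigma> (Suc i)) \<Lambda> \<longleftrightarrow> msub S \<Gamma> (\<lambda>i. \<tau> (Suc i)) \<Lambda>"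
    using Cons.prems by (intro Cons.IH) auto
  ultimately show ?case using Cons.prems(2)[of 0] by (simp add: msub_Cons)
qed simp

lemma msub_eq_irrelevant:
  assumes "ctx S \<Lambda>" and "\<And>i. i < length \<Lambda> \<Longrightarrow> \<sigma> i = \<sigma>' i" and "\<And>i. i < length \<Lambda> \<Longrightarrow> \<tau> i = \<tau>' i"
  shows "msub_eq S \<Gamma> \<sigma> \<tau> \<Lambda> \<longleftrightarrow> msub_eq S \<Gamma> \<sigma>' \<tau>' \<Lambda>"
  using assms
proof (induction \<Lambda> arbitrary: \<sigma> \<tau> \<sigma>' \<tau>')
  case (Cons D \<Lambda>)
  have sc: "scoped (length \<Lambda>) D"
    using ctx_scoped[of "[]"] Cons.prems by auto
  have "sub (\<lambda>i. \<sigma> (Suc i)) D = sub (\<lambda>i. \<sigma>' (Suc i)) D"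
    using Cons.prems by (intro sub_cong_scoped[OF sc]) auto
  moreover have "msub_eq S \<Gamma> (\<lambda>i. \<sigma> (Suc i)) (\<lambda>i. \<tau> (Suc i)) \<Lambda> \<longleftrightarrow> msub_eq S \<Gamma> (\<lambda>i. \<sigma>' (Suc i)) (\<lambda>i. \<tau>' (Suc i)) \<Lambda>"
    using Cons.prems by (intro Cons.IH) auto
  ultimately show ?case using Cons.prems(2,3)[of 0] by (simp add: msub_eq_Cons)
qed simp

text \<open>Each entry of a context has only its predecessors free, and \<open>up_sub\<close> fixes
  those. This justifies reading a context as a telescope over any ambient context.\<close>

lemma subT_closed: "ctx S \<Lambda> \<Longrightarrow> subT \<sigma> \<Lambda> = \<Lambda>"
proof (induction \<Lambda>)
  case (Cons D \<Lambda>)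
  have sc: "scoped (length \<Lambda>) D"
    using ctx_scoped[of "[]"] Cons.prems by auto
  have "sub (up_sub (length \<Lambda>) \<sigma>) D = sub Var D"
    by (rule sub_cong_scoped[OF sc]) (auto simp: up_sub_def)
  with Cons show ?case by simp
qed simp

lemma el_iff_msub: "ctx S \<Delta> \<Longrightarrow> ctx S \<Gamma> \<Longrightarrow> length ts = length \<Delta> \<Longrightarrow> el S \<Gamma> \<Delta> ts \<longleftrightarrow> msub S \<Gamma> (lsub ts \<sigma>) \<Delta>"
  using msub_lsub[of ts \<Delta> S \<Gamma> \<sigma> "[]"] by (simp add: subT_closed)

lemma el_eq_iff_msub_eq:
  "ctx S \<Delta> \<Longrightarrow> ctx S \<Gamma> \<Longrightarrow> length ts = length \<Delta> \<Longrightarrow> length us = length \<Delta> \<Longrightarrow>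
    el_eq S \<Gamma> \<Delta> ts us \<longleftrightarrow> msub_eq S \<Gamma> (lsub ts \<sigma>) (lsub us \<tau>) \<Delta>"
  using msub_eq_lsub[of ts \<Delta> us S \<Gamma> \<sigma> \<tau> "[]"] by (simp add: subT_closed)

lemma scoped_judgement_sub_cong:
  "scoped_judgement n J \<Longrightarrow> (\<And>i. i < n \<Longrightarrow> \<sigma> i = \<tau> i) \<Longrightarrow> sub_judgement (sub \<sigma>) J = sub_judgement (sub \<tau>) J"
  by (cases J) (auto intro: sub_cong_scoped)

text \<open>The substitution rule speaks of lists, so \<sigma> is cut down to its first
  \<open>length \<Delta>\<close> values; scoping of the judgement makes the cut harmless.\<close>

lemma msub_judgement:
  assumes "\<Delta> \<turnstile> J" and "msub S \<Gamma> \<sigma> \<Delta>"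
  shows "\<Gamma> \<turnstile> sub_judgement (sub \<sigma>) J"
proof -
  let ?ts = "map \<sigma> [0..<length \<Delta>]"
  have c: "ctx S \<Gamma>" "ctx S \<Delta>" using assms presup_ctx by (auto simp: msub_def)
  have "msub S \<Gamma> (lsub ?ts Var) \<Delta>"
    using assms(2) by (subst sub_ctx_irrelevant[OF c(2), of _ \<sigma>]) (auto simp: lsub_def)
  then have "el S \<Gamma> \<Delta> ?ts" by (subst el_iff_msub) (auto simp: c)
  from substitution[OF assms(1) c(1) this]
  have "\<Gamma> \<turnstile> sub_judgement (sub (lsub ?ts Var)) J" by (simp add: inst_eq_sub)
  moreover have "sub_judgement (sub (lsub ?ts Var)) J = sub_judgement (sub \<sigma>) J"
    by (rule scoped_judgement_sub_cong[OF scope[OF assms(1)]]) (auto simp: lsub_def)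
  ultimately show ?thesis by simp
qed

lemmas msub_Ty = msub_judgement[of _ "Ty _", simplified sub_judgement.simps]
  and msub_Tm = msub_judgement[of _ "Tm _ _", simplified sub_judgement.simps]
  and msub_TmEq = msub_judgement[of _ "TmEq _ _ _", simplified sub_judgement.simps]

lemma
  assumes "msub_eq S \<Gamma> \<sigma> \<tau> \<Delta>"
  shows msub_eq_Ty: "\<Delta> \<turnstile> Ty A \<Longrightarrow> \<Gamma> \<turnstile> TyEq (sub \<sigma> A) (sub \<tau> A)"
    and msub_eq_Tm: "\<Delta> \<turnstile> Tm a A \<Longrightarrow> \<Gamma> \<turnstile> TmEq (sub \<sigma> a) (sub \<tau> a) (sub \<sigma> A)"
proof -
  let ?ts = "map \<sigma> [0..<length \<Delta>]" and ?us = "map \<tau> [0..<length \<Delta>]"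
  have c: "ctx S \<Gamma>" using assms by (auto simp: msub_eq_def)
  have *: "el_eq S \<Gamma> \<Delta> ?ts ?us" if d: "ctx S \<Delta>"
  proof -
    have "msub_eq S \<Gamma> (lsub ?ts Var) (lsub ?us Var) \<Delta>"
      using assms by (subst msub_eq_irrelevant[OF d, of _ \<sigma> _ \<tau>]) (auto simp: lsub_def)
    then show ?thesis by (subst el_eq_iff_msub_eq) (auto simp: c d)
  qed
  have sub1: "sub (lsub ?ts Var) e = sub \<sigma> e" "sub (lsub ?us Var) e = sub \<tau> e" if "scoped (length \<Delta>) e" for e
    using that by (auto intro!: sub_cong_scoped[OF that] simp: lsub_def)
  show "\<Gamma> \<turnstile> TyEq (sub \<sigma> A) (sub \<tau> A)" if "\<Delta> \<turnstile> Ty A"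
    using substitution_cong_Ty[OF that c *[OF presup_ctx[OF that]]] scope[OF that] by (simp add: inst_eq_sub sub1)
  show "\<Gamma> \<turnstile> TmEq (sub \<sigma> a) (sub \<tau> a) (sub \<sigma> A)" if "\<Delta> \<turnstile> Tm a A"
    using substitution_cong_Tm[OF that c *[OF presup_ctx[OF that]]] scope[OF that] by (simp add: inst_eq_sub sub1)
qed

lemma msub_shift: "ctx S (\<Theta> @ \<Gamma>) \<Longrightarrow> msub S (\<Theta> @ \<Gamma>) (\<lambda>i. Var (i + length \<Theta>)) \<Gamma>"
  unfolding msub_def
proof (intro conjI allI impI)
  fix i assume c: "ctx S (\<Theta> @ \<Gamma>)" and i: "i < length \<Gamma>"
  have "sub (\<lambda>i. Var (i + length \<Theta>)) (lift (i + 1) (\<Gamma> ! i)) = lift (i + length \<Theta> + 1) (\<Gamma> ! i)"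
    by (simp add: wk_eq_sub sub_sub add_ac)
  then show "\<Theta> @ \<Gamma> \<turnstile> Tm (Var (i + length \<Theta>)) (sub (\<lambda>i. Var (i + length \<Theta>)) (lift (i + 1) (\<Gamma> ! i)))"
    using variable[OF c, of "i + length \<Theta>"] i by (simp add: nth_append)
qed

lemma lift_judgement: "\<Gamma> \<turnstile> J \<Longrightarrow> ctx S (\<Theta> @ \<Gamma>) \<Longrightarrow> \<Theta> @ \<Gamma> \<turnstile> sub_judgement (lift (length \<Theta>)) J"
  using msub_judgement[OF _ msub_shift] by (simp add: wk_eq_sub)

lemma lift1_judgement: "\<Gamma> \<turnstile> J \<Longrightarrow> \<Gamma> \<turnstile> Ty A \<Longrightarrow> A # \<Gamma> \<turnstile> sub_judgement (lift 1) J"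
  using lift_judgement[of \<Gamma> J "[A]"] presup_Ty_ctx by auto

lemmas lift1_Ty = lift1_judgement[of _ "Ty _", simplified sub_judgement.simps]
  and lift1_Tm = lift1_judgement[of _ "Tm _ _", simplified sub_judgement.simps]
  and lift1_TyEq = lift1_judgement[of _ "TyEq _ _", simplified sub_judgement.simps]
  and lift1_TmEq = lift1_judgement[of _ "TmEq _ _ _", simplified sub_judgement.simps]

lemma msub_comp:
  assumes "msub S \<Gamma> \<sigma> \<Delta>" and "msub S \<Delta> \<tau> \<Theta>"
  shows "msub S \<Gamma> (\<lambda>i. sub \<sigma> (\<tau> i)) \<Theta>"
  using assms msub_Tm[OF _ assms(1)] by (auto simp: msub_def sub_sub[symmetric])

lemma msub_lift1: "msub S \<Gamma> \<sigma> \<Delta> \<Longrightarrow> \<Gamma> \<turnstile> Ty A \<Longrightarrow> msub S (A # \<Gamma>) (\<lambda>i. lift 1 (\<sigma> i)) \<Delta>"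
  using msub_comp[OF msub_shift[of "[A]" \<Gamma>]] presup_Ty_ctx by (simp add: wk_eq_sub)

lemma msub_Var: "ctx S \<Gamma> \<Longrightarrow> msub S \<Gamma> Var \<Gamma>"
  using msub_shift[of "[]" \<Gamma>] by simp

lemma Tm_Var0: "\<Gamma> \<turnstile> Ty A \<Longrightarrow> A # \<Gamma> \<turnstile> Tm (Var 0) (lift 1 A)"
  using variable[of "A # \<Gamma>" 0] presup_Ty_ctx by auto

lemma msub_up1: "msub S \<Gamma> \<sigma> \<Delta> \<Longrightarrow> \<Delta> \<turnstile> Ty A \<Longrightarrow> msub S (sub \<sigma> A # \<Gamma>) (up_sub 1 \<sigma>) (A # \<Delta>)"
  using msub_lift1[of \<Gamma> \<sigma> \<Delta> "sub \<sigma> A"] Tm_Var0[of \<Gamma> "sub \<sigma> A"] msub_Ty[of \<Delta> A \<Gamma> \<sigma>]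
  by (simp add: up_sub_Suc[of 0, simplified] msub_scons lift_sub)

lemma msub_up:
  "msub S \<Gamma> \<sigma> \<Delta> \<Longrightarrow> ctx S (\<Theta> @ \<Delta>) \<Longrightarrow> msub S (subT \<sigma> \<Theta> @ \<Gamma>) (up_sub (length \<Theta>) \<sigma>) (\<Theta> @ \<Delta>)"
proof (induction \<Theta>)
  case (Cons A \<Theta>)
  then show ?case
    using msub_up1[of "subT \<sigma> \<Theta> @ \<Gamma>" "up_sub (length \<Theta>) \<sigma>" "\<Theta> @ \<Delta>" A]
    by (simp add: up_sub_up_sub)
qed simp

lemma msub_ctx: "msub S \<Gamma> \<sigma> \<Delta> \<Longrightarrow> ctx S (\<Theta> @ \<Delta>) \<Longrightarrow> ctx S (subT \<sigma> \<Theta> @ \<Gamma>)"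
  using msub_up by (auto simp: msub_def)

lemma ctx_conv_Var:
  assumes "\<Gamma> \<turnstile> TyEq A A'"
  shows "msub S (A' # \<Gamma>) Var (A # \<Gamma>)"
proof -
  have A: "\<Gamma> \<turnstile> Ty A" "\<Gamma> \<turnstile> Ty A'" using presup_TyEq[OF assms] by auto
  have "A' # \<Gamma> \<turnstile> Tm (Var 0) (lift 1 A)"
    using Tm_conv[OF Tm_Var0[OF A(2)] lift1_TyEq[OF TyEq_sym[OF assms] A(2)]] .
  moreover have "msub S (A' # \<Gamma>) (\<lambda>i. Var (Suc i)) \<Gamma>"
    using msub_shift[of "[A']" \<Gamma>] A presup_Ty_ctx by simp
  ultimately show ?thesis by (simp add: msub_Cons wk_eq_sub)
qed

text \<open>Replacing a type in the context by an equal one is substitution along the identity: by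
  conversion, the variable of type \<open>A'\<close> also has type \<open>A\<close>.\<close>

lemma ctx_conv:
  assumes "\<Gamma> \<turnstile> TyEq A A'" and "\<Theta> @ A # \<Gamma> \<turnstile> J"
  shows "\<Theta> @ A' # \<Gamma> \<turnstile> J"
proof -
  have "msub S (\<Theta> @ A' # \<Gamma>) Var (\<Theta> @ A # \<Gamma>)"
    using msub_up[OF ctx_conv_Var[OF assms(1)], of \<Theta>] presup_ctx[OF assms(2)] by simp
  from msub_judgement[OF assms(2) this] show ?thesis by (cases J) simp_all
qed

text \<open>Since the innermost entry comes first, the variables of \<Lambda> keep their indices
  when \<Gamma> is placed outside, so the comparison substitution is \<open>Var\<close>.\<close>

lemma ctx_append_closed: "ctx S \<Lambda> \<Longrightarrow> ctx S \<Gamma> \<Longrightarrow> ctx S (\<Lambda> @ \<Gamma>)"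
proof (induction \<Lambda>)
  case (Cons D \<Lambda>)
  have "msub S (\<Lambda> @ \<Gamma>) Var \<Lambda>"
    unfolding msub_def
  proof (intro conjI allI impI)
    show c: "ctx S (\<Lambda> @ \<Gamma>)" using Cons by simp
    show "\<Lambda> @ \<Gamma> \<turnstile> Tm (Var i) (sub Var (lift (i + 1) (\<Lambda> ! i)))" if "i < length \<Lambda>" for i
      using variable[OF c, of i] that by (simp add: nth_append)
  qed
  from msub_Ty[OF _ this, of D] Cons show ?case by simp
qed simp

lemma TmEq_trans2: "\<Gamma> \<turnstile> TmEq a b A \<Longrightarrow> \<Gamma> \<turnstile> TmEq c b A \<Longrightarrow> \<Gamma> \<turnstile> TmEq a c A"
  using TmEq_trans TmEq_sym by blast

end

section \<open>Extended identity elimination\<close>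

lemma up_ren_wk: "up_ren n (\<lambda>i. if i < c then i else i + m) = (\<lambda>i. if i < c + n then i else i + m)"
  by (rule ext) (auto simp: up_ren_def)

lemma lift_eq_sub: "lift m = sub (\<lambda>i. Var (i + m))"
  by (simp add: wk_eq_sub)

lemma wk_eq_sub_up_sub: "wk c m = sub (up_sub c (\<lambda>i. Var (i + m)))"
  unfolding wk_eq_sub by (rule arg_cong[of _ _ sub]) (auto simp: up_sub_def)

lemma wk_simps [simp]:
  "wk c m (SigT A B) = SigT (wk c m A) (wk (c + 1) m B)"
  "wk c m (PairT a b) = PairT (wk c m a) (wk c m b)"
  "wk c m (SplitT d e) = SplitT (wk (c + 2) m d) (wk c m e)"
  "wk c m UnitT = UnitT"
  "wk c m StarT = StarT"
  "wk c m (UnitElimT d e) = UnitElimT (wk c m d) (wk c m e)"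
  "wk c m (IdT A a b) = IdT (wk c m A) (wk c m a) (wk c m b)"
  "wk c m (ReflT a) = ReflT (wk c m a)"
  "wk c m (JT d a b p) = JT (wk (c + 1) m d) (wk c m a) (wk c m b) (wk c m p)"
  "wk c m (PiT A B) = PiT (wk c m A) (wk (c + 1) m B)"
  "wk c m (LamT t) = LamT (wk (c + 1) m t)"
  "wk c m (AppT a b) = AppT (wk c m a) (wk c m b)"
  "wk c m (ExtT a b p) = ExtT (wk c m a) (wk c m b) (wk (c + 1) m p)"
  by (simp_all add: wk_def up_ren_wk)

lemma wk_wk: "wk c m (wk c k e) = wk c (m + k) e"
  by (simp add: wk_def ren_ren) (rule arg_cong[of _ _ "\<lambda>f. ren f e"], auto)

lemma wk_lams: "wk c m (lams n e) = lams n (wk (c + n) m e)"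
  by (induction n arbitrary: e) auto

lemma sub_apps: "sub \<sigma> (apps m ts) = apps (sub \<sigma> m) (map (sub \<sigma>) ts)"
  by (induction ts) auto

section \<open>Iterated products over a telescope\<close>

fun pis :: "'s expr list \<Rightarrow> 's expr \<Rightarrow> 's expr" where
  "pis [] C = C"
| "pis (D # \<Delta>) C = pis \<Delta> (PiT D C)"

lemma sub_pis: "sub \<sigma> (pis \<Delta> C) = pis (subT \<sigma> \<Delta>) (sub (up_sub (length \<Delta>) \<sigma>) C)"
  by (induction \<Delta> arbitrary: C) (auto simp: up_sub_up_sub)

text \<open>The term that \<open>J_ctx\<close> passes to its recursive call: elimination for one
  type at generic variables y, y', q, with a post-context of length \<open>n\<close>.\<close>

definition Jgen :: "nat \<Rightarrow> 's expr \<Rightarrow> 's expr" where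
  "Jgen n d = J_ext n (wk (n + 1) (n + 3) d) (Var (n + 2)) (Var (n + 1)) (Var n) (map Var [0..<n])"

text \<open>The weakening is pulled out of the abstractions, so that the eliminator itself lives
  over x, y, p alone and the post-context enters only through the final applications.\<close>

lemma Jgen_eq:
  "Jgen n d = apps (lift n (JT (wk 1 3 (lams n d)) (Var 2) (Var 1) (Var 0))) (map Var [0..<n])"
  by (simp add: Jgen_def J_ext_def wk_lams wk_wk add_ac)

text \<open>The substitution x, x, r(x) from \<open>A # \<Gamma>\<close> into the context
  \<open>x, y : A, p : Id(x, y)\<close> over \<Gamma>; the shift in its tail accounts for x.\<close>

abbreviation diag :: "nat \<Rightarrow> 's expr" where
  "diag \<equiv> lsub [ReflT (Var 0), Var 0, Var 0] (\<lambda>i. Var (i + 1))"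

lemma inst_1_eq_sub: "inst 1 ts = sub (lsub ts (\<lambda>i. Var (i + 1)))"
  unfolding inst_def by (rule arg_cong[of _ _ sub]) (auto simp: lsub_def)

lemma map_sub_up_sub_Vars: "map (sub (up_sub n \<sigma>)) (map Var [0..<n]) = map Var [0..<n]"
  by (auto simp: up_sub_def)

lemma map_Var_Suc: "map Var [0..<Suc n] = Var 0 # map (lift 1) (map Var [0..<n])"
  by (simp add: upt_conv_Cons map_Suc_upt[symmetric] del: upt_Suc)

context ML2
begin

lemma Ty_pis: "\<Delta> @ \<Gamma> \<turnstile> Ty C \<Longrightarrow> \<Gamma> \<turnstile> Ty (pis \<Delta> C)"
proof (induction \<Delta> arbitrary: C)
  case (Cons D \<Delta>)
  then show ?case using Cons.IH[OF Pi_form[of "\<Delta> @ \<Gamma>" D C]] presup_ctx by fastforce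
qed simp

lemma Tm_lams: "\<Delta> @ \<Gamma> \<turnstile> Tm e C \<Longrightarrow> \<Gamma> \<turnstile> Tm (lams (length \<Delta>) e) (pis \<Delta> C)"
proof (induction \<Delta> arbitrary: e C)
  case (Cons D \<Delta>)
  then show ?case using Cons.IH[OF Pi_intro[of D "\<Delta> @ \<Gamma>" e C]] by simp
qed simp

text \<open>To apply a weakened function to the new variable, its codomain must be weakened outside
  its bound variable; instantiating that variable then gives back \<open>C\<close>.\<close>

lemma Pi_weaken:
  assumes "D # \<Gamma> \<turnstile> Ty C"
  shows "lift 1 D # D # \<Gamma> \<turnstile> Ty (wk 1 1 C)" and "inst 0 [Var 0] (wk 1 1 C) = C"
proof -
  have "\<Gamma> \<turnstile> Ty D" using presup_ctx[OF assms] by simp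
  then have "msub S (D # \<Gamma>) (\<lambda>i. Var (i + 1)) \<Gamma>"
    using msub_shift[of "[D]" \<Gamma>] presup_Ty_ctx by simp
  from msub_up1[OF this \<open>\<Gamma> \<turnstile> Ty D\<close>]
  have "msub S (lift 1 D # D # \<Gamma>) (up_sub 1 (\<lambda>i. Var (i + 1))) (D # \<Gamma>)"
    by (simp add: lift_eq_sub)
  then show "lift 1 D # D # \<Gamma> \<turnstile> Ty (wk 1 1 C)"
    using msub_Ty[OF assms] by (simp only: wk_eq_sub_up_sub)
  show "inst 0 [Var 0] (wk 1 1 C) = C"
    by (simp add: inst_eq_sub wk_eq_sub sub_sub) (rule sub_id, auto simp: lsub_def)
qed

lemma Pi_app_var:
  assumes "D # \<Gamma> \<turnstile> Ty C" and "\<Gamma> \<turnstile> Tm m (PiT D C)"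
  shows "D # \<Gamma> \<turnstile> Tm (AppT (lift 1 m) (Var 0)) C"
proof -
  have D: "\<Gamma> \<turnstile> Ty D" using presup_ctx[OF assms(1)] by simp
  show ?thesis
    using Pi_elim[OF Pi_weaken(1)[OF assms(1)] _ Tm_Var0[OF D]] lift1_Tm[OF assms(2) D]
      Pi_weaken(2)[OF assms(1)] by simp
qed

lemma Pi_app_var_cong:
  assumes "D # \<Gamma> \<turnstile> Ty C" and "\<Gamma> \<turnstile> TmEq m m' (PiT D C)"
  shows "D # \<Gamma> \<turnstile> TmEq (AppT (lift 1 m) (Var 0)) (AppT (lift 1 m') (Var 0)) C"
proof -
  have D: "\<Gamma> \<turnstile> Ty D" using presup_ctx[OF assms(1)] by simp
  show ?thesis
    using Pi_elim_cong[OF Pi_weaken(1)[OF assms(1)] _ TmEq_refl[OF Tm_Var0[OF D]]] lift1_TmEq[OF assms(2) D]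
      Pi_weaken(2)[OF assms(1)] by simp
qed

lemma Pi_beta_var:
  assumes "D # \<Gamma> \<turnstile> Tm e C"
  shows "D # \<Gamma> \<turnstile> TmEq (AppT (lift 1 (LamT e)) (Var 0)) e C"
proof -
  have D: "\<Gamma> \<turnstile> Ty D" using presup_ctx[OF assms(1)] by simp
  then have "msub S (D # \<Gamma>) (\<lambda>i. Var (i + 1)) \<Gamma>"
    using msub_shift[of "[D]" \<Gamma>] presup_Ty_ctx by simp
  from msub_up1[OF this D]
  have "msub S (lift 1 D # D # \<Gamma>) (up_sub 1 (\<lambda>i. Var (i + 1))) (D # \<Gamma>)"
    by (simp add: lift_eq_sub)
  then have "lift 1 D # D # \<Gamma> \<turnstile> Tm (wk 1 1 e) (wk 1 1 C)"
    using msub_Tm[OF assms] by (simp only: wk_eq_sub_up_sub)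
  moreover have "inst 0 [Var 0] (wk 1 1 e) = e"
    by (simp add: inst_eq_sub wk_eq_sub sub_sub) (rule sub_id, auto simp: lsub_def)
  ultimately show ?thesis
    using Pi_comp[OF _ Tm_Var0[OF D]] Pi_weaken(2)[OF presup_Tm[OF assms]] by fastforce
qed

lemma apps_Suc_Vars:
  "apps (lift (Suc n) m) (map Var [0..<Suc n]) = AppT (lift 1 (apps (lift n m) (map Var [0..<n]))) (Var 0)"
proof -
  have "lift 1 (apps (lift n m) (map Var [0..<n])) = apps (lift (Suc n) m) (map (lift 1) (map Var [0..<n]))"
    by (simp only: lift_eq_sub sub_apps sub_sub) simp
  then show ?thesis by (simp only: map_Var_Suc apps.simps)
qed

lemma Tm_apps_Vars:
  "\<Delta> @ \<Gamma> \<turnstile> Ty C \<Longrightarrow> \<Gamma> \<turnstile> Tm m (pis \<Delta> C) \<Longrightarrow>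
    \<Delta> @ \<Gamma> \<turnstile> Tm (apps (lift (length \<Delta>) m) (map Var [0..<length \<Delta>])) C"
proof (induction \<Delta> arbitrary: C)
  case (Cons D \<Delta>)
  have "\<Delta> @ \<Gamma> \<turnstile> Ty (PiT D C)" using Pi_form[of "\<Delta> @ \<Gamma>" D C] Cons.prems(1) presup_ctx by fastforce
  from Pi_app_var[OF _ Cons.IH[OF this]] Cons.prems show ?case
    by (simp only: apps_Suc_Vars length_Cons pis.simps append_Cons)
qed simp

lemma TmEq_apps_Vars:
  "\<Delta> @ \<Gamma> \<turnstile> Ty C \<Longrightarrow> \<Gamma> \<turnstile> TmEq m m' (pis \<Delta> C) \<Longrightarrow>
    \<Delta> @ \<Gamma> \<turnstile> TmEq (apps (lift (length \<Delta>) m) (map Var [0..<length \<Delta>]))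
      (apps (lift (length \<Delta>) m') (map Var [0..<length \<Delta>])) C"
proof (induction \<Delta> arbitrary: C)
  case (Cons D \<Delta>)
  have "\<Delta> @ \<Gamma> \<turnstile> Ty (PiT D C)" using Pi_form[of "\<Delta> @ \<Gamma>" D C] Cons.prems(1) presup_ctx by fastforce
  from Pi_app_var_cong[OF _ Cons.IH[OF this]] Cons.prems show ?case
    by (simp only: apps_Suc_Vars length_Cons pis.simps append_Cons)
qed simp

text \<open>Iterated beta. \<open>lams\<close> abstracts the innermost variable first, so the
  induction hypothesis is used for \<open>LamT e\<close> over the shorter telescope and one beta
  step is left.\<close>

lemma apps_lams_Vars:
  "\<Delta> @ \<Gamma> \<turnstile> Tm e C \<Longrightarrow>
    \<Delta> @ \<Gamma> \<turnstile> TmEq (apps (lift (length \<Delta>) (lams (length \<Delta>) e)) (map Var [0..<length \<Delta>])) e C"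
proof (induction \<Delta> arbitrary: e C)
  case Nil
  then show ?case using TmEq_refl by simp
next
  case (Cons D \<Delta>)
  then have e: "D # \<Delta> @ \<Gamma> \<turnstile> Tm e C" by simp
  have "D # \<Delta> @ \<Gamma> \<turnstile> TmEq
      (AppT (lift 1 (apps (lift (length \<Delta>) (lams (length \<Delta>) (LamT e))) (map Var [0..<length \<Delta>]))) (Var 0))
      (AppT (lift 1 (LamT e)) (Var 0)) C"
    by (rule Pi_app_var_cong[OF presup_Tm[OF e] Cons.IH[OF Pi_intro[OF e]]])
  from TmEq_trans[OF this Pi_beta_var[OF e]] show ?case
    by (simp only: apps_Suc_Vars length_Cons lams.simps append_Cons)
qed

lemma ctx_Id_tele:
  assumes A: "\<Gamma> \<turnstile> Ty A"
  shows "ctx S (Id_tele A @ \<Gamma>)"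
proof -
  have c1: "ctx S (A # \<Gamma>)" using A by (rule presup_Ty_ctx)
  have A1: "A # \<Gamma> \<turnstile> Ty (lift 1 A)" using lift1_Ty A by blast
  have v1: "A # \<Gamma> \<turnstile> Tm (Var 0) (lift 1 A)" by (rule Tm_Var0[OF A])
  have "lift 1 A # A # \<Gamma> \<turnstile> Tm (Var 0) (lift 2 A)"
    using Tm_Var0[OF A1] by (simp add: lift_lift numeral_2_eq_2)
  moreover have "lift 1 A # A # \<Gamma> \<turnstile> Tm (Var 1) (lift 2 A)"
    using lift1_Tm[OF v1 A1] by (simp add: lift_lift numeral_2_eq_2)
  ultimately have "lift 1 A # A # \<Gamma> \<turnstile> Ty (IdT (lift 2 A) (Var 1) (Var 0))"
    using Id_form by blast
  then show ?thesis using presup_Ty_ctx[of "lift 1 A # A # \<Gamma>"] by simp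
qed

lemma msub_Id_tele:
  assumes "msub S \<Xi> \<sigma> \<Gamma>" and "\<Xi> \<turnstile> Tm a (sub \<sigma> A)" and "\<Xi> \<turnstile> Tm b (sub \<sigma> A)"
    and "\<Xi> \<turnstile> Tm p (IdT (sub \<sigma> A) a b)"
  shows "msub S \<Xi> (lsub [p, b, a] \<sigma>) (Id_tele A @ \<Gamma>)"
  using assms by (simp add: lsub_Cons msub_scons sub_lift numeral_2_eq_2)

lemma msub_diag:
  assumes A: "\<Gamma> \<turnstile> Ty A"
  shows "msub S (A # \<Gamma>) diag (Id_tele A @ \<Gamma>)"
proof (rule msub_Id_tele)
  show "msub S (A # \<Gamma>) (\<lambda>i. Var (i + 1)) \<Gamma>"
    using msub_shift[of "[A]" \<Gamma>] presup_Ty_ctx[OF A] by simp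
  have "A # \<Gamma> \<turnstile> Tm (Var 0) (sub (\<lambda>i. Var (i + 1)) A)"
    using Tm_Var0[OF A] by (simp add: wk_eq_sub)
  then show "A # \<Gamma> \<turnstile> Tm (Var 0) (sub (\<lambda>i. Var (i + 1)) A)"
    "A # \<Gamma> \<turnstile> Tm (Var 0) (sub (\<lambda>i. Var (i + 1)) A)"
    "A # \<Gamma> \<turnstile> Tm (ReflT (Var 0)) (IdT (sub (\<lambda>i. Var (i + 1)) A) (Var 0) (Var 0))"
    using Id_intro by auto
qed

context
  fixes \<Gamma> \<Xi> A C d \<sigma>
  assumes C: "Id_tele A @ \<Gamma> \<turnstile> Ty C" and d: "A # \<Gamma> \<turnstile> Tm d (sub diag C)"
    and \<sigma>: "msub S \<Xi> \<sigma> \<Gamma>"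
begin

text \<open>\<open>C\<close> and \<open>d\<close> are given over \<Gamma> but the eliminator is
  applied in \<Xi>; these are the premises of the identity rules after substitution along
  \<sigma>.\<close>

lemma J_sub_premises:
  "Id_tele (sub \<sigma> A) @ \<Xi> \<turnstile> Ty (sub (up_sub 3 \<sigma>) C)"
  "sub \<sigma> A # \<Xi> \<turnstile> Tm (sub (up_sub 1 \<sigma>) d) (inst 1 [ReflT (Var 0), Var 0, Var 0] (sub (up_sub 3 \<sigma>) C))"
proof -
  have "subT \<sigma> (Id_tele A) = Id_tele (sub \<sigma> A)"
    using sub_up_sub_lift[of 2 \<sigma> A] sub_up_sub_lift[of 1 \<sigma> A] by (simp add: numeral_2_eq_2) (simp add: up_sub_def)
  then show "Id_tele (sub \<sigma> A) @ \<Xi> \<turnstile> Ty (sub (up_sub 3 \<sigma>) C)"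
    using msub_Ty[OF C msub_up[OF \<sigma> presup_ctx[OF C]]] by (simp add: numeral_3_eq_3)
  have A: "\<Gamma> \<turnstile> Ty A" using presup_ctx[OF C] by simp
  show "sub \<sigma> A # \<Xi> \<turnstile> Tm (sub (up_sub 1 \<sigma>) d) (inst 1 [ReflT (Var 0), Var 0, Var 0] (sub (up_sub 3 \<sigma>) C))"
    using msub_Tm[OF d msub_up1[OF \<sigma> A]]
    by (simp add: inst_1_eq_sub[simplified] sub_sub sub_lsub sub_lsub_up_sub) (simp add: up_sub_def wk_eq_sub)
qed

lemma J_Tm:
  assumes "\<Xi> \<turnstile> Tm a (sub \<sigma> A)" and "\<Xi> \<turnstile> Tm b (sub \<sigma> A)" and "\<Xi> \<turnstile> Tm p (IdT (sub \<sigma> A) a b)"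
  shows "\<Xi> \<turnstile> Tm (JT (sub (up_sub 1 \<sigma>) d) a b p) (sub (lsub [p, b, a] \<sigma>) C)"
  using Id_elim[OF J_sub_premises assms] by (simp add: inst_eq_sub sub_sub sub_lsub_up_sub)

lemma J_comp:
  assumes "\<Xi> \<turnstile> Tm a (sub \<sigma> A)"
  shows "\<Xi> \<turnstile> TmEq (JT (sub (up_sub 1 \<sigma>) d) a a (ReflT a)) (sub (lsub [a] \<sigma>) d) (sub (lsub [ReflT a, a, a] \<sigma>) C)"
  using Id_comp[OF J_sub_premises assms] by (simp add: inst_eq_sub sub_sub sub_lsub_up_sub)

end

text \<open>Extended elimination uses the product \<open>pis \<Delta> C\<close> as motive: the
  abstraction of \<open>d\<close> over the telescope is eliminated by J, and the result is applied
  to the variables of the telescope. On the diagonal J computes to that abstraction, and iterated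
  beta returns \<open>d\<close>.\<close>

lemma Jgen_Tm:
  assumes C: "\<Delta> @ Id_tele A @ \<Gamma> \<turnstile> Ty C" and n: "n = length \<Delta>"
    and d: "subT diag \<Delta> @ A # \<Gamma> \<turnstile> Tm d (sub (up_sub n diag) C)"
  shows "\<Delta> @ Id_tele A @ \<Gamma> \<turnstile> Tm (Jgen n d) C"
    and "subT diag \<Delta> @ A # \<Gamma> \<turnstile> TmEq (sub (up_sub n diag) (Jgen n d)) d (sub (up_sub n diag) C)"
proof -
  let ?P = "pis \<Delta> C" and ?m = "JT (wk 1 3 (lams n d)) (Var 2) (Var 1) (Var 0)"
  let ?I = "Id_tele A @ \<Gamma>"
  have P: "?I \<turnstile> Ty ?P" using Ty_pis C by blast
  have cI: "ctx S ?I" by (rule presup_ctx[OF P])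
  have A: "\<Gamma> \<turnstile> Ty A" using cI by simp
  have l: "A # \<Gamma> \<turnstile> Tm (lams n d) (sub diag ?P)"
    using Tm_lams[OF d] by (simp add: sub_pis n)
  have sh: "msub S ?I (\<lambda>i. Var (i + 3)) \<Gamma>" using msub_shift[OF cI] by (simp add: numeral_3_eq_3)
  have v: "?I \<turnstile> Tm (Var 2) (sub (\<lambda>i. Var (i + 3)) A)" "?I \<turnstile> Tm (Var 1) (sub (\<lambda>i. Var (i + 3)) A)"
    "?I \<turnstile> Tm (Var 0) (IdT (sub (\<lambda>i. Var (i + 3)) A) (Var 2) (Var 1))"
    using variable[OF cI, of 2] variable[OF cI, of 1] variable[OF cI, of 0]
    by (simp_all add: lift_lift numeral_2_eq_2 numeral_3_eq_3 wk_eq_sub sub_sub)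
  have wk1: "wk 1 3 e = sub (up_sub 1 (\<lambda>i. Var (i + 3))) e" for e :: "'s expr"
    unfolding wk_eq_sub by (rule sub_cong) (auto simp: up_sub_def)
  \<comment> \<open>At the generic variables themselves the instantiated motive is the motive
    again.\<close>
  have C3: "sub (lsub [Var 0, Var 1, Var 2] (\<lambda>i. Var (i + 3))) ?P = ?P"
    by (rule sub_id) (auto simp: lsub_def nth_Cons numeral_2_eq_2 numeral_3_eq_3 split: nat.split)
  have m: "?I \<turnstile> Tm ?m ?P"
    using J_Tm[OF P l sh v] by (simp only: wk1 C3)
  show "\<Delta> @ ?I \<turnstile> Tm (Jgen n d) C"
    using Tm_apps_Vars[OF C m] by (simp add: Jgen_eq n)
  have sh1: "msub S (A # \<Gamma>) (\<lambda>i. Var (i + 1)) \<Gamma>"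
    using msub_shift[of "[A]" \<Gamma>] presup_Ty_ctx[OF A] by simp
  have v0: "A # \<Gamma> \<turnstile> Tm (Var 0) (sub (\<lambda>i. Var (i + 1)) A)"
    using Tm_Var0[OF A] by (simp add: wk_eq_sub)
  have "sub diag ?m = JT (sub (up_sub 1 (\<lambda>i. Var (i + 1))) (lams n d)) (Var 0) (Var 0) (ReflT (Var 0))"
    unfolding wk1 sub.simps sub_sub sub_up_sub by (simp add: lsub_def numeral_3_eq_3 numeral_2_eq_2)
  moreover have "sub (lsub [Var 0] (\<lambda>i. Var (i + 1))) (lams n d) = lams n d"
    by (rule sub_id) (auto simp: lsub_def)
  ultimately have "A # \<Gamma> \<turnstile> TmEq (sub diag ?m) (lams n d) (sub diag ?P)"
    using J_comp[OF P l sh1 v0] by simp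
  then have "subT diag \<Delta> @ A # \<Gamma> \<turnstile> TmEq (apps (lift n (sub diag ?m)) (map Var [0..<n]))
      (apps (lift n (lams n d)) (map Var [0..<n])) (sub (up_sub n diag) C)"
    using TmEq_apps_Vars[of "subT diag \<Delta>" "A # \<Gamma>" "sub (up_sub n diag) C"] presup_Tm[OF d] by (simp only: sub_pis n length_subT)
  moreover have "subT diag \<Delta> @ A # \<Gamma> \<turnstile> TmEq (apps (lift n (lams n d)) (map Var [0..<n])) d (sub (up_sub n diag) C)"
    using apps_lams_Vars[OF d] by (simp add: n)
  moreover have "sub (up_sub n diag) (Jgen n d) = apps (lift n (sub diag ?m)) (map Var [0..<n])"
    unfolding Jgen_eq sub_apps map_sub_up_sub_Vars sub_up_sub_lift ..
  ultimately show "subT diag \<Delta> @ A # \<Gamma> \<turnstile> TmEq (sub (up_sub n diag) (Jgen n d)) d (sub (up_sub n diag) C)"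
    using TmEq_trans by simp
qed

end

section \<open>Elimination for identity contexts\<close>

text \<open>The innermost type is eliminated first; its variables y, y', q then belong to the
  post-context of the next step, hence \<open>n + 3\<close>.\<close>

fun J_iter :: "nat \<Rightarrow> nat \<Rightarrow> 's expr \<Rightarrow> 's expr" where
  "J_iter n 0 d = d"
| "J_iter n (Suc k) d = J_iter (n + 3) k (Jgen n d)"

fun ux :: "nat \<Rightarrow> nat \<Rightarrow> 's expr" where
  "ux 0 = Var"
| "ux (Suc k) = scons (Var 2) (\<lambda>i. lift 3 (ux k i))"

fun uy :: "nat \<Rightarrow> nat \<Rightarrow> 's expr" where
  "uy 0 = Var"
| "uy (Suc k) = scons (Var 1) (\<lambda>i. lift 3 (uy k i))"

fun dg :: "nat \<Rightarrow> nat \<Rightarrow> 's expr" where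
  "dg 0 = Var"
| "dg (Suc k) = lsub [ReflT (Var 0), Var 0, Var 0] (\<lambda>i. lift 1 (dg k i))"

text \<open>
  The generic instance \<open>x, x' : \<Lambda>, p : Id(x, x')\<close> of the identity context, with the variables interleaved
  as \<open>x\<^sub>1, x\<^sub>1', p\<^sub>1, x\<^sub>2, x\<^sub>2', p\<^sub>2, \<dots>\<close>. In this order the recursion of \<open>J_ctx\<close> is an iteration of \<open>Jgen\<close>; the
  type of each \<open>p\<^sub>i\<close> involves the transport \<open>J_iter 1 k (Var 0)\<close>, with one variable more than in the
  instance of the preceding types. The substitutions \<open>ux\<close> and \<open>uy\<close> select \<open>x\<close> and \<open>x'\<close>, and \<open>dg\<close> is \<open>x, x, r(x)\<close>.
\<close>

fun U :: "'s expr list \<Rightarrow> 's expr list" where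
  "U [] = []"
| "U (D # \<Lambda>) =
    [IdT (lift 2 (sub (ux (length \<Lambda>)) D)) (Var 1) (wk 1 1 (J_iter 1 (length \<Lambda>) (Var 0))),
      lift 1 (sub (uy (length \<Lambda>)) D), sub (ux (length \<Lambda>)) D] @ U \<Lambda>"

lemma length_U [simp]: "length (U \<Lambda>) = 3 * length \<Lambda>"
  by (induction \<Lambda>) auto

lemma dg_ux: "(\<lambda>i. sub (dg k) (ux k i)) = (Var :: nat \<Rightarrow> 's expr)"
proof (induction k)
  case (Suc k)
  have "sub (dg (Suc k)) (ux (Suc k) i) = (Var i :: 's expr)" for i
    using fun_cong[OF Suc, of "i - 1"]
    by (cases i) (auto simp: lsub_Cons numeral_2_eq_2 numeral_3_eq_3 sub_lift lift_sub[symmetric])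
  then show ?case by (simp add: fun_eq_iff)
qed simp

lemma dg_uy: "(\<lambda>i. sub (dg k) (uy k i)) = (Var :: nat \<Rightarrow> 's expr)"
proof (induction k)
  case (Suc k)
  have "sub (dg (Suc k)) (uy (Suc k) i) = (Var i :: 's expr)" for i
    using fun_cong[OF Suc, of "i - 1"]
    by (cases i) (auto simp: lsub_Cons numeral_2_eq_2 numeral_3_eq_3 sub_lift lift_sub[symmetric])
  then show ?case by (simp add: fun_eq_iff)
qed simp

lemma sub_dg_ux [simp]: "sub (dg k) (sub (ux k) e) = e" "sub (dg k) (sub (uy k) e) = e"
  by (simp_all add: sub_sub dg_ux dg_uy)

text \<open>The diagonal of the tail followed by that of the head is the diagonal of the extended
  context. Because of this identity, the computation rules of the single steps compose.\<close>

lemma diag_up_dg: "(\<lambda>i. sub diag (up_sub 3 (dg k) i)) = dg (Suc k)"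
  by (subst sub_lsub_up_sub) (auto simp: lift_eq_sub)

lemma sub_scons_wk: "sub (scons a (scons b \<sigma>)) (wk 1 1 t) = sub (scons a \<sigma>) t"
  by (simp add: wk_eq_sub sub_sub) (rule sub_cong, auto simp: scons_def split: nat.split)

lemma sub_up_2_wk: "sub (up_sub 2 \<sigma>) (wk 1 1 t) = wk 1 1 (sub (up_sub 1 \<sigma>) t)"
  unfolding wk_eq_sub sub_sub by (rule sub_cong) (auto simp: up_sub_def sub_lift lift_eq_sub sub_sub)

section \<open>Elimination over the interleaved identity context\<close>

context ML2
begin

text \<open>Elimination and computation for the identity context of \<Lambda>, quantified over all
  post-contexts and motives because the induction enlarges the post-context. It is a predicate so
  that it can be an induction hypothesis alongside the typing of \<open>U\<close>, which already
  involves transport.\<close>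

definition U_elim :: "'s expr list \<Rightarrow> 's expr list \<Rightarrow> bool" where
  "U_elim \<Lambda> \<Xi> \<longleftrightarrow> (\<forall>\<Delta> C d. (\<Delta> @ U \<Lambda> @ \<Xi> \<turnstile> Ty C) \<longrightarrow>
    (subT (dg (length \<Lambda>)) \<Delta> @ \<Lambda> @ \<Xi> \<turnstile> Tm d (sub (up_sub (length \<Delta>) (dg (length \<Lambda>))) C)) \<longrightarrow>
    (\<Delta> @ U \<Lambda> @ \<Xi> \<turnstile> Tm (J_iter (length \<Delta>) (length \<Lambda>) d) C) \<and>
    (subT (dg (length \<Lambda>)) \<Delta> @ \<Lambda> @ \<Xi> \<turnstile>
      TmEq (sub (up_sub (length \<Delta>) (dg (length \<Lambda>))) (J_iter (length \<Delta>) (length \<Lambda>) d)) d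
        (sub (up_sub (length \<Delta>) (dg (length \<Lambda>))) C)))"

context
  fixes \<Lambda> \<Xi> D
  assumes D: "\<Lambda> @ \<Xi> \<turnstile> Ty D"
    and x: "msub S (U \<Lambda> @ \<Xi>) (ux (length \<Lambda>)) (\<Lambda> @ \<Xi>)"
    and y: "msub S (U \<Lambda> @ \<Xi>) (uy (length \<Lambda>)) (\<Lambda> @ \<Xi>)"
    and dg: "msub S (\<Lambda> @ \<Xi>) (dg (length \<Lambda>)) (U \<Lambda> @ \<Xi>)"
    and elim: "U_elim \<Lambda> \<Xi>"
begin

private abbreviation "k \<equiv> length \<Lambda>"
private abbreviation "X \<equiv> sub (ux k) D"
private abbreviation "Y \<equiv> sub (uy k) D"
private abbreviation "t \<equiv> J_iter 1 k (Var 0)"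

lemma Ty_XY: "U \<Lambda> @ \<Xi> \<turnstile> Ty X" "U \<Lambda> @ \<Xi> \<turnstile> Ty Y"
  using msub_Ty[OF D] x y by auto

text \<open>Transport is the elimination with post-context \<open>z : Y\<close> and motive
  \<open>X\<close>. On the diagonal both types become \<open>D\<close>, and the premise is the
  variable z itself.\<close>

lemma Tm_transport:
  "Y # U \<Lambda> @ \<Xi> \<turnstile> Tm t (lift 1 X)"
  "D # \<Lambda> @ \<Xi> \<turnstile> TmEq (sub (up_sub 1 (dg k)) t) (Var 0) (lift 1 D)"
proof -
  have "[Y] @ U \<Lambda> @ \<Xi> \<turnstile> Ty (lift 1 X)" using lift1_Ty Ty_XY by simp
  moreover have "subT (dg k) [Y] @ \<Lambda> @ \<Xi> \<turnstile> Tm (Var 0) (sub (up_sub (length [Y]) (dg k)) (lift 1 X))"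
    using Tm_Var0[OF D] sub_up_sub_lift[of 1 "dg k" X] by simp
  ultimately have
    "[Y] @ U \<Lambda> @ \<Xi> \<turnstile> Tm (J_iter (length [Y]) k (Var 0)) (lift 1 X)"
    "subT (dg k) [Y] @ \<Lambda> @ \<Xi> \<turnstile> TmEq (sub (up_sub (length [Y]) (dg k)) (J_iter (length [Y]) k (Var 0))) (Var 0)
      (sub (up_sub (length [Y]) (dg k)) (lift 1 X))"
    using elim unfolding U_elim_def by blast+
  then show "Y # U \<Lambda> @ \<Xi> \<turnstile> Tm t (lift 1 X)"
    "D # \<Lambda> @ \<Xi> \<turnstile> TmEq (sub (up_sub 1 (dg k)) t) (Var 0) (lift 1 D)"
    using sub_up_sub_lift[of 1 "dg k" X] by simp_all
qed

lemma ctx_U_step: "ctx S (U (D # \<Lambda>) @ \<Xi>)"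
proof -
  have Y1: "X # U \<Lambda> @ \<Xi> \<turnstile> Ty (lift 1 Y)" using lift1_Ty Ty_XY by blast
  have sh: "msub S (X # U \<Lambda> @ \<Xi>) (\<lambda>i. Var (i + 1)) (U \<Lambda> @ \<Xi>)"
    using msub_shift[of "[X]"] presup_Ty_ctx[OF Ty_XY(1)] by simp
  have "lift 1 Y # X # U \<Lambda> @ \<Xi> \<turnstile> Tm (wk 1 1 t) (lift 2 X)"
    using msub_Tm[OF Tm_transport(1) msub_up1[OF sh Ty_XY(2)]] sub_up_sub_lift[of 1 "\<lambda>i. Var (i + 1)" X]
    by (simp add: wk_eq_sub_up_sub lift_eq_sub sub_sub)
  moreover have "lift 1 Y # X # U \<Lambda> @ \<Xi> \<turnstile> Tm (Var 1) (lift 2 X)"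
    using lift1_Tm[OF Tm_Var0[OF Ty_XY(1)] Y1] by (simp add: lift_lift numeral_2_eq_2)
  ultimately have "lift 1 Y # X # U \<Lambda> @ \<Xi> \<turnstile> Ty (IdT (lift 2 X) (Var 1) (wk 1 1 t))"
    using Id_form by blast
  from presup_Ty_ctx[OF this] show ?thesis by simp
qed

lemma msub_ux_step: "msub S (U (D # \<Lambda>) @ \<Xi>) (ux (Suc k)) (D # \<Lambda> @ \<Xi>)"
    and msub_uy_step: "msub S (U (D # \<Lambda>) @ \<Xi>) (uy (Suc k)) (D # \<Lambda> @ \<Xi>)"
proof -
  let ?W = "U (D # \<Lambda>) @ \<Xi>"
  have "msub S ?W (\<lambda>i. Var (i + 3)) (U \<Lambda> @ \<Xi>)"
    using msub_shift[of "take 3 (U (D # \<Lambda>))" "U \<Lambda> @ \<Xi>"] ctx_U_step by (simp add: numeral_3_eq_3)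
  then have "msub S ?W (\<lambda>i. lift 3 (ux k i)) (\<Lambda> @ \<Xi>)" "msub S ?W (\<lambda>i. lift 3 (uy k i)) (\<Lambda> @ \<Xi>)"
    using msub_comp x y unfolding lift_eq_sub by blast+
  moreover have "?W \<turnstile> Tm (Var 2) (lift 3 X)" "?W \<turnstile> Tm (Var 1) (lift 3 Y)"
    using variable[OF ctx_U_step, of 2] variable[OF ctx_U_step, of 1]
    by (simp_all add: lift_lift numeral_2_eq_2 numeral_3_eq_3)
  ultimately show "msub S ?W (ux (Suc k)) (D # \<Lambda> @ \<Xi>)" "msub S ?W (uy (Suc k)) (D # \<Lambda> @ \<Xi>)"
    by (simp_all add: msub_scons lift_sub)
qed

text \<open>The head component r(x) has to identify x with the transport of x along reflexivity.
  That type equals Id(x, x) by the computation rule of transport, hence the conversion.\<close>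

lemma msub_dg_step: "msub S (D # \<Lambda> @ \<Xi>) (dg (Suc k)) (U (D # \<Lambda>) @ \<Xi>)"
proof -
  let ?\<sigma> = "\<lambda>i. lift 1 (dg k i)"
  have base: "msub S (D # \<Lambda> @ \<Xi>) ?\<sigma> (U \<Lambda> @ \<Xi>)" by (rule msub_lift1[OF dg D])
  have v: "D # \<Lambda> @ \<Xi> \<turnstile> Tm (Var 0) (lift 1 D)" by (rule Tm_Var0[OF D])
  have up: "up_sub 1 (dg k) = scons (Var 0) ?\<sigma>" using up_sub_Suc[of 0 "dg k"] by simp
  have eq: "D # \<Lambda> @ \<Xi> \<turnstile> TmEq (Var 0) (sub (scons (Var 0) ?\<sigma>) t) (lift 1 D)"
    using TmEq_sym[OF Tm_transport(2)] by (simp only: up)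
  have "D # \<Lambda> @ \<Xi> \<turnstile> Tm (ReflT (Var 0)) (IdT (lift 1 D) (Var 0) (sub (scons (Var 0) ?\<sigma>) t))"
    using Tm_conv[OF Id_intro[OF v] Id_form_cong[OF TyEq_refl[OF presup_Tm[OF v]] TmEq_refl[OF v] eq]] .
  then show ?thesis
    using base v
    by (simp add: lsub_Cons msub_scons sub_lift lift_sub[symmetric] numeral_2_eq_2 sub_scons_wk[simplified])
qed

text \<open>With the tail on the diagonal, the remaining three entries form \<open>Id_tele D\<close>
  except for a transport along reflexivity inside the identity type; the computation rule removes
  it.\<close>

lemma dg_Id_conv:
  "lift 1 D # D # \<Lambda> @ \<Xi> \<turnstile>
    TyEq (IdT (lift 2 D) (Var 1) (wk 1 1 (sub (up_sub 1 (dg k)) t))) (IdT (lift 2 D) (Var 1) (Var 0))"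
proof -
  have D1: "D # \<Lambda> @ \<Xi> \<turnstile> Ty (lift 1 D)" using lift1_Ty D by blast
  have sh: "msub S (D # \<Lambda> @ \<Xi>) (\<lambda>i. Var (i + 1)) (\<Lambda> @ \<Xi>)"
    using msub_shift[of "[D]"] presup_Ty_ctx[OF D] by simp
  have "lift 1 D # D # \<Lambda> @ \<Xi> \<turnstile> TmEq (wk 1 1 (sub (up_sub 1 (dg k)) t)) (Var 0) (lift 2 D)"
    using msub_TmEq[OF Tm_transport(2) msub_up1[OF sh D]] sub_up_sub_lift[of 1 "\<lambda>i. Var (i + 1)" D]
    by (simp add: wk_eq_sub_up_sub lift_eq_sub sub_sub) (simp add: up_sub_def)
  moreover have "lift 1 D # D # \<Lambda> @ \<Xi> \<turnstile> Tm (Var 1) (lift 2 D)"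
    using lift1_Tm[OF Tm_Var0[OF D] D1] by (simp add: lift_lift numeral_2_eq_2)
  ultimately show ?thesis using Id_form_cong TyEq_refl TmEq_refl presup_Tm by blast
qed

text \<open>Mirrors the recursion: \<open>Jgen\<close> eliminates over \<open>D\<close> with the
  tail on the diagonal, and its result is the premise for elimination over \<Lambda>, the three head
  variables having moved into the post-context. Chaining the two computation rules gives the one for
  \<open>D # \<Lambda>\<close>.\<close>

lemma U_elim_step: "U_elim (D # \<Lambda>) \<Xi>"
  unfolding U_elim_def
proof (intro allI impI)
  fix \<Delta> :: "'s expr list" and C d :: "'s expr"
  let ?n = "length \<Delta>" and ?\<mu> = "up_sub 3 (dg k)" and ?L = "\<Lambda> @ \<Xi>"
    and ?T = "[IdT (lift 2 X) (Var 1) (wk 1 1 t), lift 1 Y, X]"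
    and ?I = "IdT (lift 2 D) (Var 1) (wk 1 1 (sub (up_sub 1 (dg k)) t))"
  let ?\<Delta>1 = "subT ?\<mu> \<Delta>" and ?C1 = "sub (up_sub ?n ?\<mu>) C"
  assume C: "\<Delta> @ U (D # \<Lambda>) @ \<Xi> \<turnstile> Ty C"
    and d: "subT (dg (length (D # \<Lambda>))) \<Delta> @ (D # \<Lambda>) @ \<Xi> \<turnstile> Tm d (sub (up_sub ?n (dg (length (D # \<Lambda>)))) C)"
  have C': "(\<Delta> @ ?T) @ U \<Lambda> @ \<Xi> \<turnstile> Ty C" using C by simp
  have T: "subT (dg k) ?T = [?I, lift 1 D, D]"
    using sub_up_sub_lift[of 2 "dg k" X] sub_up_sub_lift[of 1 "dg k" Y] sub_up_2_wk[of "dg k" t]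
    by (simp add: numeral_2_eq_2) (simp add: up_sub_def)
  have T': "subT (dg k) (\<Delta> @ ?T) = ?\<Delta>1 @ [?I, lift 1 D, D]"
    unfolding subT_append T by (simp add: numeral_3_eq_3)
  have n3: "up_sub (length (\<Delta> @ ?T)) (dg k) = up_sub ?n ?\<mu>"
    by (simp add: up_sub_up_sub numeral_3_eq_3)
  \<comment> \<open>Single-type elimination is stated over \<open>Id_tele D\<close>, the hypothesis
    for the tail over the transported form \<open>?I\<close>; every judgement passes between the two
    by context conversion.\<close>
  have conv: "\<Theta> @ Id_tele D @ ?L \<turnstile> J \<longleftrightarrow> \<Theta> @ [?I, lift 1 D, D] @ ?L \<turnstile> J" for \<Theta> J
    using ctx_conv[OF dg_Id_conv, of \<Theta> J] ctx_conv[OF TyEq_sym[OF dg_Id_conv], of \<Theta> J] by auto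
  have d1: "subT diag ?\<Delta>1 = subT (dg (Suc k)) \<Delta>" "sub (up_sub ?n diag) (sub (up_sub ?n ?\<mu>) e) = sub (up_sub ?n (dg (Suc k))) e" for e
    by (simp_all only: subT_subT sub_sub sub_up_sub diag_up_dg)
  have "?\<Delta>1 @ [?I, lift 1 D, D] @ ?L \<turnstile> Ty ?C1"
    using msub_Ty[OF C' msub_up[OF dg presup_ctx[OF C']]] by (simp only: T' n3 append_assoc)
  then have C1: "?\<Delta>1 @ Id_tele D @ ?L \<turnstile> Ty ?C1" unfolding conv .
  have d': "subT diag ?\<Delta>1 @ D # ?L \<turnstile> Tm d (sub (up_sub ?n diag) ?C1)"
    using d unfolding d1 by simp
  have n: "?n = length ?\<Delta>1" by simp
  note J = Jgen_Tm[OF C1 n d']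
  have "subT (dg k) (\<Delta> @ ?T) @ ?L \<turnstile> Tm (Jgen ?n d) (sub (up_sub (length (\<Delta> @ ?T)) (dg k)) C)"
    using J(1) unfolding conv T' n3 append_assoc .
  with C' elim have "(\<Delta> @ ?T) @ U \<Lambda> @ \<Xi> \<turnstile> Tm (J_iter (length (\<Delta> @ ?T)) k (Jgen ?n d)) C"
    and "subT (dg k) (\<Delta> @ ?T) @ ?L \<turnstile> TmEq (sub (up_sub (length (\<Delta> @ ?T)) (dg k)) (J_iter (length (\<Delta> @ ?T)) k (Jgen ?n d)))
      (Jgen ?n d) (sub (up_sub (length (\<Delta> @ ?T)) (dg k)) C)"
    unfolding U_elim_def by blast+
  then have j1: "\<Delta> @ U (D # \<Lambda>) @ \<Xi> \<turnstile> Tm (J_iter ?n (Suc k) d) C"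
    and j2: "?\<Delta>1 @ Id_tele D @ ?L \<turnstile> TmEq (sub (up_sub ?n ?\<mu>) (J_iter ?n (Suc k) d)) (Jgen ?n d) ?C1"
    unfolding T' n3 append_assoc conv[symmetric] by (simp_all add: numeral_3_eq_3)
  \<comment> \<open>The computation rule for the tail is evaluated on the head diagonal, so that
    both sides lie on the full diagonal \<open>dg (Suc k)\<close>.\<close>
  have "msub S (subT diag ?\<Delta>1 @ D # ?L) (up_sub ?n diag) (?\<Delta>1 @ Id_tele D @ ?L)"
    using msub_up[OF msub_diag[OF D] presup_ctx[OF C1]] by simp
  from msub_TmEq[OF j2 this]
  have "subT (dg (Suc k)) \<Delta> @ D # ?L \<turnstile>
      TmEq (sub (up_sub ?n (dg (Suc k))) (J_iter ?n (Suc k) d)) (sub (up_sub ?n diag) (Jgen ?n d)) (sub (up_sub ?n (dg (Suc k))) C)"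
    unfolding d1 .
  from TmEq_trans[OF this] J(2)
  have "subT (dg (Suc k)) \<Delta> @ D # ?L \<turnstile>
      TmEq (sub (up_sub ?n (dg (Suc k))) (J_iter ?n (Suc k) d)) d (sub (up_sub ?n (dg (Suc k))) C)"
    unfolding d1 by blast
  with j1 show "(\<Delta> @ U (D # \<Lambda>) @ \<Xi> \<turnstile> Tm (J_iter ?n (length (D # \<Lambda>)) d) C) \<and>
    (subT (dg (length (D # \<Lambda>))) \<Delta> @ (D # \<Lambda>) @ \<Xi> \<turnstile>
      TmEq (sub (up_sub ?n (dg (length (D # \<Lambda>)))) (J_iter ?n (length (D # \<Lambda>)) d)) d
        (sub (up_sub ?n (dg (length (D # \<Lambda>)))) C))"
    by simp
qed

end

text \<open>One simultaneous induction, since forming the next entries of \<open>U\<close> uses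
  transport, transport uses elimination over the shorter context, and elimination uses the typing of
  the diagonal.\<close>

lemma U_generic:
  "ctx S (\<Lambda> @ \<Xi>) \<Longrightarrow>
    ctx S (U \<Lambda> @ \<Xi>) \<and> msub S (U \<Lambda> @ \<Xi>) (ux (length \<Lambda>)) (\<Lambda> @ \<Xi>) \<and>
    msub S (U \<Lambda> @ \<Xi>) (uy (length \<Lambda>)) (\<Lambda> @ \<Xi>) \<and> msub S (\<Lambda> @ \<Xi>) (dg (length \<Lambda>)) (U \<Lambda> @ \<Xi>) \<and> U_elim \<Lambda> \<Xi>"
proof (induction \<Lambda>)
  case Nil
  then show ?case by (auto simp: msub_Var U_elim_def intro: TmEq_refl)
next
  case (Cons D \<Lambda>)
  then have D: "\<Lambda> @ \<Xi> \<turnstile> Ty D"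
    and IH: "msub S (U \<Lambda> @ \<Xi>) (ux (length \<Lambda>)) (\<Lambda> @ \<Xi>)" "msub S (U \<Lambda> @ \<Xi>) (uy (length \<Lambda>)) (\<Lambda> @ \<Xi>)"
      "msub S (\<Lambda> @ \<Xi>) (dg (length \<Lambda>)) (U \<Lambda> @ \<Xi>)" "U_elim \<Lambda> \<Xi>" by auto
  note 1 = ctx_U_step[OF D IH] msub_ux_step[OF D IH] msub_uy_step[OF D IH] msub_dg_step[OF D IH] U_elim_step[OF D IH]
  then show ?case by (simp only: append_Cons length_Cons)
qed

lemma
  assumes "ctx S (\<Lambda> @ \<Xi>)"
  shows ctx_U: "ctx S (U \<Lambda> @ \<Xi>)"
    and msub_ux: "msub S (U \<Lambda> @ \<Xi>) (ux (length \<Lambda>)) (\<Lambda> @ \<Xi>)"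
    and msub_uy: "msub S (U \<Lambda> @ \<Xi>) (uy (length \<Lambda>)) (\<Lambda> @ \<Xi>)"
    and msub_dg: "msub S (\<Lambda> @ \<Xi>) (dg (length \<Lambda>)) (U \<Lambda> @ \<Xi>)"
  using U_generic[OF assms] by auto

lemma
  assumes "ctx S (\<Lambda> @ \<Xi>)" and "\<Delta> @ U \<Lambda> @ \<Xi> \<turnstile> Ty C"
    and "subT (dg (length \<Lambda>)) \<Delta> @ \<Lambda> @ \<Xi> \<turnstile> Tm d (sub (up_sub (length \<Delta>) (dg (length \<Lambda>))) C)"
  shows Tm_J_iter: "\<Delta> @ U \<Lambda> @ \<Xi> \<turnstile> Tm (J_iter (length \<Delta>) (length \<Lambda>) d) C"
    and J_iter_comp: "subT (dg (length \<Lambda>)) \<Delta> @ \<Lambda> @ \<Xi> \<turnstile>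
      TmEq (sub (up_sub (length \<Delta>) (dg (length \<Lambda>))) (J_iter (length \<Delta>) (length \<Lambda>) d)) d
        (sub (up_sub (length \<Delta>) (dg (length \<Lambda>))) C)"
  using U_generic[OF assms(1)] assms(2,3) unfolding U_elim_def by blast+

text \<open>By elimination, an identification of \<open>t\<close> with \<open>u\<close> need only be given on the diagonal; discreteness
  turns it into a definitional equality.\<close>

lemma Id_unique:
  assumes L: "ctx S (\<Lambda> @ \<Xi>)"
    and ab: "\<Delta> @ U \<Lambda> @ \<Xi> \<turnstile> Tm a A" "\<Delta> @ U \<Lambda> @ \<Xi> \<turnstile> Tm b A"
    and t: "\<Delta> @ U \<Lambda> @ \<Xi> \<turnstile> Tm t (IdT A a b)" and u: "\<Delta> @ U \<Lambda> @ \<Xi> \<turnstile> Tm u (IdT A a b)"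
    and e: "subT (dg (length \<Lambda>)) \<Delta> @ \<Lambda> @ \<Xi> \<turnstile>
      TmEq (sub (up_sub (length \<Delta>) (dg (length \<Lambda>))) t) (sub (up_sub (length \<Delta>) (dg (length \<Lambda>))) u)
        (sub (up_sub (length \<Delta>) (dg (length \<Lambda>))) (IdT A a b))"
  shows "\<Delta> @ U \<Lambda> @ \<Xi> \<turnstile> TmEq t u (IdT A a b)"
proof -
  let ?s = "sub (up_sub (length \<Delta>) (dg (length \<Lambda>)))"
  let ?I = "IdT A a b" and ?\<Gamma> = "subT (dg (length \<Lambda>)) \<Delta> @ \<Lambda> @ \<Xi>"
  have C: "\<Delta> @ U \<Lambda> @ \<Xi> \<turnstile> Ty (IdT ?I t u)" by (rule Id_form[OF t u])
  have s: "?\<Gamma> \<turnstile> Tm (?s t) (?s ?I)" using presup_TmEq[OF e] by blast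
  have "?\<Gamma> \<turnstile> TyEq (IdT (?s ?I) (?s t) (?s t)) (IdT (?s ?I) (?s t) (?s u))"
    by (rule Id_form_cong[OF TyEq_refl[OF presup_Tm[OF s]] TmEq_refl[OF s] e])
  from Tm_conv[OF Id_intro[OF s] this]
  have "?\<Gamma> \<turnstile> Tm (ReflT (?s t)) (?s (IdT ?I t u))" by simp
  from Id_disc[OF ab t u Tm_J_iter[OF L C this]] show ?thesis .
qed

end

section \<open>Vectors of terms\<close>

context dependent_type_theory
begin

lemma el_msub: "el S \<Gamma> \<Theta> ts \<Longrightarrow> ctx S \<Gamma> \<Longrightarrow> msub S \<Gamma> (lsub ts Var) (\<Theta> @ \<Gamma>)"
  by (simp add: msub_lsub el_length msub_Var)

lemma msub_eq_refl: "msub S \<Gamma> \<sigma> \<Delta> \<Longrightarrow> msub_eq S \<Gamma> \<sigma> \<sigma> \<Delta>"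
  by (auto simp: msub_def msub_eq_def intro: TmEq_refl)

lemma el_eq_msub_eq: "el_eq S \<Gamma> \<Theta> ts us \<Longrightarrow> ctx S \<Gamma> \<Longrightarrow> msub_eq S \<Gamma> (lsub ts Var) (lsub us Var) (\<Theta> @ \<Gamma>)"
  using el_eq_length by (subst msub_eq_lsub) (fastforce simp: msub_Var msub_eq_refl)+

lemma el_eq_inst_Ty:
  "el_eq S \<Gamma> \<Theta> ts us \<Longrightarrow> \<Theta> @ \<Gamma> \<turnstile> Ty D \<Longrightarrow> \<Gamma> \<turnstile> TyEq (inst 0 ts D) (inst 0 us D)"
  using msub_eq_Ty[OF el_eq_msub_eq] ctx_appendD[OF presup_ctx] by (simp add: inst_eq_sub)

lemma el_inst_Ty: "el S \<Gamma> \<Theta> ts \<Longrightarrow> \<Theta> @ \<Gamma> \<turnstile> Ty D \<Longrightarrow> \<Gamma> \<turnstile> Ty (inst 0 ts D)"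
  using msub_Ty[OF _ el_msub] ctx_appendD[OF presup_ctx] by (simp add: inst_eq_sub)

lemma el_eq_refl: "el S \<Gamma> \<Theta> ts \<Longrightarrow> el_eq S \<Gamma> \<Theta> ts ts"
  by (induction \<Theta> ts rule: list_induct2') (auto intro: TmEq_refl)

lemma el_eq_left: "el_eq S \<Gamma> \<Theta> ts us \<Longrightarrow> el S \<Gamma> \<Theta> ts"
proof (induction \<Theta> arbitrary: ts us)
  case (Cons D \<Theta>)
  then show ?case by (cases ts; cases us) (auto dest: presup_TmEq)
qed (use el_eq.elims(2) in fastforce)

text \<open>The equality types every entry over the left list. Well-formedness of the telescope
  makes the types over both lists equal, so the entries of \<open>us\<close> can be
  converted.\<close>

lemma el_eq_right: "el_eq S \<Gamma> \<Theta> ts us \<Longrightarrow> ctx S (\<Theta> @ \<Gamma>) \<Longrightarrow> el S \<Gamma> \<Theta> us"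
proof (induction \<Theta> arbitrary: ts us)
  case (Cons D \<Theta>)
  then obtain t ts' u us' where [simp]: "ts = t # ts'" "us = u # us'" by (cases ts; cases us) auto
  have "\<Gamma> \<turnstile> TyEq (inst 0 ts' D) (inst 0 us' D)" using el_eq_inst_Ty[of \<Gamma> \<Theta> ts' us' D] Cons.prems by simp
  then show ?case using Cons presup_TmEq Tm_conv by fastforce
qed (use el_eq.elims(2) in fastforce)

lemma el_eq_sym: "el_eq S \<Gamma> \<Theta> ts us \<Longrightarrow> ctx S (\<Theta> @ \<Gamma>) \<Longrightarrow> el_eq S \<Gamma> \<Theta> us ts"
proof (induction \<Theta> arbitrary: ts us)
  case (Cons D \<Theta>)
  then obtain t ts' u us' where [simp]: "ts = t # ts'" "us = u # us'" by (cases ts; cases us) auto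
  have "\<Gamma> \<turnstile> TyEq (inst 0 ts' D) (inst 0 us' D)" using el_eq_inst_Ty[of \<Gamma> \<Theta> ts' us' D] Cons.prems by simp
  then have "\<Gamma> \<turnstile> TmEq u t (inst 0 us' D)"
    using Cons.prems TmEq_conv[OF TmEq_sym, of \<Gamma> t u "inst 0 ts' D"] by simp
  then show ?case using Cons by simp
qed (use el_eq.elims(2) in fastforce)

lemma el_eq_trans:
  "el_eq S \<Gamma> \<Theta> ts us \<Longrightarrow> el_eq S \<Gamma> \<Theta> us vs \<Longrightarrow> ctx S (\<Theta> @ \<Gamma>) \<Longrightarrow> el_eq S \<Gamma> \<Theta> ts vs"
proof (induction \<Theta> arbitrary: ts us vs)
  case (Cons D \<Theta>)
  then obtain t ts' u us' v vs' where [simp]: "ts = t # ts'" "us = u # us'" "vs = v # vs'"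
    by (cases ts; cases us; cases vs) auto
  have "\<Gamma> \<turnstile> TyEq (inst 0 us' D) (inst 0 ts' D)" using TyEq_sym[OF el_eq_inst_Ty[of \<Gamma> \<Theta> ts' us' D]] Cons.prems by simp
  then have "\<Gamma> \<turnstile> TmEq u v (inst 0 ts' D)" using Cons.prems TmEq_conv by auto
  then show ?case using Cons TmEq_trans by auto
next
  case Nil
  then show ?case by (cases ts; cases us; cases vs) auto
qed

lemma el_Vars:
  assumes "ctx S (\<Theta> @ \<Gamma>)"
  shows "el S (\<Theta> @ \<Gamma>) (subT (\<lambda>i. Var (i + length \<Theta>)) \<Theta>) (map Var [0..<length \<Theta>])"
proof -
  have "lsub (map Var [0..<length \<Theta>]) (\<lambda>i. Var (i + length \<Theta>)) = (Var :: nat \<Rightarrow> 's expr)"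
    by (auto simp: lsub_def)
  then show ?thesis
    using msub_lsub[of "map Var [0..<length \<Theta>]" \<Theta> S "\<Theta> @ \<Gamma>" "\<lambda>i. Var (i + length \<Theta>)" \<Gamma>] msub_Var[OF assms] by simp
qed

lemma sub_inst: "length ts = k \<Longrightarrow> sub \<sigma> (inst 0 ts D) = inst 0 (map (sub \<sigma>) ts) (sub (up_sub k \<sigma>) D)"
  by (simp add: inst_eq_sub sub_sub sub_lsub sub_lsub_up_sub)

lemma el_sub:
  assumes "msub S \<Gamma> \<sigma> \<Delta>"
  shows "el S \<Delta> \<Theta> ts \<Longrightarrow> el S \<Gamma> (subT \<sigma> \<Theta>) (map (sub \<sigma>) ts)"
proof (induction \<Theta> ts rule: list_induct2')
  case (4 D \<Theta> t ts)
  then show ?case using msub_Tm[OF _ assms] el_length by (fastforce simp: sub_inst)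
qed auto

lemma el_eq_sub:
  assumes "msub S \<Gamma> \<sigma> \<Delta>"
  shows "el_eq S \<Delta> \<Theta> ts us \<Longrightarrow> el_eq S \<Gamma> (subT \<sigma> \<Theta>) (map (sub \<sigma>) ts) (map (sub \<sigma>) us)"
proof (induction \<Theta> arbitrary: ts us)
  case (Cons D \<Theta>)
  then obtain t ts' u us' where [simp]: "ts = t # ts'" "us = u # us'" by (cases ts; cases us) auto
  show ?case using Cons msub_TmEq[OF _ assms] el_eq_length by (fastforce simp: sub_inst)
next
  case Nil
  then show ?case by (cases ts; cases us) auto
qed

lemma el_sub_cong:
  assumes "msub_eq S \<Gamma> \<sigma> \<tau> \<Delta>"
  shows "el S \<Delta> \<Theta> ts \<Longrightarrow> el_eq S \<Gamma> (subT \<sigma> \<Theta>) (map (sub \<sigma>) ts) (map (sub \<tau>) ts)"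
proof (induction \<Theta> ts rule: list_induct2')
  case (4 D \<Theta> t ts)
  then show ?case using msub_eq_Tm[OF assms] el_length by (fastforce simp: sub_inst)
qed auto

lemma inst_closed:
  assumes "scoped (length xs) D"
  shows "sub \<sigma> (inst 0 xs D) = inst 0 (map (sub \<sigma>) xs) D"
  unfolding inst_eq_sub sub_sub sub_lsub
  by (rule sub_cong_scoped[OF assms]) (simp add: lsub_def)

end

section \<open>Identity contexts\<close>

text \<open>Lists p, y, x for the interleaved context \<open>U\<close>, innermost component
  first.\<close>

fun il :: "'a list \<Rightarrow> 'a list \<Rightarrow> 'a list \<Rightarrow> 'a list" where
  "il (p # ps) (y # ys) (x # xs) = p # y # x # il ps ys xs"
| "il _ _ _ = []"

lemma length_il [simp]:
  "length ps = length xs \<Longrightarrow> length ys = length xs \<Longrightarrow> length (il ps ys xs) = 3 * length xs"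
  by (induction ps ys xs rule: il.induct) auto

lemma map_il: "map f (il ps ys xs) = il (map f ps) (map f ys) (map f xs)"
  by (induction ps ys xs rule: il.induct) auto

text \<open>The accumulator of \<open>J_ctx\<close> collects q, y', y in exactly the order of
  \<open>il\<close>, so the recursion only instantiates the iterate of \<open>Jgen\<close>. All
  typing questions about \<open>J_ctx\<close> are thereby moved to \<open>U\<close>.\<close>

lemma J_ctx_eq:
  "length xs' = length xs \<Longrightarrow> length ps = length xs \<Longrightarrow>
    J_ctx n ds xs xs' ps \<delta> = map (inst 0 (\<delta> @ il ps xs' xs)) (map (J_iter n (length xs)) ds)"
proof (induction xs arbitrary: n ds xs' ps \<delta>)
  case (Cons x xs)
  then obtain y ys p ps' where "xs' = y # ys" "ps = p # ps'" by (auto simp: length_Suc_conv)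
  with Cons show ?case by (simp add: Jgen_def[abs_def] comp_def)
qed simp

lemma transport_eq:
  "length xs' = length xs \<Longrightarrow> length ps = length xs \<Longrightarrow>
    transport xs xs' ps z = inst 0 (z # il ps xs' xs) (J_iter 1 (length xs) (Var 0))"
  by (simp add: transport_def J_ctx_eq)

lemma il_ux:
  "length ps = length xs \<Longrightarrow> length ys = length xs \<Longrightarrow> k = length xs \<Longrightarrow>
    (\<lambda>i. sub (lsub (il ps ys xs) \<sigma>) (ux k i)) = lsub xs \<sigma>"
proof (induction xs arbitrary: ps ys k)
  case (Cons x xs)
  then obtain y ys' p ps' where [simp]: "ys = y # ys'" "ps = p # ps'" by (auto simp: length_Suc_conv)
  show ?case
  proof
    show "sub (lsub (il ps ys (x # xs)) \<sigma>) (ux k i) = lsub (x # xs) \<sigma> i" for i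
      using fun_cong[OF Cons.IH[of ps' ys' "length xs"], of "i - 1"] Cons.prems
      by (cases i) (simp_all add: lsub_Cons numeral_2_eq_2 numeral_3_eq_3 sub_lift)
  qed
qed simp

lemma il_uy:
  "length ps = length xs \<Longrightarrow> length ys = length xs \<Longrightarrow> k = length xs \<Longrightarrow>
    (\<lambda>i. sub (lsub (il ps ys xs) \<sigma>) (uy k i)) = lsub ys \<sigma>"
proof (induction xs arbitrary: ps ys k)
  case (Cons x xs)
  then obtain y ys' p ps' where [simp]: "ys = y # ys'" "ps = p # ps'" by (auto simp: length_Suc_conv)
  show ?case
  proof
    show "sub (lsub (il ps ys (x # xs)) \<sigma>) (uy k i) = lsub ys \<sigma> i" for i
      using fun_cong[OF Cons.IH[of ps' ys' "length xs"], of "i - 1"] Cons.prems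
      by (cases i) (simp_all add: lsub_Cons numeral_2_eq_2 numeral_3_eq_3 sub_lift)
  qed
qed simp

lemma inst_il_ux:
  "length ps = length xs \<Longrightarrow> length ys = length xs \<Longrightarrow> k = length xs \<Longrightarrow> inst 0 (il ps ys xs) (sub (ux k) D) = inst 0 xs D"
  "length ps = length xs \<Longrightarrow> length ys = length xs \<Longrightarrow> k = length xs \<Longrightarrow> inst 0 (il ps ys xs) (sub (uy k) D) = inst 0 ys D"
  by (simp_all add: inst_eq_sub sub_sub il_ux il_uy)

lemma inst_Cons_lift: "inst 0 (t # ts) (lift 1 e) = inst 0 ts e"
  by (simp add: inst_eq_sub lsub_Cons sub_lift)

text \<open>The type of the head identification once the tail identifications are \<open>ps\<close>:
  it identifies y with the transport of y' along \<open>ps\<close>.\<close>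

definition Id_entry :: "'s expr \<Rightarrow> 's expr list \<Rightarrow> 's expr list \<Rightarrow> 's expr list \<Rightarrow> 's expr \<Rightarrow> 's expr \<Rightarrow> 's expr" where
  "Id_entry D ps xs' xs y y' = IdT (inst 0 xs D) y (inst 0 (y' # il ps xs' xs) (J_iter 1 (length xs) (Var 0)))"

lemma inst_U_entry:
  assumes "length ps = length xs" and "length ys = length xs" and "k = length xs"
  shows "inst 0 (y' # y # il ps ys xs) (IdT (lift 2 (sub (ux k) D)) (Var 1) (wk 1 1 (J_iter 1 k (Var 0)))) =
    Id_entry D ps ys xs y y'"
proof -
  have "inst 0 (y' # y # il ps ys xs) (lift 2 (sub (ux k) D)) = inst 0 xs D"
    using sub_lsub_lift[of "[y', y]" "lsub (il ps ys xs) Var"] inst_il_ux(1)[OF assms]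
    by (simp add: inst_eq_sub lsub_Cons numeral_2_eq_2)
  moreover have "inst 0 (y' # y # il ps ys xs) (wk 1 1 (J_iter 1 k (Var 0))) = inst 0 (y' # il ps ys xs) (J_iter 1 k (Var 0))"
    by (simp add: inst_eq_sub lsub_Cons sub_scons_wk[simplified])
  moreover have "inst 0 (y' # y # il ps ys xs) (Var 1) = y" by (simp add: inst_eq_sub lsub_Cons)
  ultimately show ?thesis by (simp add: Id_entry_def assms(3) inst_eq_sub)
qed

lemma Id_ctx_Cons:
  assumes "length xs = length \<Lambda>" and "length xs' = length \<Lambda>" and "k = length \<Lambda>"
  shows "Id_ctx (D # \<Lambda>) (y # xs) (y' # xs') =
    IdT (lift k (inst 0 xs D)) (lift k y)
      (inst 0 (lift k y' # il (map Var [0..<k]) (map (lift k) xs') (map (lift k) xs)) (J_iter 1 k (Var 0)))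
    # Id_ctx \<Lambda> xs xs'"
  using assms by (simp add: Let_def transport_eq)

lemma length_Id_ctx [simp]:
  "length xs = length \<Lambda> \<Longrightarrow> length xs' = length \<Lambda> \<Longrightarrow> length (Id_ctx \<Lambda> xs xs') = length \<Lambda>"
proof (induction \<Lambda> arbitrary: xs xs')
  case (Cons D \<Lambda>)
  then show ?case by (cases xs; cases xs') (simp_all add: Let_def del: Id_ctx.simps(1) add: Id_ctx_Cons)
qed simp

text \<open>Remembers that every entry is an identity type, the form in which discreteness applies
  entry by entry.\<close>

fun id_tele :: "'s ttheory \<Rightarrow> 's expr list \<Rightarrow> 's expr list \<Rightarrow> bool" where
  "id_tele S \<Gamma> [] = True"
| "id_tele S \<Gamma> (D # \<Theta>) =
    (id_tele S \<Gamma> \<Theta> \<and> (\<exists>A a b. D = IdT A a b \<and> (\<Theta> @ \<Gamma> \<turnstile>\<^bsub>S\<^esub> Tm a A) \<and> (\<Theta> @ \<Gamma> \<turnstile>\<^bsub>S\<^esub> Tm b A)))"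

context ML2
begin

lemma transport_Tm:
  assumes "ctx S (D # \<Lambda>)"
  shows "sub (uy (length \<Lambda>)) D # U \<Lambda> \<turnstile> Tm (J_iter 1 (length \<Lambda>) (Var 0)) (lift 1 (sub (ux (length \<Lambda>)) D))"
    and "D # \<Lambda> \<turnstile> TmEq (sub (up_sub 1 (dg (length \<Lambda>))) (J_iter 1 (length \<Lambda>) (Var 0))) (Var 0) (lift 1 D)"
proof -
  have c: "ctx S (\<Lambda> @ [])" and D: "\<Lambda> @ [] \<turnstile> Ty D" using assms by auto
  note T = Tm_transport[OF D msub_ux[OF c] msub_uy[OF c] msub_dg[OF c]]
  show "sub (uy (length \<Lambda>)) D # U \<Lambda> \<turnstile> Tm (J_iter 1 (length \<Lambda>) (Var 0)) (lift 1 (sub (ux (length \<Lambda>)) D))"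
    "D # \<Lambda> \<turnstile> TmEq (sub (up_sub 1 (dg (length \<Lambda>))) (J_iter 1 (length \<Lambda>) (Var 0))) (Var 0) (lift 1 D)"
    using T U_generic[OF c] by auto
qed

text \<open>Typed over a closed context, the transport term has only its declared variables free:
  three for each entry of \<Lambda> and the transported z. Any later substitution therefore acts on
  its arguments alone.\<close>

lemma transport_scoped: "ctx S (D # \<Lambda>) \<Longrightarrow> scoped (Suc (3 * length \<Lambda>)) (J_iter 1 (length \<Lambda>) (Var 0 :: 's expr))"
  using scope[OF transport_Tm(1), of D \<Lambda>] by simp

lemma sub_transport:
  fixes y' :: "'s expr"
  assumes "ctx S (D # \<Lambda>)" and "length xs = length \<Lambda>" and "length xs' = length \<Lambda>" and "length ps = length \<Lambda>"
  shows "sub \<sigma> (inst 0 (y' # il ps xs' xs) (J_iter 1 (length \<Lambda>) (Var 0))) =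
    inst 0 (sub \<sigma> y' # il (map (sub \<sigma>) ps) (map (sub \<sigma>) xs') (map (sub \<sigma>) xs)) (J_iter 1 (length \<Lambda>) (Var 0))"
  using inst_closed[of "y' # il ps xs' xs" "J_iter 1 (length \<Lambda>) (Var 0)" \<sigma>] transport_scoped[OF assms(1)] assms
  by (simp add: map_il)

lemma Id_ctx_Cons_entry:
  assumes c: "ctx S (D # \<Lambda>)" and n: "length xs = length \<Lambda>" "length xs' = length \<Lambda>"
  obtains h where "Id_ctx (D # \<Lambda>) (x # xs) (x' # xs') = h # Id_ctx \<Lambda> xs xs'"
    and "\<And>ps. length ps = length \<Lambda> \<Longrightarrow> inst 0 ps h = Id_entry D ps xs' xs x x'"
proof -
  let ?k = "length \<Lambda>"
  let ?h = "IdT (lift ?k (inst 0 xs D)) (lift ?k x)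
    (inst 0 (lift ?k x' # il (map Var [0..<?k]) (map (lift ?k) xs') (map (lift ?k) xs)) (J_iter 1 ?k (Var 0)))"
  show thesis
  proof (rule that)
    show "Id_ctx (D # \<Lambda>) (x # xs) (x' # xs') = ?h # Id_ctx \<Lambda> xs xs'" by (rule Id_ctx_Cons[OF n refl])
    fix ps :: "'s expr list" assume ps: "length ps = ?k"
    have i1: "inst 0 ps (lift ?k e) = e" for e using sub_lsub_lift[of ps Var e] ps by (simp add: inst_eq_sub)
    have m1: "map (inst 0 ps) (map (lift ?k) zs) = zs" for zs
      by (simp only: map_map comp_def i1 map_ident)
    have m2: "map (inst 0 ps) (map Var [0..<?k]) = ps"
      using ps by (auto simp: inst_eq_sub lsub_def intro: nth_equalityI)
    have "inst 0 ps (inst 0 (lift ?k x' # il (map Var [0..<?k]) (map (lift ?k) xs') (map (lift ?k) xs)) (J_iter 1 ?k (Var 0)))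
        = inst 0 (x' # il ps xs' xs) (J_iter 1 ?k (Var 0))"
      using sub_transport[OF c, of "map (lift ?k) xs" "map (lift ?k) xs'" "map Var [0..<?k]" "lsub ps Var" "lift ?k x'"]
        i1[of x'] m1 m2 n unfolding inst_eq_sub[of ps] by (simp only: length_map length_upt minus_nat.diff_0)
    then show "inst 0 ps ?h = Id_entry D ps xs' xs x x'"
      using i1 n by (simp add: Id_entry_def inst_eq_sub)
  qed
qed

lemma el_Id_ctx_Cons:
  assumes c: "ctx S (D # \<Lambda>)" and n: "length xs = length \<Lambda>" "length xs' = length \<Lambda>"
  shows "el S \<Gamma> (Id_ctx (D # \<Lambda>) (x # xs) (x' # xs')) (p # ps) \<longleftrightarrow>
      el S \<Gamma> (Id_ctx \<Lambda> xs xs') ps \<and> (\<Gamma> \<turnstile> Tm p (Id_entry D ps xs' xs x x'))"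
    and "el_eq S \<Gamma> (Id_ctx (D # \<Lambda>) (x # xs) (x' # xs')) (p # ps) (q # qs) \<longleftrightarrow>
      el_eq S \<Gamma> (Id_ctx \<Lambda> xs xs') ps qs \<and> (\<Gamma> \<turnstile> TmEq p q (Id_entry D ps xs' xs x x'))"
proof -
  obtain h where I: "Id_ctx (D # \<Lambda>) (x # xs) (x' # xs') = h # Id_ctx \<Lambda> xs xs'"
    and E: "\<And>ps. length ps = length \<Lambda> \<Longrightarrow> inst 0 ps h = Id_entry D ps xs' xs x x'"
    using Id_ctx_Cons_entry[OF c n] by metis
  show "el S \<Gamma> (Id_ctx (D # \<Lambda>) (x # xs) (x' # xs')) (p # ps) \<longleftrightarrow>
      el S \<Gamma> (Id_ctx \<Lambda> xs xs') ps \<and> (\<Gamma> \<turnstile> Tm p (Id_entry D ps xs' xs x x'))"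
    unfolding I el.simps using E el_length[of S \<Gamma> "Id_ctx \<Lambda> xs xs'" ps] n by auto
  show "el_eq S \<Gamma> (Id_ctx (D # \<Lambda>) (x # xs) (x' # xs')) (p # ps) (q # qs) \<longleftrightarrow>
      el_eq S \<Gamma> (Id_ctx \<Lambda> xs xs') ps qs \<and> (\<Gamma> \<turnstile> TmEq p q (Id_entry D ps xs' xs x x'))"
    unfolding I el_eq.simps using E el_eq_length[of S \<Gamma> "Id_ctx \<Lambda> xs xs'" ps qs] n by auto
qed

text \<open>A vector for \<open>U \<Lambda>\<close> is an identification together with its two end
  points. Equality of such vectors therefore compares cells over end points that are merely
  definitionally equal.\<close>

lemma el_U:
  assumes "ctx S \<Lambda>" and "length xs = length \<Lambda>" and "length xs' = length \<Lambda>" and "length ps = length \<Lambda>"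
  shows "el S \<Gamma> (U \<Lambda>) (il ps xs' xs) \<longleftrightarrow> el S \<Gamma> \<Lambda> xs \<and> el S \<Gamma> \<Lambda> xs' \<and> el S \<Gamma> (Id_ctx \<Lambda> xs xs') ps"
    and "length ys = length \<Lambda> \<Longrightarrow> length ys' = length \<Lambda> \<Longrightarrow> length qs = length \<Lambda> \<Longrightarrow>
      el_eq S \<Gamma> (U \<Lambda>) (il ps xs' xs) (il qs ys' ys) \<longleftrightarrow>
        el_eq S \<Gamma> \<Lambda> xs ys \<and> el_eq S \<Gamma> \<Lambda> xs' ys' \<and> el_eq S \<Gamma> (Id_ctx \<Lambda> xs xs') ps qs"
proof -
  have "(el S \<Gamma> (U \<Lambda>) (il ps xs' xs) \<longleftrightarrow> el S \<Gamma> \<Lambda> xs \<and> el S \<Gamma> \<Lambda> xs' \<and> el S \<Gamma> (Id_ctx \<Lambda> xs xs') ps) \<and>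
    (length ys = length \<Lambda> \<longrightarrow> length ys' = length \<Lambda> \<longrightarrow> length qs = length \<Lambda> \<longrightarrow>
      (el_eq S \<Gamma> (U \<Lambda>) (il ps xs' xs) (il qs ys' ys) \<longleftrightarrow>
        el_eq S \<Gamma> \<Lambda> xs ys \<and> el_eq S \<Gamma> \<Lambda> xs' ys' \<and> el_eq S \<Gamma> (Id_ctx \<Lambda> xs xs') ps qs))"
    for ys ys' qs
    using assms
  proof (induction \<Lambda> arbitrary: xs xs' ps ys ys' qs)
    case (Cons D \<Lambda>)
    let ?k = "length \<Lambda>"
    from Cons.prems obtain x x' p xs1 xs1' ps1
      where l: "xs = x # xs1" "xs' = x' # xs1'" "ps = p # ps1" and
        n: "length xs1 = ?k" "length xs1' = ?k" "length ps1 = ?k" by (auto simp: length_Suc_conv)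
    have c: "ctx S \<Lambda>" and sc: "scoped ?k D" using Cons.prems ctx_scoped[of "[]"] by auto
    obtain h where I: "Id_ctx (D # \<Lambda>) xs xs' = h # Id_ctx \<Lambda> xs1 xs1'"
      and E: "inst 0 ps1 h = Id_entry D ps1 xs1' xs1 x x'"
      using Id_ctx_Cons_entry[OF Cons.prems(1) n(1,2)] n(3) l by metis
    have y1: "inst 0 (x # il ps1 xs1' xs1) (lift 1 (sub (uy ?k) D)) = inst 0 xs1' D"
      unfolding inst_Cons_lift by (rule inst_il_ux(2)) (simp_all add: n)
    have x1: "inst 0 (il ps1 xs1' xs1) (sub (ux ?k) D) = inst 0 xs1 D"
      by (rule inst_il_ux(1)) (simp_all add: n)
    have u1: "inst 0 (x' # x # il ps1 xs1' xs1) (IdT (lift 2 (sub (ux ?k) D)) (Var 1) (wk 1 1 (J_iter 1 ?k (Var 0)))) =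
      Id_entry D ps1 xs1' xs1 x x'"
      by (rule inst_U_entry) (simp_all add: n)
    have "el S \<Gamma> (U (D # \<Lambda>)) (il ps xs' xs) \<longleftrightarrow> el S \<Gamma> (D # \<Lambda>) xs \<and> el S \<Gamma> (D # \<Lambda>) xs' \<and> el S \<Gamma> (Id_ctx (D # \<Lambda>) xs xs') ps"
      unfolding I using Cons.IH[OF c n, of ys ys' qs]
      by (auto simp only: l il.simps U.simps append_Cons append_Nil el.simps x1 y1 u1 E)
    moreover have "el_eq S \<Gamma> (U (D # \<Lambda>)) (il ps xs' xs) (il qs ys' ys) \<longleftrightarrow>
        el_eq S \<Gamma> (D # \<Lambda>) xs ys \<and> el_eq S \<Gamma> (D # \<Lambda>) xs' ys' \<and> el_eq S \<Gamma> (Id_ctx (D # \<Lambda>) xs xs') ps qs"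
      if "length ys = length (D # \<Lambda>)" "length ys' = length (D # \<Lambda>)" "length qs = length (D # \<Lambda>)"
    proof -
      from that obtain z z' q zs zs' qs1
        where l': "ys = z # zs" "ys' = z' # zs'" "qs = q # qs1" and
          n': "length zs = ?k" "length zs' = ?k" "length qs1 = ?k" by (auto simp: length_Suc_conv)
      show ?thesis
        unfolding I using Cons.IH[OF c n, of zs zs' qs1] n'
        by (auto simp only: l l' il.simps U.simps append_Cons append_Nil el_eq.simps x1 y1 u1 E)
    qed
    ultimately show ?case by blast
  qed simp
  then show "el S \<Gamma> (U \<Lambda>) (il ps xs' xs) \<longleftrightarrow> el S \<Gamma> \<Lambda> xs \<and> el S \<Gamma> \<Lambda> xs' \<and> el S \<Gamma> (Id_ctx \<Lambda> xs xs') ps"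
    and "length ys = length \<Lambda> \<Longrightarrow> length ys' = length \<Lambda> \<Longrightarrow> length qs = length \<Lambda> \<Longrightarrow>
      el_eq S \<Gamma> (U \<Lambda>) (il ps xs' xs) (il qs ys' ys) \<longleftrightarrow>
        el_eq S \<Gamma> \<Lambda> xs ys \<and> el_eq S \<Gamma> \<Lambda> xs' ys' \<and> el_eq S \<Gamma> (Id_ctx \<Lambda> xs xs') ps qs"
    by blast+
qed

lemma subT_Id_ctx:
  assumes "ctx S \<Lambda>" and "length xs = length \<Lambda>" and "length xs' = length \<Lambda>"
  shows "subT \<sigma> (Id_ctx \<Lambda> xs xs') = Id_ctx \<Lambda> (map (sub \<sigma>) xs) (map (sub \<sigma>) xs')"
  using assms
proof (induction \<Lambda> arbitrary: xs xs')
  case (Cons D \<Lambda>)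
  let ?k = "length \<Lambda>"
  from Cons.prems obtain x x' xs1 xs1' where l: "xs = x # xs1" "xs' = x' # xs1'"
    and n: "length xs1 = ?k" "length xs1' = ?k" by (auto simp: length_Suc_conv)
  let ?s = "sub (up_sub ?k \<sigma>)"
  have m: "map ?s (map (lift ?k) zs) = map (lift ?k) (map (sub \<sigma>) zs)" for zs
    by (simp add: sub_up_sub_lift)
  have sc: "scoped (length xs1) D" using Cons.prems ctx_scoped[of "[]"] n by auto
  show ?case
    using Cons.IH[of xs1 xs1'] Cons.prems n sub_transport[OF Cons.prems(1), of "map (lift ?k) xs1" "map (lift ?k) xs1'" "map Var [0..<?k]"]
    unfolding l list.map
    by (simp only: Id_ctx_Cons length_map n subT.simps length_Id_ctx sub.simps sub_up_sub_lift
        length_upt minus_nat.diff_0 m map_sub_up_sub_Vars inst_closed[OF sc]) simp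
qed simp

text \<open>The type of the next identification contains a transport along the generic
  identifications already declared. With the weakened end points these form a vector for
  \<open>U \<Lambda>\<close>, over which the transport term is typed.\<close>

lemma Id_ctx_ctx:
  assumes "ctx S \<Lambda>" and "ctx S \<Gamma>" and "el S \<Gamma> \<Lambda> xs" and "el S \<Gamma> \<Lambda> xs'"
  shows "ctx S (Id_ctx \<Lambda> xs xs' @ \<Gamma>) \<and> id_tele S \<Gamma> (Id_ctx \<Lambda> xs xs')"
  using assms
proof (induction \<Lambda> arbitrary: xs xs')
  case (Cons D \<Lambda>)
  let ?k = "length \<Lambda>"
  have "length xs = Suc ?k" "length xs' = Suc ?k" using el_length Cons.prems(3,4) by force+
  then obtain x x' xs1 xs1' where l: "xs = x # xs1" "xs' = x' # xs1'"
    and n: "length xs1 = ?k" "length xs1' = ?k" by (auto simp: length_Suc_conv)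
  have sc: "scoped (length xs1) D" "scoped (length xs1') D" using Cons.prems ctx_scoped[of "[]"] n by auto
  have c: "ctx S \<Lambda>" and D: "\<Lambda> \<turnstile> Ty D" using Cons.prems by auto
  let ?T = "Id_ctx \<Lambda> xs1 xs1'"
  let ?G = "?T @ \<Gamma>" and ?L = "map (lift ?k)" and ?vs = "map Var [0..<?k]"
  have IH: "ctx S ?G" "id_tele S \<Gamma> ?T" using Cons by (auto simp: l)
  have lT: "length ?T = ?k" using n by simp
  have sh: "msub S ?G (\<lambda>i. Var (i + ?k)) \<Gamma>" using msub_shift[OF IH(1)] lT by simp
  have e1: "el S ?G \<Lambda> (?L xs1)" "el S ?G \<Lambda> (?L xs1')"
    using el_sub[OF sh, of \<Lambda> xs1] el_sub[OF sh, of \<Lambda> xs1'] Cons.prems subT_closed[OF c]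
    by (simp_all add: l lift_eq_sub)
  have "el S ?G (subT (\<lambda>i. Var (i + ?k)) ?T) ?vs" using el_Vars[OF IH(1)] lT by simp
  then have "el S ?G (Id_ctx \<Lambda> (?L xs1) (?L xs1')) ?vs"
    using subT_Id_ctx[OF c n] by (simp add: lift_eq_sub)
  with e1 have U: "el S ?G (U \<Lambda>) (il ?vs (?L xs1') (?L xs1))"
    using el_U(1)[OF c] n by simp
  have x: "\<Gamma> \<turnstile> Tm x (inst 0 xs1 D)" "\<Gamma> \<turnstile> Tm x' (inst 0 xs1' D)" using Cons.prems by (auto simp: l)
  have x1: "?G \<turnstile> Tm (lift ?k x) (inst 0 (?L xs1) D)" "?G \<turnstile> Tm (lift ?k x') (inst 0 (?L xs1') D)"
    using msub_Tm[OF x(1) sh] msub_Tm[OF x(2) sh] unfolding inst_closed[OF sc(1)] inst_closed[OF sc(2)]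
    by (simp_all add: lift_eq_sub)
  have "msub S ?G (lsub (il ?vs (?L xs1') (?L xs1)) Var) (U \<Lambda>)"
    using U el_iff_msub[OF _ IH(1), of "U \<Lambda>"] ctx_U[of \<Lambda> "[]"] c n by simp
  moreover have "?G \<turnstile> Tm (lift ?k x') (sub (lsub (il ?vs (?L xs1') (?L xs1)) Var) (sub (uy ?k) D))"
    using x1(2) inst_il_ux(2)[of ?vs "?L xs1" "?L xs1'" ?k D] n by (simp add: inst_eq_sub)
  ultimately have ms: "msub S ?G (lsub (lift ?k x' # il ?vs (?L xs1') (?L xs1)) Var) (sub (uy ?k) D # U \<Lambda>)"
    by (simp add: lsub_Cons msub_scons)
  have ty: "sub (lsub (lift ?k x' # il ?vs (?L xs1') (?L xs1)) Var) (lift 1 (sub (ux ?k) D)) = inst 0 (?L xs1) D"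
    using inst_il_ux(1)[of ?vs "?L xs1" "?L xs1'" ?k D] n by (simp add: inst_eq_sub lsub_Cons sub_lift)
  have t: "?G \<turnstile> Tm (inst 0 (lift ?k x' # il ?vs (?L xs1') (?L xs1)) (J_iter 1 ?k (Var 0))) (inst 0 (?L xs1) D)"
    using msub_Tm[OF transport_Tm(1)[OF Cons.prems(1)] ms] unfolding ty inst_eq_sub .
  have i: "lift ?k (inst 0 xs1 D) = inst 0 (?L xs1) D"
    using inst_closed[OF sc(1)] by (simp add: lift_eq_sub)
  show ?case
    unfolding l Id_ctx_Cons[OF n refl] using IH Id_form[OF x1(1) t] x1(1) t by (auto simp: i)
qed simp

text \<open>Componentwise elimination into a telescope. The motive of a component mentions the
  earlier eliminated components, which on the diagonal equal the given \<open>ds\<close> only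
  definitionally, so each premise is converted before its elimination.\<close>

lemma J_iter_tele:
  assumes "ctx S (\<Lambda> @ \<Xi>)" and "n = length \<Delta>"
  shows "ctx S (\<Theta> @ \<Delta> @ U \<Lambda> @ \<Xi>) \<Longrightarrow>
    el S (subT (dg (length \<Lambda>)) \<Delta> @ \<Lambda> @ \<Xi>) (subT (up_sub n (dg (length \<Lambda>))) \<Theta>) ds \<Longrightarrow>
    el S (\<Delta> @ U \<Lambda> @ \<Xi>) \<Theta> (map (J_iter n (length \<Lambda>)) ds) \<and>
    el_eq S (subT (dg (length \<Lambda>)) \<Delta> @ \<Lambda> @ \<Xi>) (subT (up_sub n (dg (length \<Lambda>))) \<Theta>)
      (map (sub (up_sub n (dg (length \<Lambda>)))) (map (J_iter n (length \<Lambda>)) ds)) ds"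
proof (induction \<Theta> ds rule: list_induct2')
  case (4 D \<Theta> d ds)
  let ?k = "length \<Lambda>"
  let ?s = "up_sub n (dg ?k)" and ?G = "subT (dg ?k) \<Delta> @ \<Lambda> @ \<Xi>" and ?J = "map (J_iter n ?k) ds"
  from 4 have IH: "el S (\<Delta> @ U \<Lambda> @ \<Xi>) \<Theta> ?J" "el_eq S ?G (subT ?s \<Theta>) (map (sub ?s) ?J) ds"
    and D: "\<Theta> @ \<Delta> @ U \<Lambda> @ \<Xi> \<turnstile> Ty D" by auto
  have l: "length ?J = length \<Theta>" using el_length[OF IH(1)] by simp
  have C: "\<Delta> @ U \<Lambda> @ \<Xi> \<turnstile> Ty (inst 0 ?J D)" by (rule el_inst_Ty[OF IH(1) D])
  have ms: "msub S ?G ?s (\<Delta> @ U \<Lambda> @ \<Xi>)"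
    using msub_up[OF msub_dg[OF assms(1)] presup_ctx[OF C]] assms(2) by simp
  have c: "ctx S (subT ?s \<Theta> @ ?G)" by (rule msub_ctx[OF ms presup_ctx[OF D]])
  have "subT ?s \<Theta> @ ?G \<turnstile> Ty (sub (up_sub (length \<Theta>) ?s) D)"
    using msub_Ty[OF D msub_up[OF ms presup_ctx[OF D]]] .
  from el_eq_inst_Ty[OF el_eq_sym[OF IH(2) c] this]
  have "?G \<turnstile> TyEq (inst 0 ds (sub (up_sub (length \<Theta>) ?s) D)) (sub ?s (inst 0 ?J D))"
    by (simp add: sub_inst[OF l])
  moreover have "?G \<turnstile> Tm d (inst 0 ds (sub (up_sub (length \<Theta>) ?s) D))" using 4 by simp
  ultimately have "?G \<turnstile> Tm d (sub ?s (inst 0 ?J D))" using Tm_conv by blast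
  with Tm_J_iter[OF assms(1) C] J_iter_comp[OF assms(1) C]
  have "\<Delta> @ U \<Lambda> @ \<Xi> \<turnstile> Tm (J_iter n ?k d) (inst 0 ?J D)"
    "?G \<turnstile> TmEq (sub ?s (J_iter n ?k d)) d (sub ?s (inst 0 ?J D))"
    by (simp_all add: assms(2))
  with IH show ?case by (simp add: sub_inst[OF l])
qed auto

text \<open>Uniqueness entry by entry; the entry of \<open>us\<close> is first converted along the
  equality already shown for the preceding entries.\<close>

lemma Id_unique_tele:
  assumes L: "ctx S (\<Lambda> @ \<Xi>)" and n: "n = length \<Delta>"
  shows "id_tele S (\<Delta> @ U \<Lambda> @ \<Xi>) \<Theta> \<Longrightarrow> ctx S (\<Theta> @ \<Delta> @ U \<Lambda> @ \<Xi>) \<Longrightarrow>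
    el S (\<Delta> @ U \<Lambda> @ \<Xi>) \<Theta> ts \<Longrightarrow> el S (\<Delta> @ U \<Lambda> @ \<Xi>) \<Theta> us \<Longrightarrow>
    el_eq S (subT (dg (length \<Lambda>)) \<Delta> @ \<Lambda> @ \<Xi>) (subT (up_sub n (dg (length \<Lambda>))) \<Theta>)
      (map (sub (up_sub n (dg (length \<Lambda>)))) ts) (map (sub (up_sub n (dg (length \<Lambda>)))) us) \<Longrightarrow>
    el_eq S (\<Delta> @ U \<Lambda> @ \<Xi>) \<Theta> ts us"
proof (induction \<Theta> arbitrary: ts us)
  case (Cons D \<Theta>)
  let ?k = "length \<Lambda>" and ?W = "\<Delta> @ U \<Lambda> @ \<Xi>"
  let ?s = "up_sub n (dg ?k)" and ?G = "subT (dg ?k) \<Delta> @ \<Lambda> @ \<Xi>"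
  obtain t ts' u us' where [simp]: "ts = t # ts'" "us = u # us'" using Cons.prems by (cases ts; cases us) auto
  have IH: "el_eq S ?W \<Theta> ts' us'" using Cons by auto
  have l: "length ts' = length \<Theta>" using el_eq_length[OF IH] by simp
  obtain A a b where D: "D = IdT A a b" and ab: "\<Theta> @ ?W \<turnstile> Tm a A" "\<Theta> @ ?W \<turnstile> Tm b A"
    using Cons.prems by auto
  have DT: "\<Theta> @ ?W \<turnstile> Ty D" and c: "ctx S ?W" using Cons.prems ctx_appendD[of S \<Theta>] by auto
  have ms: "msub S ?W (lsub ts' Var) (\<Theta> @ ?W)" using el_msub[OF _ c] Cons.prems by simp
  have ab': "?W \<turnstile> Tm (inst 0 ts' a) (inst 0 ts' A)" "?W \<turnstile> Tm (inst 0 ts' b) (inst 0 ts' A)"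
    using msub_Tm[OF _ ms] ab by (simp_all add: inst_eq_sub)
  have D': "inst 0 ts' D = IdT (inst 0 ts' A) (inst 0 ts' a) (inst 0 ts' b)" by (simp add: D inst_eq_sub)
  have t: "?W \<turnstile> Tm t (inst 0 ts' D)" using Cons.prems by simp
  have "?W \<turnstile> Tm u (inst 0 us' D)" using Cons.prems by simp
  from Tm_conv[OF this TyEq_sym[OF el_eq_inst_Ty[OF IH DT]]] have u: "?W \<turnstile> Tm u (inst 0 ts' D)" .
  have "?G \<turnstile> TmEq (sub ?s t) (sub ?s u) (sub ?s (inst 0 ts' D))"
    using Cons.prems by (simp add: sub_inst[OF l])
  then have "?W \<turnstile> TmEq t u (inst 0 ts' D)"
    using Id_unique[OF L ab'] t u unfolding D' n by blast
  with IH show ?case by simp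
next
  case Nil
  then show ?case by (cases ts; cases us) auto
qed

end

section \<open>Categories of terms\<close>

text \<open>The composite of p from f to g with q from g to h; the source f does not occur in the
  raw term.\<close>

definition vcomp :: "'s expr \<Rightarrow> 's expr \<Rightarrow> 's expr \<Rightarrow> 's expr \<Rightarrow> 's expr" where
  "vcomp g h q p = J_ext 1 (Var 0) g h q [p]"

lemma sub_vcomp: "sub \<sigma> (vcomp g h q p) = vcomp (sub \<sigma> g) (sub \<sigma> h) (sub \<sigma> q) (sub \<sigma> p)"
  by (simp add: vcomp_def J_ext_def up_sub_def)

lemma Jgen_1_Var0: "Jgen 1 (Var 0) = vcomp (Var 3) (Var 2) (Var 1) (Var 0)"
  by (simp add: Jgen_def vcomp_def numeral_2_eq_2 numeral_3_eq_3)

lemma U_single: "U [A] = Id_tele A"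
  by simp

lemma dg_single: "dg (length [A]) = diag"
  by simp

context ML2
begin

lemma Id_unique1:
  assumes ab: "\<Delta> @ Id_tele B @ \<Gamma> \<turnstile> Tm a A" "\<Delta> @ Id_tele B @ \<Gamma> \<turnstile> Tm b A"
    and t: "\<Delta> @ Id_tele B @ \<Gamma> \<turnstile> Tm t (IdT A a b)" and u: "\<Delta> @ Id_tele B @ \<Gamma> \<turnstile> Tm u (IdT A a b)"
    and e: "subT diag \<Delta> @ B # \<Gamma> \<turnstile>
      TmEq (sub (up_sub (length \<Delta>) diag) t) (sub (up_sub (length \<Delta>) diag) u) (sub (up_sub (length \<Delta>) diag) (IdT A a b))"
  shows "\<Delta> @ Id_tele B @ \<Gamma> \<turnstile> TmEq t u (IdT A a b)"
proof -
  have "ctx S ([B] @ \<Gamma>)" using ctx_appendD[of S \<Delta>] presup_ctx[OF t] by fastforce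
  from Id_unique[OF this, unfolded U_single dg_single append_Cons[of B] append_Nil, OF ab t u e] show ?thesis .
qed

section \<open>Category laws for identifications of terms\<close>

context
  fixes \<Gamma> A f
  assumes f: "\<Gamma> \<turnstile> Tm f A"
begin

lemma Id_from_Ty: "Id_tele A @ \<Gamma> \<turnstile> Ty (IdT (lift 3 A) (lift 3 f) (Var 2))"
proof -
  have c: "ctx S (Id_tele A @ \<Gamma>)" by (rule ctx_Id_tele[OF presup_Tm[OF f]])
  have "Id_tele A @ \<Gamma> \<turnstile> Tm (lift 3 f) (lift 3 A)"
    using lift_judgement[OF f c] by (simp add: numeral_3_eq_3)
  moreover have "Id_tele A @ \<Gamma> \<turnstile> Tm (Var 2) (lift 3 A)"
    using variable[OF c, of 2] by (simp add: numeral_3_eq_3 numeral_2_eq_2)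
  ultimately show ?thesis by (rule Id_form)
qed

text \<open>Elimination on q : Id(x, y) with x and y generic and p : Id(f, x) as post-context. The
  source f stays a fixed term over \<Gamma>, weakened past these four variables.\<close>

lemma vcomp_generic:
  "[IdT (lift 3 A) (lift 3 f) (Var 2)] @ Id_tele A @ \<Gamma> \<turnstile>
    Tm (vcomp (Var 3) (Var 2) (Var 1) (Var 0)) (IdT (lift 4 A) (lift 4 f) (Var 2))"
  "[IdT (lift 1 A) (lift 1 f) (Var 0)] @ A # \<Gamma> \<turnstile>
    TmEq (vcomp (Var 1) (Var 1) (ReflT (Var 1)) (Var 0)) (Var 0) (IdT (lift 2 A) (lift 2 f) (Var 1))"
proof -
  let ?D = "[IdT (lift 3 A) (lift 3 f) (Var 2)]" and ?C = "IdT (lift 4 A) (lift 4 f) (Var 2)"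
  have A: "\<Gamma> \<turnstile> Ty A" by (rule presup_Tm[OF f])
  have c: "ctx S (?D @ Id_tele A @ \<Gamma>)" using presup_Ty_ctx[OF Id_from_Ty] by simp
  have "?D @ Id_tele A @ \<Gamma> \<turnstile> Tm (lift 4 f) (lift 4 A)"
    using lift_judgement[OF f, of "?D @ Id_tele A"] c by (simp add: eval_nat_numeral)
  moreover have "?D @ Id_tele A @ \<Gamma> \<turnstile> Tm (Var 2) (lift 4 A)"
    using variable[OF c, of 2] by (simp add: eval_nat_numeral lift_lift)
  ultimately have C: "?D @ Id_tele A @ \<Gamma> \<turnstile> Ty ?C" by (rule Id_form)
  have sD: "subT diag ?D = [IdT (lift 1 A) (lift 1 f) (Var 0)]"
    by (simp add: sub_lift lsub_def eval_nat_numeral) (simp add: lift_eq_sub)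
  have sC: "sub (up_sub 1 diag) ?C = IdT (lift 2 A) (lift 2 f) (Var 1)"
    by (simp add: sub_lift up_sub_def lsub_def eval_nat_numeral) (simp add: lift_eq_sub)
  have "A # \<Gamma> \<turnstile> Ty (IdT (lift 1 A) (lift 1 f) (Var 0))"
    using Id_form[OF lift1_Tm[OF f A] Tm_Var0[OF A]] .
  from Tm_Var0[OF this]
  have d: "subT diag ?D @ A # \<Gamma> \<turnstile> Tm (Var 0) (sub (up_sub 1 diag) ?C)"
    unfolding sD sC by (simp add: lift_lift eval_nat_numeral)
  have 1: "1 = length ?D" by simp
  show "?D @ Id_tele A @ \<Gamma> \<turnstile> Tm (vcomp (Var 3) (Var 2) (Var 1) (Var 0)) ?C"
    using Jgen_Tm(1)[OF C 1 d] unfolding Jgen_1_Var0 .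
  have sv: "sub (up_sub 1 diag) (vcomp (Var 3) (Var 2) (Var 1) (Var 0)) = vcomp (Var 1) (Var 1) (ReflT (Var 1)) (Var 0)"
    by (simp add: sub_vcomp up_sub_def lsub_def eval_nat_numeral)
  show "[IdT (lift 1 A) (lift 1 f) (Var 0)] @ A # \<Gamma> \<turnstile>
    TmEq (vcomp (Var 1) (Var 1) (ReflT (Var 1)) (Var 0)) (Var 0) (IdT (lift 2 A) (lift 2 f) (Var 1))"
    using Jgen_Tm(2)[OF C 1 d] unfolding Jgen_1_Var0 sv sD sC .
qed

text \<open>Congruence of substitution, applied to the generic composite with the two lists of
  values for its four variables.\<close>

lemma vcomp_cong:
  assumes g: "\<Gamma> \<turnstile> TmEq g g' A" and h: "\<Gamma> \<turnstile> TmEq h h' A"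
    and p: "\<Gamma> \<turnstile> TmEq p p' (IdT A f g)" and q: "\<Gamma> \<turnstile> TmEq q q' (IdT A g h)"
  shows "\<Gamma> \<turnstile> TmEq (vcomp g h q p) (vcomp g' h' q' p') (IdT A f h)"
proof -
  have c: "ctx S \<Gamma>" by (rule presup_ctx[OF f])
  have "msub_eq S \<Gamma> (lsub [p, q, h, g] Var) (lsub [p', q', h', g'] Var) ([IdT (lift 3 A) (lift 3 f) (Var 2)] @ Id_tele A @ \<Gamma>)"
    using assms msub_eq_refl[OF msub_Var[OF c]] by (simp add: lsub_Cons msub_eq_scons sub_lift eval_nat_numeral)
  from msub_eq_Tm[OF this vcomp_generic(1)] show ?thesis
    by (simp add: sub_vcomp lsub_Cons sub_lift eval_nat_numeral)
qed

lemma vcomp_Tm: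
  assumes "\<Gamma> \<turnstile> Tm g A" and "\<Gamma> \<turnstile> Tm h A" and "\<Gamma> \<turnstile> Tm p (IdT A f g)" and "\<Gamma> \<turnstile> Tm q (IdT A g h)"
  shows "\<Gamma> \<turnstile> Tm (vcomp g h q p) (IdT A f h)"
  using vcomp_cong[OF assms[THEN TmEq_refl]] presup_TmEq by blast

lemma vcomp_refl_left:
  assumes "\<Gamma> \<turnstile> Tm g A" and "\<Gamma> \<turnstile> Tm p (IdT A f g)"
  shows "\<Gamma> \<turnstile> TmEq (vcomp g g (ReflT g) p) p (IdT A f g)"
proof -
  have c: "ctx S \<Gamma>" by (rule presup_ctx[OF f])
  have "msub S \<Gamma> (lsub [p, g] Var) ([IdT (lift 1 A) (lift 1 f) (Var 0)] @ A # \<Gamma>)"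
    using assms msub_Var[OF c] by (simp add: lsub_Cons msub_scons sub_lift)
  from msub_TmEq[OF vcomp_generic(2) this] show ?thesis
    by (simp add: sub_vcomp lsub_Cons sub_lift eval_nat_numeral)
qed

end

text \<open>Uniqueness for a generic p: at p = r(x) both sides are r(x), by the left unit
  law.\<close>

lemma vcomp_refl_right:
  assumes f: "\<Gamma> \<turnstile> Tm f A" and g: "\<Gamma> \<turnstile> Tm g A" and p: "\<Gamma> \<turnstile> Tm p (IdT A f g)"
  shows "\<Gamma> \<turnstile> TmEq (vcomp f g p (ReflT f)) p (IdT A f g)"
proof -
  have A: "\<Gamma> \<turnstile> Ty A" by (rule presup_Tm[OF f])
  have cI: "ctx S ([] @ Id_tele A @ \<Gamma>)" using ctx_Id_tele[OF A] by simp
  have v: "[] @ Id_tele A @ \<Gamma> \<turnstile> Tm (Var 2) (lift 3 A)" "[] @ Id_tele A @ \<Gamma> \<turnstile> Tm (Var 1) (lift 3 A)"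
    "[] @ Id_tele A @ \<Gamma> \<turnstile> Tm (Var 0) (IdT (lift 3 A) (Var 2) (Var 1))"
    using variable[OF cI, of 2] variable[OF cI, of 1] variable[OF cI, of 0]
    by (simp_all add: lift_lift eval_nat_numeral)
  have v0: "A # \<Gamma> \<turnstile> Tm (Var 0) (lift 1 A)" by (rule Tm_Var0[OF A])
  have "[] @ Id_tele A @ \<Gamma> \<turnstile>
      TmEq (vcomp (Var 2) (Var 1) (Var 0) (ReflT (Var 2))) (Var 0) (IdT (lift 3 A) (Var 2) (Var 1))"
  proof (rule Id_unique1)
    show "[] @ Id_tele A @ \<Gamma> \<turnstile> Tm (Var 2) (lift 3 A)" "[] @ Id_tele A @ \<Gamma> \<turnstile> Tm (Var 1) (lift 3 A)"
      "[] @ Id_tele A @ \<Gamma> \<turnstile> Tm (Var 0) (IdT (lift 3 A) (Var 2) (Var 1))" by fact+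
    show "[] @ Id_tele A @ \<Gamma> \<turnstile> Tm (vcomp (Var 2) (Var 1) (Var 0) (ReflT (Var 2))) (IdT (lift 3 A) (Var 2) (Var 1))"
      by (rule vcomp_Tm[OF v(1) v(1) v(2) Id_intro[OF v(1)] v(3)])
    have "sub diag (lift 3 A) = lift 1 A" by (simp add: sub_lift lsub_def eval_nat_numeral) (simp add: lift_eq_sub)
    then show "subT diag [] @ A # \<Gamma> \<turnstile>
      TmEq (sub (up_sub (length []) diag) (vcomp (Var 2) (Var 1) (Var 0) (ReflT (Var 2)))) (sub (up_sub (length []) diag) (Var 0))
        (sub (up_sub (length []) diag) (IdT (lift 3 A) (Var 2) (Var 1)))"
      using vcomp_refl_left[OF v0 v0 Id_intro[OF v0]] by (simp add: sub_vcomp lsub_def eval_nat_numeral)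
  qed
  then have e: "Id_tele A @ \<Gamma> \<turnstile>
      TmEq (vcomp (Var 2) (Var 1) (Var 0) (ReflT (Var 2))) (Var 0) (IdT (lift 3 A) (Var 2) (Var 1))" by simp
  have "msub S \<Gamma> (lsub [p, g, f] Var) (Id_tele A @ \<Gamma>)"
    using assms msub_Var[OF presup_ctx[OF f]] by (intro msub_Id_tele) auto
  from msub_TmEq[OF e this] show ?thesis by (simp add: sub_vcomp lsub_Cons sub_lift eval_nat_numeral)
qed

text \<open>Uniqueness in r, with q in the post-context and f, g, p fixed. When r is reflexivity,
  the left unit law reduces both sides to the composite of q and p.\<close>

lemma vcomp_assoc:
  assumes f: "\<Gamma> \<turnstile> Tm f A" and g: "\<Gamma> \<turnstile> Tm g A" and h: "\<Gamma> \<turnstile> Tm h A" and k: "\<Gamma> \<turnstile> Tm k A"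
    and p: "\<Gamma> \<turnstile> Tm p (IdT A f g)" and q: "\<Gamma> \<turnstile> Tm q (IdT A g h)" and r: "\<Gamma> \<turnstile> Tm r (IdT A h k)"
  shows "\<Gamma> \<turnstile> TmEq (vcomp h k r (vcomp g h q p)) (vcomp g k (vcomp h k r q) p) (IdT A f k)"
proof -
  let ?D = "[IdT (lift 3 A) (lift 3 g) (Var 2)]"
  let ?G = "?D @ Id_tele A @ \<Gamma>"
  let ?t = "vcomp (Var 3) (Var 2) (Var 1) (vcomp (lift 4 g) (Var 3) (Var 0) (lift 4 p))"
  let ?u = "vcomp (lift 4 g) (Var 2) (vcomp (Var 3) (Var 2) (Var 1) (Var 0)) (lift 4 p)"
  have A: "\<Gamma> \<turnstile> Ty A" by (rule presup_Tm[OF f])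
  have c: "ctx S ?G" using presup_Ty_ctx[OF Id_from_Ty[OF g]] by simp
  have v: "?G \<turnstile> Tm (Var 3) (lift 4 A)" "?G \<turnstile> Tm (Var 2) (lift 4 A)"
    "?G \<turnstile> Tm (Var 1) (IdT (lift 4 A) (Var 3) (Var 2))" "?G \<turnstile> Tm (Var 0) (IdT (lift 4 A) (lift 4 g) (Var 3))"
    using variable[OF c, of 3] variable[OF c, of 2] variable[OF c, of 1] variable[OF c, of 0]
    by (simp_all add: lift_lift eval_nat_numeral)
  have l: "?G \<turnstile> Tm (lift 4 f) (lift 4 A)" "?G \<turnstile> Tm (lift 4 g) (lift 4 A)"
    "?G \<turnstile> Tm (lift 4 p) (IdT (lift 4 A) (lift 4 f) (lift 4 g))"
    using lift_judgement[OF f, of "?D @ Id_tele A"] lift_judgement[OF g, of "?D @ Id_tele A"]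
      lift_judgement[OF p, of "?D @ Id_tele A"] c by (simp_all add: eval_nat_numeral)
  let ?H = "[IdT (lift 1 A) (lift 1 g) (Var 0)] @ A # \<Gamma>"
  have "A # \<Gamma> \<turnstile> Ty (IdT (lift 1 A) (lift 1 g) (Var 0))"
    using Id_form[OF lift1_Tm[OF g A] Tm_Var0[OF A]] .
  from presup_Ty_ctx[OF this] have cH: "ctx S ?H" by simp
  have w: "?H \<turnstile> Tm (Var 1) (lift 2 A)" "?H \<turnstile> Tm (Var 0) (IdT (lift 2 A) (lift 2 g) (Var 1))"
    using variable[OF cH, of 1] variable[OF cH, of 0] by (simp_all add: lift_lift eval_nat_numeral)
  have m: "?H \<turnstile> Tm (lift 2 f) (lift 2 A)" "?H \<turnstile> Tm (lift 2 g) (lift 2 A)"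
    "?H \<turnstile> Tm (lift 2 p) (IdT (lift 2 A) (lift 2 f) (lift 2 g))"
    using lift_judgement[OF f, of "[IdT (lift 1 A) (lift 1 g) (Var 0), A]"] lift_judgement[OF g, of "[IdT (lift 1 A) (lift 1 g) (Var 0), A]"]
      lift_judgement[OF p, of "[IdT (lift 1 A) (lift 1 g) (Var 0), A]"] cH by (simp_all add: eval_nat_numeral)
  have s4: "sub (up_sub 1 diag) (lift 4 e) = lift 2 e" for e :: "'s expr"
    by (simp add: sub_lift up_sub_def lsub_def eval_nat_numeral) (simp add: lift_eq_sub)
  have sD: "subT diag ?D = [IdT (lift 1 A) (lift 1 g) (Var 0)]"
    by (simp add: sub_lift lsub_def eval_nat_numeral) (simp add: lift_eq_sub)
  have sV: "sub (up_sub 1 diag) (Var 3) = Var 1" "sub (up_sub 1 diag) (Var 2) = Var 1"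
    "sub (up_sub 1 diag) (Var 1) = ReflT (Var 1)" "sub (up_sub 1 diag) (Var 0) = Var 0"
    by (simp_all add: up_sub_def lsub_def eval_nat_numeral)
  have "?G \<turnstile> TmEq ?t ?u (IdT (lift 4 A) (lift 4 f) (Var 2))"
  proof (rule Id_unique1)
    show "?G \<turnstile> Tm (lift 4 f) (lift 4 A)" "?G \<turnstile> Tm (Var 2) (lift 4 A)" by fact+
    show "?G \<turnstile> Tm ?t (IdT (lift 4 A) (lift 4 f) (Var 2))"
      by (rule vcomp_Tm[OF l(1) v(1,2) vcomp_Tm[OF l(1,2) v(1) l(3) v(4)] v(3)])
    show "?G \<turnstile> Tm ?u (IdT (lift 4 A) (lift 4 f) (Var 2))"
      by (rule vcomp_Tm[OF l(1,2) v(2) l(3) vcomp_Tm[OF l(2) v(1,2,4,3)]])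
    have "?H \<turnstile> TmEq (vcomp (Var 1) (Var 1) (ReflT (Var 1)) (vcomp (lift 2 g) (Var 1) (Var 0) (lift 2 p)))
        (vcomp (lift 2 g) (Var 1) (Var 0) (lift 2 p)) (IdT (lift 2 A) (lift 2 f) (Var 1))"
      by (rule vcomp_refl_left[OF m(1) w(1) vcomp_Tm[OF m(1,2) w(1) m(3) w(2)]])
    moreover have "?H \<turnstile> TmEq (vcomp (lift 2 g) (Var 1) (vcomp (Var 1) (Var 1) (ReflT (Var 1)) (Var 0)) (lift 2 p))
        (vcomp (lift 2 g) (Var 1) (Var 0) (lift 2 p)) (IdT (lift 2 A) (lift 2 f) (Var 1))"
      by (rule vcomp_cong[OF m(1) TmEq_refl[OF m(2)] TmEq_refl[OF w(1)] TmEq_refl[OF m(3)] vcomp_refl_left[OF m(2) w]])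
    ultimately have "?H \<turnstile> TmEq (vcomp (Var 1) (Var 1) (ReflT (Var 1)) (vcomp (lift 2 g) (Var 1) (Var 0) (lift 2 p)))
        (vcomp (lift 2 g) (Var 1) (vcomp (Var 1) (Var 1) (ReflT (Var 1)) (Var 0)) (lift 2 p)) (IdT (lift 2 A) (lift 2 f) (Var 1))"
      by (rule TmEq_trans2)
    then show "subT diag ?D @ A # \<Gamma> \<turnstile> TmEq (sub (up_sub (length ?D) diag) ?t) (sub (up_sub (length ?D) diag) ?u)
        (sub (up_sub (length ?D) diag) (IdT (lift 4 A) (lift 4 f) (Var 2)))"
      unfolding sD by (simp only: list.size One_nat_def[symmetric] add_0 sub_vcomp s4 sV sub.simps(8))
  qed
  moreover have "msub S \<Gamma> (lsub [q, r, k, h] Var) ?G"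
    using assms msub_Var[OF presup_ctx[OF f]] by (simp add: lsub_Cons msub_scons sub_lift eval_nat_numeral)
  ultimately show ?thesis
    using msub_TmEq by (fastforce simp: sub_vcomp lsub_Cons sub_lift eval_nat_numeral)
qed

text \<open>
  \<open>term_cat G T C ob arr\<close>: the category \<open>C\<close> consists of the terms of type \<open>T\<close> over \<open>G\<close> and of the terms of
  their identity types, modulo definitional equality; \<open>ob\<close> and \<open>arr\<close> send terms to their classes.
\<close>

definition term_cat ::
  "'s expr list \<Rightarrow> 's expr \<Rightarrow> ('o, 'a) cat \<Rightarrow> ('s expr \<Rightarrow> 'o) \<Rightarrow> ('s expr \<Rightarrow> 's expr \<Rightarrow> 's expr \<Rightarrow> 'a) \<Rightarrow> bool" where
  "term_cat G T C ob arr \<longleftrightarrow>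
    Ob C = {ob f |f. G \<turnstile> Tm f T} \<and>
    (\<forall>f g. (G \<turnstile> Tm f T) \<longrightarrow> (G \<turnstile> Tm g T) \<longrightarrow>
      (ob f = ob g \<longleftrightarrow> (G \<turnstile> TmEq f g T)) \<and>
      Hom C (ob f) (ob g) = {arr f g p |p. G \<turnstile> Tm p (IdT T f g)} \<and>
      Idt C (ob f) = arr f f (ReflT f)) \<and>
    (\<forall>f g h p q. (G \<turnstile> Tm f T) \<longrightarrow> (G \<turnstile> Tm g T) \<longrightarrow> (G \<turnstile> Tm h T) \<longrightarrow>
      (G \<turnstile> Tm p (IdT T f g)) \<longrightarrow> (G \<turnstile> Tm q (IdT T g h)) \<longrightarrow>
      Cmp C (ob f) (ob g) (ob h) (arr g h q) (arr f g p) = arr f h (vcomp g h q p)) \<and>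
    (\<forall>f f' g g' p p'. (G \<turnstile> TmEq f f' T) \<longrightarrow> (G \<turnstile> TmEq g g' T) \<longrightarrow> (G \<turnstile> Tm p (IdT T f g)) \<longrightarrow>
      (G \<turnstile> Tm p' (IdT T f g)) \<longrightarrow> (arr f g p = arr f' g' p' \<longleftrightarrow> (G \<turnstile> TmEq p p' (IdT T f g))))"

context
  fixes G T and C :: "('o, 'a) cat" and ob arr
  assumes C: "term_cat G T C ob arr"
begin

lemma
  shows term_cat_Ob: "Ob C = {ob f |f. G \<turnstile> Tm f T}"
    and term_cat_ob_eq: "G \<turnstile> Tm f T \<Longrightarrow> G \<turnstile> Tm g T \<Longrightarrow> ob f = ob g \<longleftrightarrow> (G \<turnstile> TmEq f g T)"
    and term_cat_Hom: "G \<turnstile> Tm f T \<Longrightarrow> G \<turnstile> Tm g T \<Longrightarrow>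
      Hom C (ob f) (ob g) = {arr f g p |p. G \<turnstile> Tm p (IdT T f g)}"
    and term_cat_Idt: "G \<turnstile> Tm f T \<Longrightarrow> Idt C (ob f) = arr f f (ReflT f)"
    and term_cat_Cmp: "G \<turnstile> Tm f T \<Longrightarrow> G \<turnstile> Tm g T \<Longrightarrow> G \<turnstile> Tm h T \<Longrightarrow>
      G \<turnstile> Tm p (IdT T f g) \<Longrightarrow> G \<turnstile> Tm q (IdT T g h) \<Longrightarrow>
      Cmp C (ob f) (ob g) (ob h) (arr g h q) (arr f g p) = arr f h (vcomp g h q p)"
    and term_cat_arr_eq: "G \<turnstile> TmEq f f' T \<Longrightarrow> G \<turnstile> TmEq g g' T \<Longrightarrow> G \<turnstile> Tm p (IdT T f g) \<Longrightarrow>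
      G \<turnstile> Tm p' (IdT T f g) \<Longrightarrow> arr f g p = arr f' g' p' \<longleftrightarrow> (G \<turnstile> TmEq p p' (IdT T f g))"
  using C unfolding term_cat_def by blast+

lemma term_cat_arr_cong:
  assumes "G \<turnstile> TmEq f f' T" and "G \<turnstile> TmEq g g' T" and "G \<turnstile> TmEq p p' (IdT T f g)"
  shows "arr f g p = arr f' g' p'"
  using term_cat_arr_eq[OF assms(1,2)] presup_TmEq[OF assms(3)] assms(3) by blast

lemma term_cat_category: "category C"
  unfolding category_def
proof (intro conjI ballI)
  fix a assume "a \<in> Ob C"
  then obtain f where f: "G \<turnstile> Tm f T" "a = ob f" using term_cat_Ob by auto
  then show "Idt C a \<in> Hom C a a" using term_cat_Hom term_cat_Idt Id_intro by auto
  fix b assume "b \<in> Ob C"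
  then obtain g where g: "G \<turnstile> Tm g T" "b = ob g" using term_cat_Ob by auto
  {
    fix m assume "m \<in> Hom C a b"
    then obtain p where p: "G \<turnstile> Tm p (IdT T f g)" "m = arr f g p"
      using term_cat_Hom[OF f(1) g(1)] f g by auto
    show "Cmp C a a b m (Idt C a) = m"
      using term_cat_Cmp[OF f(1) f(1) g(1) Id_intro[OF f(1)] p(1)] term_cat_Idt[OF f(1)]
        term_cat_arr_cong[OF TmEq_refl[OF f(1)] TmEq_refl[OF g(1)] vcomp_refl_right[OF f(1) g(1) p(1)]] f g p by simp
    show "Cmp C a b b (Idt C b) m = m"
      using term_cat_Cmp[OF f(1) g(1) g(1) p(1) Id_intro[OF g(1)]] term_cat_Idt[OF g(1)]
        term_cat_arr_cong[OF TmEq_refl[OF f(1)] TmEq_refl[OF g(1)] vcomp_refl_left[OF f(1) g(1) p(1)]] f g p by simp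
  }
  fix c assume "c \<in> Ob C"
  then obtain h where h: "G \<turnstile> Tm h T" "c = ob h" using term_cat_Ob by auto
  {
    fix m n assume "m \<in> Hom C a b" "n \<in> Hom C b c"
    then obtain p q where p: "G \<turnstile> Tm p (IdT T f g)" "m = arr f g p" and q: "G \<turnstile> Tm q (IdT T g h)" "n = arr g h q"
      using term_cat_Hom[OF f(1) g(1)] term_cat_Hom[OF g(1) h(1)] f g h by auto
    show "Cmp C a b c n m \<in> Hom C a c"
      using term_cat_Cmp[OF f(1) g(1) h(1) p(1) q(1)] vcomp_Tm[OF f(1) g(1) h(1) p(1) q(1)]
        term_cat_Hom[OF f(1) h(1)] f g h p q by auto
  }
  fix d assume "d \<in> Ob C"
  then obtain k where k: "G \<turnstile> Tm k T" "d = ob k" using term_cat_Ob by auto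
  fix m n l assume "m \<in> Hom C a b" "n \<in> Hom C b c" "l \<in> Hom C c d"
  then obtain p q r where p: "G \<turnstile> Tm p (IdT T f g)" "m = arr f g p" and q: "G \<turnstile> Tm q (IdT T g h)" "n = arr g h q"
    and r: "G \<turnstile> Tm r (IdT T h k)" "l = arr h k r"
    using term_cat_Hom[OF f(1) g(1)] term_cat_Hom[OF g(1) h(1)] term_cat_Hom[OF h(1) k(1)] f g h k by auto
  show "Cmp C a c d l (Cmp C a b c n m) = Cmp C a b d (Cmp C b c d l n) m"
    using term_cat_Cmp[OF f(1) g(1) h(1) p(1) q(1)] term_cat_Cmp[OF g(1) h(1) k(1) q(1) r(1)]
      term_cat_Cmp[OF f(1) h(1) k(1) vcomp_Tm[OF f(1) g(1) h(1) p(1) q(1)] r(1)]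
      term_cat_Cmp[OF f(1) g(1) k(1) p(1) vcomp_Tm[OF g(1) h(1) k(1) q(1) r(1)]]
      term_cat_arr_cong[OF TmEq_refl[OF f(1)] TmEq_refl[OF k(1)] vcomp_assoc[OF f(1) g(1) h(1) k(1) p(1) q(1) r(1)]]
      f g h k p q r by simp
qed

end

end

section \<open>Evaluation at the canonical element of the unit type\<close>

abbreviation at_star :: "'s expr \<Rightarrow> 's expr" where
  "at_star \<equiv> inst 0 [StarT]"

lemma at_star_simps [simp]: "at_star (lift 1 e) = e" "at_star (IdT A a b) = IdT (at_star A) (at_star a) (at_star b)"
  "at_star (ReflT a) = ReflT (at_star a)" "at_star (vcomp g h q p) = vcomp (at_star g) (at_star h) (at_star q) (at_star p)"
  by (simp_all add: inst_lift[simplified]) (simp_all add: inst_eq_sub sub_vcomp)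

lemma at_star_lift_Suc [simp]: "at_star (lift (Suc 0) e) = e"
  using at_star_simps(1) by simp

context ML2
begin

context
  fixes \<Gamma>
  assumes c: "ctx S \<Gamma>"
begin

lemma msub_star: "msub S \<Gamma> (lsub [StarT] Var) (UnitT # \<Gamma>)"
  using Unit_intro[OF c] msub_Var[OF c] by (simp add: lsub_Cons msub_scons)

lemma at_star_Tm: "UnitT # \<Gamma> \<turnstile> Tm a A \<Longrightarrow> \<Gamma> \<turnstile> Tm (at_star a) (at_star A)"
  using msub_Tm[OF _ msub_star] by (simp add: inst_eq_sub)

lemma at_star_TmEq: "UnitT # \<Gamma> \<turnstile> TmEq a b A \<Longrightarrow> \<Gamma> \<turnstile> TmEq (at_star a) (at_star b) (at_star A)"
  using msub_TmEq[OF _ msub_star] by (simp add: inst_eq_sub)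

lemma unit_lift_Tm: "\<Gamma> \<turnstile> Tm a A \<Longrightarrow> UnitT # \<Gamma> \<turnstile> Tm (lift 1 a) (lift 1 A)"
  using lift1_Tm Unit_form c by blast

lemma unit_lift_TmEq: "\<Gamma> \<turnstile> TmEq a b A \<Longrightarrow> UnitT # \<Gamma> \<turnstile> TmEq (lift 1 a) (lift 1 b) (lift 1 A)"
  using lift1_TmEq Unit_form c by blast

text \<open>The eliminator is applied to the variable of the unit type itself, so the result is a
  term over \<open>UnitT # \<Gamma>\<close>; the motive and \<open>d\<close> are weakened past that
  variable for this purpose.\<close>

lemma unit_elim:
  assumes C: "UnitT # \<Gamma> \<turnstile> Ty C" and d: "\<Gamma> \<turnstile> Tm d (at_star C)"
  shows "UnitT # \<Gamma> \<turnstile> Tm (UnitElimT (lift 1 d) (Var 0)) C"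
    and "\<Gamma> \<turnstile> TmEq (at_star (UnitElimT (lift 1 d) (Var 0))) d (at_star C)"
proof -
  have "UnitT # UnitT # \<Gamma> \<turnstile> Ty (wk 1 1 C)" using Pi_weaken(1)[OF C] by simp
  moreover have "at_star (wk 1 1 C) = lift 1 (at_star C)"
    unfolding wk_eq_sub_up_sub lift_eq_sub inst_eq_sub sub_sub by (rule sub_cong) (auto simp: up_sub_def lsub_def wk_eq_sub sub_sub)
  moreover have "UnitT # \<Gamma> \<turnstile> Tm (Var 0) UnitT" using Tm_Var0[OF Unit_form[OF c]] by simp
  ultimately show "UnitT # \<Gamma> \<turnstile> Tm (UnitElimT (lift 1 d) (Var 0)) C"
    using Unit_elim[of "UnitT # \<Gamma>" "wk 1 1 C" "lift 1 d" "Var 0"] unit_lift_Tm[OF d] Pi_weaken(2)[OF C] by simp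
  have "at_star (UnitElimT (lift 1 d) (Var 0)) = UnitElimT d StarT"
    by (simp add: inst_eq_sub lsub_Cons sub_lift)
  then show "\<Gamma> \<turnstile> TmEq (at_star (UnitElimT (lift 1 d) (Var 0))) d (at_star C)"
    using Unit_comp[OF C d] by simp
qed

text \<open>By discreteness it suffices to identify t with u, and unit elimination reduces this to
  the values at \<open>StarT\<close>, where reflexivity serves after conversion.\<close>

lemma unit_unique:
  assumes ab: "UnitT # \<Gamma> \<turnstile> Tm a A" "UnitT # \<Gamma> \<turnstile> Tm b A"
    and t: "UnitT # \<Gamma> \<turnstile> Tm t (IdT A a b)" and u: "UnitT # \<Gamma> \<turnstile> Tm u (IdT A a b)"
    and e: "\<Gamma> \<turnstile> TmEq (at_star t) (at_star u) (IdT (at_star A) (at_star a) (at_star b))"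
  shows "UnitT # \<Gamma> \<turnstile> TmEq t u (IdT A a b)"
proof -
  let ?I = "IdT (at_star A) (at_star a) (at_star b)"
  have s: "\<Gamma> \<turnstile> Tm (at_star t) ?I" using at_star_Tm[OF t] by simp
  have "\<Gamma> \<turnstile> TyEq (IdT ?I (at_star t) (at_star t)) (IdT ?I (at_star t) (at_star u))"
    by (rule Id_form_cong[OF TyEq_refl[OF presup_Tm[OF s]] TmEq_refl[OF s] e])
  from Tm_conv[OF Id_intro[OF s] this]
  have "\<Gamma> \<turnstile> Tm (ReflT (at_star t)) (at_star (IdT (IdT A a b) t u))" by simp
  from Id_disc[OF ab t u unit_elim(1)[OF Id_form[OF t u] this]] show ?thesis .
qed

end

text \<open>Raw terms carry no types, so this one term is an identification of f with its weakened
  value at \<open>StarT\<close> and also an identification in the opposite direction.\<close>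

definition to_star :: "'s expr \<Rightarrow> 's expr" where
  "to_star f = UnitElimT (lift 1 (ReflT (at_star f))) (Var 0)"

section \<open>Evaluation as a surjective equivalence between abstractly presented
  categories\<close>

context
  fixes \<Gamma> B and C :: "('o, 'a) cat" and D :: "('p, 'b) cat" and P :: "('o, 'a, 'p, 'b) functor_data"
    and ob arr ob' arr'
  assumes c: "ctx S \<Gamma>" and B: "\<Gamma> \<turnstile> Ty B"
    and C: "term_cat (UnitT # \<Gamma>) (lift 1 B) C ob arr" and D: "term_cat \<Gamma> B D ob' arr'"
    and P_ob: "\<And>f. UnitT # \<Gamma> \<turnstile> Tm f (lift 1 B) \<Longrightarrow> FOb P (ob f) = ob' (at_star f)"
    and P_arr: "\<And>f g p. UnitT # \<Gamma> \<turnstile> Tm f (lift 1 B) \<Longrightarrow> UnitT # \<Gamma> \<turnstile> Tm g (lift 1 B) \<Longrightarrow>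
      UnitT # \<Gamma> \<turnstile> Tm p (IdT (lift 1 B) f g) \<Longrightarrow> FHom P (ob f) (ob g) (arr f g p) = arr' (at_star f) (at_star g) (at_star p)"
begin

lemma at_star_Tm_B: "UnitT # \<Gamma> \<turnstile> Tm f (lift 1 B) \<Longrightarrow> \<Gamma> \<turnstile> Tm (at_star f) B"
  using at_star_Tm[OF c, of f "lift 1 B"] by (simp del: One_nat_def)

lemma at_star_Tm_Id: "UnitT # \<Gamma> \<turnstile> Tm p (IdT (lift 1 B) f g) \<Longrightarrow> \<Gamma> \<turnstile> Tm (at_star p) (IdT B (at_star f) (at_star g))"
  using at_star_Tm[OF c, of p "IdT (lift 1 B) f g"] by (simp del: One_nat_def)

lemma lift_Tm_Id: "\<Gamma> \<turnstile> Tm p (IdT B a b) \<Longrightarrow> UnitT # \<Gamma> \<turnstile> Tm (lift 1 p) (IdT (lift 1 B) (lift 1 a) (lift 1 b))"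
  using unit_lift_Tm[OF c, of p "IdT B a b"] by (simp del: One_nat_def)

lemma to_star:
  assumes f: "UnitT # \<Gamma> \<turnstile> Tm f (lift 1 B)"
  shows "UnitT # \<Gamma> \<turnstile> Tm (to_star f) (IdT (lift 1 B) f (lift 1 (at_star f)))"
    and "UnitT # \<Gamma> \<turnstile> Tm (to_star f) (IdT (lift 1 B) (lift 1 (at_star f)) f)"
    and "\<Gamma> \<turnstile> TmEq (at_star (to_star f)) (ReflT (at_star f)) (IdT B (at_star f) (at_star f))"
proof -
  have s: "\<Gamma> \<turnstile> Tm (at_star f) B" by (rule at_star_Tm_B[OF f])
  note l = unit_lift_Tm[OF c s]
  have r: "\<Gamma> \<turnstile> Tm (ReflT (at_star f)) (at_star (IdT (lift 1 B) f (lift 1 (at_star f))))"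
    "\<Gamma> \<turnstile> Tm (ReflT (at_star f)) (at_star (IdT (lift 1 B) (lift 1 (at_star f)) f))"
    using Id_intro[OF s] by simp_all
  show "UnitT # \<Gamma> \<turnstile> Tm (to_star f) (IdT (lift 1 B) f (lift 1 (at_star f)))"
    "UnitT # \<Gamma> \<turnstile> Tm (to_star f) (IdT (lift 1 B) (lift 1 (at_star f)) f)"
    unfolding to_star_def by (rule unit_elim(1)[OF c Id_form[OF f l] r(1)] unit_elim(1)[OF c Id_form[OF l f] r(2)])+
  show "\<Gamma> \<turnstile> TmEq (at_star (to_star f)) (ReflT (at_star f)) (IdT B (at_star f) (at_star f))"
    using unit_elim(2)[OF c Id_form[OF f l] r(1)] unfolding to_star_def by simp
qed

text \<open>Arrows over the unit type are determined by their evaluation. Naturality, invertibility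
  and the condition on \<theta> at weakened terms are all checked in this way.\<close>

lemma unit_arr_eq:
  assumes f: "UnitT # \<Gamma> \<turnstile> Tm f (lift 1 B)" and g: "UnitT # \<Gamma> \<turnstile> Tm g (lift 1 B)"
    and p: "UnitT # \<Gamma> \<turnstile> Tm p (IdT (lift 1 B) f g)" and q: "UnitT # \<Gamma> \<turnstile> Tm q (IdT (lift 1 B) f g)"
    and e: "\<Gamma> \<turnstile> TmEq (at_star p) (at_star q) (IdT B (at_star f) (at_star g))"
  shows "arr f g p = arr f g q"
  using term_cat_arr_cong[OF C TmEq_refl[OF f] TmEq_refl[OF g] unit_unique[OF c f g p q]] e by simp

lemma P_functor: "is_functor C D P"
  unfolding is_functor_def
proof (intro conjI ballI)
  fix a assume "a \<in> Ob C"
  then obtain f where f: "UnitT # \<Gamma> \<turnstile> Tm f (lift 1 B)" "a = ob f" using term_cat_Ob[OF C] by auto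
  note sf = at_star_Tm_B[OF f(1)]
  show "FOb P a \<in> Ob D" using P_ob[OF f(1)] term_cat_Ob[OF D] sf f by auto
  show "FHom P a a (Idt C a) = Idt D (FOb P a)"
    using P_arr[OF f(1) f(1) Id_intro[OF f(1)]] term_cat_Idt[OF C f(1)] term_cat_Idt[OF D sf] P_ob[OF f(1)] f by simp
  fix b assume "b \<in> Ob C"
  then obtain g where g: "UnitT # \<Gamma> \<turnstile> Tm g (lift 1 B)" "b = ob g" using term_cat_Ob[OF C] by auto
  note sg = at_star_Tm_B[OF g(1)]
  {
    fix m assume "m \<in> Hom C a b"
    then obtain p where p: "UnitT # \<Gamma> \<turnstile> Tm p (IdT (lift 1 B) f g)" "m = arr f g p"
      using term_cat_Hom[OF C f(1) g(1)] f g by auto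
    show "FHom P a b m \<in> Hom D (FOb P a) (FOb P b)"
      using P_arr[OF f(1) g(1) p(1)] term_cat_Hom[OF D sf sg] at_star_Tm_Id[OF p(1)] P_ob f g p by auto
  }
  fix d assume "d \<in> Ob C"
  then obtain h where h: "UnitT # \<Gamma> \<turnstile> Tm h (lift 1 B)" "d = ob h" using term_cat_Ob[OF C] by auto
  note sh = at_star_Tm_B[OF h(1)]
  fix m n assume "m \<in> Hom C a b" "n \<in> Hom C b d"
  then obtain p q where p: "UnitT # \<Gamma> \<turnstile> Tm p (IdT (lift 1 B) f g)" "m = arr f g p"
    and q: "UnitT # \<Gamma> \<turnstile> Tm q (IdT (lift 1 B) g h)" "n = arr g h q"
    using term_cat_Hom[OF C f(1) g(1)] term_cat_Hom[OF C g(1) h(1)] f g h by auto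
  show "FHom P a d (Cmp C a b d n m) = Cmp D (FOb P a) (FOb P b) (FOb P d) (FHom P b d n) (FHom P a b m)"
    using term_cat_Cmp[OF C f(1) g(1) h(1) p(1) q(1)] P_arr[OF f(1) g(1) p(1)] P_arr[OF g(1) h(1) q(1)]
      P_arr[OF f(1) h(1) vcomp_Tm[OF f(1) g(1) h(1) p(1) q(1)]]
      term_cat_Cmp[OF D sf sg sh at_star_Tm_Id[OF p(1)] at_star_Tm_Id[OF q(1)]] P_ob f g h p q by simp
qed

text \<open>\<open>I\<close> and \<theta> have to be functions of classes, so representatives are
  chosen; \<open>I_ob\<close>, \<open>I_arr\<close> and \<open>\<theta>_ob\<close> show that the
  choices do not matter.\<close>

private definition "bo d = (SOME b. (\<Gamma> \<turnstile> Tm b B) \<and> d = ob' b)"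
private definition "qo d d' m = (SOME q. (\<Gamma> \<turnstile> Tm q (IdT B (bo d) (bo d'))) \<and> m = arr' (bo d) (bo d') q)"
private definition "fo a = (SOME f. (UnitT # \<Gamma> \<turnstile> Tm f (lift 1 B)) \<and> a = ob f)"
private definition "I = \<lparr> FOb = (\<lambda>d. ob (lift 1 (bo d))),
  FHom = (\<lambda>d d' m. arr (lift 1 (bo d)) (lift 1 (bo d')) (lift 1 (qo d d' m))) \<rparr>"
private definition "\<theta> a = arr (fo a) (lift 1 (at_star (fo a))) (to_star (fo a))"

lemma bo:
  assumes "\<Gamma> \<turnstile> Tm b B"
  shows "\<Gamma> \<turnstile> Tm (bo (ob' b)) B" and "\<Gamma> \<turnstile> TmEq (bo (ob' b)) b B"
proof -
  have "(\<Gamma> \<turnstile> Tm (bo (ob' b)) B) \<and> ob' b = ob' (bo (ob' b))"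
    unfolding bo_def by (rule someI[of "\<lambda>b'. (\<Gamma> \<turnstile> Tm b' B) \<and> ob' b = ob' b'" b]) (use assms in simp)
  then show "\<Gamma> \<turnstile> Tm (bo (ob' b)) B" "\<Gamma> \<turnstile> TmEq (bo (ob' b)) b B"
    using term_cat_ob_eq[OF D] assms TmEq_sym by blast+
qed

lemma I_ob:
  assumes b: "\<Gamma> \<turnstile> Tm b B"
  shows "FOb I (ob' b) = ob (lift 1 b)"
  using term_cat_ob_eq[OF C unit_lift_Tm[OF c bo(1)[OF b]] unit_lift_Tm[OF c b]]
    unit_lift_TmEq[OF c bo(2)[OF b]] by (simp add: I_def)

text \<open>The chosen representative of the arrow lives between chosen end points. It is compared
  with p there, where both have the same type, and the equality is converted back and
  weakened.\<close>

lemma I_arr: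
  assumes a: "\<Gamma> \<turnstile> Tm a B" and b: "\<Gamma> \<turnstile> Tm b B" and p: "\<Gamma> \<turnstile> Tm p (IdT B a b)"
  shows "FHom I (ob' a) (ob' b) (arr' a b p) = arr (lift 1 a) (lift 1 b) (lift 1 p)"
proof -
  let ?a = "bo (ob' a)" and ?b = "bo (ob' b)" and ?m = "arr' a b p"
  let ?q = "qo (ob' a) (ob' b) ?m"
  have ab: "\<Gamma> \<turnstile> TmEq a ?a B" "\<Gamma> \<turnstile> TmEq b ?b B" using bo a b TmEq_sym by blast+
  have I: "\<Gamma> \<turnstile> TyEq (IdT B a b) (IdT B ?a ?b)" by (rule Id_form_cong[OF TyEq_refl[OF B] ab])
  have p': "\<Gamma> \<turnstile> Tm p (IdT B ?a ?b)" by (rule Tm_conv[OF p I])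
  have m: "?m = arr' ?a ?b p" by (rule term_cat_arr_cong[OF D ab TmEq_refl[OF p]])
  have "(\<Gamma> \<turnstile> Tm ?q (IdT B ?a ?b)) \<and> ?m = arr' ?a ?b ?q"
    unfolding qo_def by (rule someI[of "\<lambda>q. (\<Gamma> \<turnstile> Tm q (IdT B ?a ?b)) \<and> ?m = arr' ?a ?b q" p]) (use m p' in simp)
  then have q: "\<Gamma> \<turnstile> Tm ?q (IdT B ?a ?b)" and "arr' ?a ?b p = arr' ?a ?b ?q" using m by auto
  then have "\<Gamma> \<turnstile> TmEq p ?q (IdT B ?a ?b)"
    using term_cat_arr_eq[OF D TmEq_refl[OF bo(1)[OF a]] TmEq_refl[OF bo(1)[OF b]] p' q] by simp
  from TmEq_conv[OF this TyEq_sym[OF I]]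
  have "UnitT # \<Gamma> \<turnstile> TmEq (lift 1 p) (lift 1 ?q) (IdT (lift 1 B) (lift 1 a) (lift 1 b))"
    using unit_lift_TmEq[OF c, of p ?q "IdT B a b"] by simp
  from term_cat_arr_cong[OF C unit_lift_TmEq[OF c ab(1)] unit_lift_TmEq[OF c ab(2)] this]
  show ?thesis by (simp add: I_def)
qed

lemma I_functor: "is_functor D C I"
  unfolding is_functor_def
proof (intro conjI ballI)
  fix a assume "a \<in> Ob D"
  then obtain f where f: "\<Gamma> \<turnstile> Tm f B" "a = ob' f" using term_cat_Ob[OF D] by auto
  note sf = unit_lift_Tm[OF c f(1)]
  show "FOb I a \<in> Ob C" using I_ob[OF f(1)] term_cat_Ob[OF C] sf f by auto
  show "FHom I a a (Idt D a) = Idt C (FOb I a)"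
    using I_arr[OF f(1) f(1) Id_intro[OF f(1)]] term_cat_Idt[OF D f(1)] term_cat_Idt[OF C sf] I_ob[OF f(1)] f by simp
  fix b assume "b \<in> Ob D"
  then obtain g where g: "\<Gamma> \<turnstile> Tm g B" "b = ob' g" using term_cat_Ob[OF D] by auto
  note sg = unit_lift_Tm[OF c g(1)]
  {
    fix m assume "m \<in> Hom D a b"
    then obtain p where p: "\<Gamma> \<turnstile> Tm p (IdT B f g)" "m = arr' f g p"
      using term_cat_Hom[OF D f(1) g(1)] f g by auto
    show "FHom I a b m \<in> Hom C (FOb I a) (FOb I b)"
      using I_arr[OF f(1) g(1) p(1)] term_cat_Hom[OF C sf sg] lift_Tm_Id[OF p(1)] I_ob f g p by auto
  }
  fix d assume "d \<in> Ob D"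
  then obtain h where h: "\<Gamma> \<turnstile> Tm h B" "d = ob' h" using term_cat_Ob[OF D] by auto
  note sh = unit_lift_Tm[OF c h(1)]
  fix m n assume "m \<in> Hom D a b" "n \<in> Hom D b d"
  then obtain p q where p: "\<Gamma> \<turnstile> Tm p (IdT B f g)" "m = arr' f g p"
    and q: "\<Gamma> \<turnstile> Tm q (IdT B g h)" "n = arr' g h q"
    using term_cat_Hom[OF D f(1) g(1)] term_cat_Hom[OF D g(1) h(1)] f g h by auto
  have "lift 1 (vcomp g h q p) = vcomp (lift 1 g) (lift 1 h) (lift 1 q) (lift 1 p)"
    by (simp add: lift_eq_sub sub_vcomp)
  then show "FHom I a d (Cmp D a b d n m) = Cmp C (FOb I a) (FOb I b) (FOb I d) (FHom I b d n) (FHom I a b m)"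
    using term_cat_Cmp[OF D f(1) g(1) h(1) p(1) q(1)] I_arr[OF f(1) g(1) p(1)] I_arr[OF g(1) h(1) q(1)]
      I_arr[OF f(1) h(1) vcomp_Tm[OF f(1) g(1) h(1) p(1) q(1)]]
      term_cat_Cmp[OF C sf sg sh lift_Tm_Id[OF p(1)] lift_Tm_Id[OF q(1)]] I_ob f g h p q by simp
qed

text \<open>Changing the representative of f changes the end points, but both candidates evaluate to
  reflexivity, so uniqueness over the unit type identifies them.\<close>

lemma \<theta>_ob:
  assumes f: "UnitT # \<Gamma> \<turnstile> Tm f (lift 1 B)"
  shows "\<theta> (ob f) = arr f (lift 1 (at_star f)) (to_star f)"
proof -
  let ?f = "fo (ob f)"
  have "(UnitT # \<Gamma> \<turnstile> Tm ?f (lift 1 B)) \<and> ob f = ob ?f"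
    unfolding fo_def by (rule someI[of "\<lambda>g. (UnitT # \<Gamma> \<turnstile> Tm g (lift 1 B)) \<and> ob f = ob g" f]) (use f in simp)
  then have f': "UnitT # \<Gamma> \<turnstile> Tm ?f (lift 1 B)" and e: "UnitT # \<Gamma> \<turnstile> TmEq f ?f (lift 1 B)"
    using term_cat_ob_eq[OF C f] by auto
  have s: "\<Gamma> \<turnstile> TmEq (at_star f) (at_star ?f) B" using at_star_TmEq[OF c e] by simp
  have ls: "UnitT # \<Gamma> \<turnstile> TmEq (lift 1 (at_star f)) (lift 1 (at_star ?f)) (lift 1 B)"
    by (rule unit_lift_TmEq[OF c s])
  have l: "UnitT # \<Gamma> \<turnstile> Tm (lift 1 (at_star f)) (lift 1 B)" by (rule unit_lift_Tm[OF c at_star_Tm_B[OF f]])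
  have "UnitT # \<Gamma> \<turnstile> TyEq (IdT (lift 1 B) ?f (lift 1 (at_star ?f))) (IdT (lift 1 B) f (lift 1 (at_star f)))"
    using Id_form_cong[OF TyEq_refl[OF presup_Tm[OF f]] e ls] TyEq_sym by blast
  from Tm_conv[OF to_star(1)[OF f'] this]
  have t: "UnitT # \<Gamma> \<turnstile> Tm (to_star ?f) (IdT (lift 1 B) f (lift 1 (at_star f)))" .
  have "\<Gamma> \<turnstile> TyEq (IdT B (at_star ?f) (at_star ?f)) (IdT B (at_star f) (at_star f))"
    using Id_form_cong[OF TyEq_refl[OF B] s s] TyEq_sym by blast
  from TmEq_conv[OF to_star(3)[OF f'] this]
  have "\<Gamma> \<turnstile> TmEq (at_star (to_star ?f)) (ReflT (at_star ?f)) (IdT B (at_star f) (at_star f))" .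
  from TmEq_trans2[OF this TmEq_trans[OF to_star(3)[OF f] Id_intro_cong[OF s]]]
  have "\<Gamma> \<turnstile> TmEq (at_star (to_star ?f)) (at_star (to_star f)) (IdT B (at_star f) (at_star f))" .
  then have "arr f (lift 1 (at_star f)) (to_star ?f) = arr f (lift 1 (at_star f)) (to_star f)"
    by (intro unit_arr_eq[OF f l t to_star(1)[OF f]]) simp
  moreover have "arr f (lift 1 (at_star f)) (to_star ?f) = arr ?f (lift 1 (at_star ?f)) (to_star ?f)"
    by (rule term_cat_arr_cong[OF C e ls TmEq_refl[OF t]])
  ultimately show ?thesis by (simp add: \<theta>_def)
qed

lemma \<theta>_natural_iso: "natural_iso C C functor_id (functor_comp I P) \<theta>"
  unfolding natural_iso_def functor_id_def functor_comp_def functor_data.simps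
proof (intro conjI ballI)
  fix a assume "a \<in> Ob C"
  then obtain f where f: "UnitT # \<Gamma> \<turnstile> Tm f (lift 1 B)" "a = ob f" using term_cat_Ob[OF C] by auto
  note sf = at_star_Tm_B[OF f(1)] and lf = unit_lift_Tm[OF c at_star_Tm_B[OF f(1)]]
  have IP: "FOb I (FOb P a) = ob (lift 1 (at_star f))" using P_ob[OF f(1)] I_ob[OF sf] f by simp
  have \<theta>: "\<theta> a = arr f (lift 1 (at_star f)) (to_star f)" using \<theta>_ob f by simp
  show "\<theta> a \<in> Hom C a (FOb I (FOb P a))"
    unfolding \<theta> IP using f term_cat_Hom[OF C f(1) lf] to_star(1)[OF f(1)] by auto
  have st_lf: "at_star (lift 1 (at_star f)) = at_star f" by simp
  note st_th = to_star(3)[OF f(1)]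
  \<comment> \<open>Both inverse laws evaluate to this equation, that reflexivity composed with
    itself is reflexivity.\<close>
  have r: "\<Gamma> \<turnstile> TmEq (vcomp (at_star f) (at_star f) (at_star (to_star f)) (at_star (to_star f))) (ReflT (at_star f)) (IdT B (at_star f) (at_star f))"
    by (rule TmEq_trans[OF vcomp_cong[OF sf TmEq_refl[OF sf] TmEq_refl[OF sf] st_th st_th] vcomp_refl_left[OF sf sf Id_intro[OF sf]]])
  show "\<exists>\<phi>\<in>Hom C (FOb I (FOb P a)) a. Cmp C a (FOb I (FOb P a)) a \<phi> (\<theta> a) = Idt C a \<and>
      Cmp C (FOb I (FOb P a)) a (FOb I (FOb P a)) (\<theta> a) \<phi> = Idt C (FOb I (FOb P a))"
  proof (intro bexI conjI)
    \<comment> \<open>The inverse is the same raw term, read in the opposite direction.\<close>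
    show "arr (lift 1 (at_star f)) f (to_star f) \<in> Hom C (FOb I (FOb P a)) a"
      unfolding IP unfolding f(2) term_cat_Hom[OF C lf f(1)] using to_star(2)[OF f(1)] by blast
    show "Cmp C a (FOb I (FOb P a)) a (arr (lift 1 (at_star f)) f (to_star f)) (\<theta> a) = Idt C a"
      unfolding IP \<theta> unfolding f(2) term_cat_Cmp[OF C f(1) lf f(1) to_star(1)[OF f(1)] to_star(2)[OF f(1)]] term_cat_Idt[OF C f(1)]
      by (rule unit_arr_eq[OF f(1) f(1) vcomp_Tm[OF f(1) lf f(1) to_star(1)[OF f(1)] to_star(2)[OF f(1)]] Id_intro[OF f(1)]])
        (use r in simp)
    show "Cmp C (FOb I (FOb P a)) a (FOb I (FOb P a)) (\<theta> a) (arr (lift 1 (at_star f)) f (to_star f)) = Idt C (FOb I (FOb P a))"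
      unfolding IP \<theta> unfolding f(2) term_cat_Cmp[OF C lf f(1) lf to_star(2)[OF f(1)] to_star(1)[OF f(1)]] term_cat_Idt[OF C lf]
      by (rule unit_arr_eq[OF lf lf vcomp_Tm[OF lf f(1) lf to_star(2)[OF f(1)] to_star(1)[OF f(1)]] Id_intro[OF lf]])
        (use r in simp)
  qed
  fix b assume "b \<in> Ob C"
  then obtain g where g: "UnitT # \<Gamma> \<turnstile> Tm g (lift 1 B)" "b = ob g" using term_cat_Ob[OF C] by auto
  note sg = at_star_Tm_B[OF g(1)] and lg = unit_lift_Tm[OF c at_star_Tm_B[OF g(1)]]
  have IPg: "FOb I (FOb P b) = ob (lift 1 (at_star g))" using P_ob[OF g(1)] I_ob[OF sg] g by simp
  have \<theta>g: "\<theta> b = arr g (lift 1 (at_star g)) (to_star g)" using \<theta>_ob g by simp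
  fix m assume "m \<in> Hom C a b"
  then obtain p where p: "UnitT # \<Gamma> \<turnstile> Tm p (IdT (lift 1 B) f g)" "m = arr f g p"
    using term_cat_Hom[OF C f(1) g(1)] f g by auto
  note sp = at_star_Tm_Id[OF p(1)] and lp = lift_Tm_Id[OF at_star_Tm_Id[OF p(1)]]
  have IPm: "FHom I (FOb P a) (FOb P b) (FHom P a b m) = arr (lift 1 (at_star f)) (lift 1 (at_star g)) (lift 1 (at_star p))"
    using P_ob[OF f(1)] P_ob[OF g(1)] P_arr[OF f(1) g(1) p(1)] I_arr[OF sf sg sp] f g p by simp
  \<comment> \<open>Evaluated at \<open>StarT\<close>, each side of the naturality square composes p
    with a reflexivity, on the left or on the right.\<close>
  have "\<Gamma> \<turnstile> TmEq (vcomp (at_star g) (at_star g) (at_star (to_star g)) (at_star p)) (at_star p) (IdT B (at_star f) (at_star g))"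
    by (rule TmEq_trans[OF vcomp_cong[OF sf TmEq_refl[OF sg] TmEq_refl[OF sg] TmEq_refl[OF sp] to_star(3)[OF g(1)]] vcomp_refl_left[OF sf sg sp]])
  moreover have "\<Gamma> \<turnstile> TmEq (vcomp (at_star f) (at_star g) (at_star p) (at_star (to_star f))) (at_star p) (IdT B (at_star f) (at_star g))"
    by (rule TmEq_trans[OF vcomp_cong[OF sf TmEq_refl[OF sf] TmEq_refl[OF sg] st_th TmEq_refl[OF sp]] vcomp_refl_right[OF sf sg sp]])
  ultimately have e: "\<Gamma> \<turnstile> TmEq (vcomp (at_star g) (at_star g) (at_star (to_star g)) (at_star p)) (vcomp (at_star f) (at_star g) (at_star p) (at_star (to_star f))) (IdT B (at_star f) (at_star g))"
    by (rule TmEq_trans2)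
  show "Cmp C a b (FOb I (FOb P b)) (\<theta> b) m =
      Cmp C a (FOb I (FOb P a)) (FOb I (FOb P b)) (FHom I (FOb P a) (FOb P b) (FHom P a b m)) (\<theta> a)"
    unfolding IPm IP IPg \<theta> \<theta>g unfolding f(2) g(2) p(2) term_cat_Cmp[OF C f(1) g(1) lg p(1) to_star(1)[OF g(1)]]
      term_cat_Cmp[OF C f(1) lf lg to_star(1)[OF f(1)] lp]
    by (rule unit_arr_eq[OF f(1) lg vcomp_Tm[OF f(1) g(1) lg p(1) to_star(1)[OF g(1)]] vcomp_Tm[OF f(1) lf lg to_star(1)[OF f(1)] lp]])
      (use e in simp)
qed

lemma unit_surjective_equivalence: "surjective_equivalence C D P"
  unfolding surjective_equivalence_def
proof (intro conjI exI)
  show "category C" "category D" by (rule term_cat_category[OF C] term_cat_category[OF D])+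
  show "is_functor C D P" by (rule P_functor)
  show "is_functor D C I" by (rule I_functor)
  show "natural_iso C C functor_id (functor_comp I P) \<theta>" by (rule \<theta>_natural_iso)
  show "functor_eq D (functor_comp P I) functor_id"
    unfolding functor_eq_def functor_id_def functor_comp_def functor_data.simps
  proof (intro conjI ballI)
    fix a assume "a \<in> Ob D"
    then obtain f where f: "\<Gamma> \<turnstile> Tm f B" "a = ob' f" using term_cat_Ob[OF D] by auto
    note lf = unit_lift_Tm[OF c f(1)]
    show "FOb P (FOb I a) = a" using I_ob[OF f(1)] P_ob[OF lf] f by simp
    fix b m assume "b \<in> Ob D"
    then obtain g where g: "\<Gamma> \<turnstile> Tm g B" "b = ob' g" using term_cat_Ob[OF D] by auto
    note lg = unit_lift_Tm[OF c g(1)]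
    assume "m \<in> Hom D a b"
    then obtain p where p: "\<Gamma> \<turnstile> Tm p (IdT B f g)" "m = arr' f g p"
      using term_cat_Hom[OF D f(1) g(1)] f g by auto
    show "FHom P (FOb I a) (FOb I b) (FHom I a b m) = m"
      using I_ob[OF f(1)] I_ob[OF g(1)] I_arr[OF f(1) g(1) p(1)] P_arr[OF lf lg lift_Tm_Id[OF p(1)]] f g p by simp
  qed
  show "\<forall>d\<in>Ob D. \<theta> (FOb I d) = Idt C (FOb I d)"
  proof
    fix d assume "d \<in> Ob D"
    then obtain f where f: "\<Gamma> \<turnstile> Tm f B" "d = ob' f" using term_cat_Ob[OF D] by auto
    note lf = unit_lift_Tm[OF c f(1)]
    have "arr (lift 1 f) (lift 1 f) (to_star (lift 1 f)) = arr (lift 1 f) (lift 1 f) (ReflT (lift 1 f))"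
      by (rule unit_arr_eq[OF lf lf _ Id_intro[OF lf]]) (use to_star(1)[OF lf] to_star(3)[OF lf] in simp_all)
    then show "\<theta> (FOb I d) = Idt C (FOb I d)"
      using I_ob[OF f(1)] \<theta>_ob[OF lf] term_cat_Idt[OF C lf] f by simp
  qed
  show "\<forall>a\<in>Ob C. FHom P a (FOb I (FOb P a)) (\<theta> a) = Idt D (FOb P a)"
  proof
    fix a assume "a \<in> Ob C"
    then obtain f where f: "UnitT # \<Gamma> \<turnstile> Tm f (lift 1 B)" "a = ob f" using term_cat_Ob[OF C] by auto
    note sf = at_star_Tm_B[OF f(1)] and lf = unit_lift_Tm[OF c at_star_Tm_B[OF f(1)]]
    have "FHom P a (FOb I (FOb P a)) (\<theta> a) = arr' (at_star f) (at_star f) (at_star (to_star f))"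
      using P_ob[OF f(1)] I_ob[OF sf] \<theta>_ob[OF f(1)] P_arr[OF f(1) lf to_star(1)[OF f(1)]] f by simp
    also have "\<dots> = arr' (at_star f) (at_star f) (ReflT (at_star f))"
      by (rule term_cat_arr_cong[OF D TmEq_refl[OF sf] TmEq_refl[OF sf] to_star(3)[OF f(1)]])
    finally show "FHom P a (FOb I (FOb P a)) (\<theta> a) = Idt D (FOb P a)"
      using P_ob[OF f(1)] term_cat_Idt[OF D sf] f by simp
  qed
qed

end

end

section \<open>Reflexivity and vertical identifications\<close>

text \<open>Companion of \<open>ux\<close> and \<open>uy\<close> that selects the
  identifications.\<close>

fun uz :: "nat \<Rightarrow> nat \<Rightarrow> 's expr" where
  "uz 0 = Var"
| "uz (Suc k) = scons (Var 0) (\<lambda>i. lift 3 (uz k i))"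

lemma map_upt_Suc_shift: "map f [0..<Suc n] = f 0 # map (\<lambda>i. f (Suc i)) [0..<n]"
  by (simp add: upt_conv_Cons map_Suc_upt[symmetric] comp_def del: upt_Suc)

text \<open>Lets the generic vector over \<open>U\<close> be split into end points and
  identifications, so that facts about \<open>il\<close> apply to the variables themselves.\<close>

lemma U_Vars:
  "il (map (uz k) [0..<k]) (map (uy k) [0..<k]) (map (ux k) [0..<k]) = (map Var [0..<3 * k] :: 's expr list)"
proof (induction k)
  case (Suc k)
  have "il (map (uz (Suc k)) [0..<Suc k]) (map (uy (Suc k)) [0..<Suc k]) (map (ux (Suc k)) [0..<Suc k]) =
    (Var 0 # Var 1 # Var 2 # map (lift 3) (map Var [0..<3 * k]) :: 's expr list)"
    unfolding map_upt_Suc_shift Suc[symmetric] map_il by (simp add: comp_def)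
  moreover have "map f [0..<3 * Suc k] = f 0 # f 1 # f 2 # map (\<lambda>i. f (i + 3)) [0..<3 * k]" for f :: "nat \<Rightarrow> 's expr"
    using map_upt_Suc_shift[of f "Suc (Suc (3 * k))"] map_upt_Suc_shift[of "\<lambda>i. f (Suc i)" "Suc (3 * k)"]
      map_upt_Suc_shift[of "\<lambda>i. f (Suc (Suc i))" "3 * k"] by (simp add: eval_nat_numeral del: upt_Suc)
  ultimately show ?case by (simp add: comp_def)
qed simp

lemma dg_uz: "i < k \<Longrightarrow> sub (dg k) (uz k i) = ReflT (Var i)"
proof (induction k arbitrary: i)
  case (Suc k)
  then show ?case
    by (cases i) (auto simp: lsub_Cons numeral_2_eq_2 numeral_3_eq_3 sub_lift lift_sub[symmetric])
qed simp

lemma dg_U_Vars: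
  "map (dg k) [0..<3 * k] = il (map ReflT (map Var [0..<k])) (map Var [0..<k]) (map Var [0..<k])"
proof -
  have "map (dg k) [0..<3 * k] = map (sub (dg k)) (map Var [0..<3 * k])" by simp
  also have "\<dots> = il (map (sub (dg k)) (map (uz k) [0..<k])) (map (sub (dg k)) (map (uy k) [0..<k])) (map (sub (dg k)) (map (ux k) [0..<k]))"
    unfolding U_Vars[symmetric] map_il ..
  also have "map (sub (dg k)) (map (uz k) [0..<k]) = map ReflT (map Var [0..<k])" by (simp add: dg_uz)
  also have "map (sub (dg k)) (map (uy k) [0..<k]) = map Var [0..<k]" by (simp add: fun_cong[OF dg_uy])
  also have "map (sub (dg k)) (map (ux k) [0..<k]) = map Var [0..<k]" by (simp add: fun_cong[OF dg_ux])
  finally show ?thesis .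
qed

lemma dg_ge: "dg k (i + 3 * k) = Var (i + k)"
  by (induction k) (auto simp: lsub_def)

lemma il_uz:
  "length ps = length xs \<Longrightarrow> length ys = length xs \<Longrightarrow> i < length xs \<Longrightarrow>
    sub (lsub (il ps ys xs) \<sigma>) (uz (length xs) i) = ps ! i"
proof (induction xs arbitrary: ps ys i)
  case (Cons x xs)
  then obtain y ys' p ps' where [simp]: "ys = y # ys'" "ps = p # ps'" by (auto simp: length_Suc_conv)
  show ?case
    using Cons by (cases i) (simp_all add: lsub_Cons numeral_3_eq_3 sub_lift)
qed simp

lemma map_lsub_Vars: "length ts = n \<Longrightarrow> map (sub (lsub ts \<sigma>)) (map Var [0..<n]) = ts"
  by (auto simp: lsub_def intro: nth_equalityI)

lemma proj_eq: "proj \<Lambda> = map (\<lambda>i. Var (Suc i)) [0..<length \<Lambda>]"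
  by (simp add: proj_def map_Suc_upt[symmetric] comp_def del: upt_Suc)

context dependent_type_theory
begin

lemma msub_el: "ctx S \<Lambda> \<Longrightarrow> msub S \<Gamma> \<sigma> \<Lambda> \<Longrightarrow> el S \<Gamma> \<Lambda> (map \<sigma> [0..<length \<Lambda>])"
  using sub_ctx_irrelevant[of \<Lambda> "lsub (map \<sigma> [0..<length \<Lambda>]) Var" \<sigma> \<Gamma>] el_iff_msub[of \<Lambda> \<Gamma> "map \<sigma> [0..<length \<Lambda>]" Var]
  by (simp add: lsub_def msub_def)

lemma el_closed_msub: "ctx S \<Lambda> \<Longrightarrow> ctx S \<Gamma> \<Longrightarrow> el S \<Gamma> \<Lambda> ts \<Longrightarrow> msub S \<Gamma> (lsub ts \<sigma>) \<Lambda>"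
  using el_iff_msub el_length by blast

lemma el_closed_sub:
  "ctx S \<Lambda> \<Longrightarrow> msub S \<Gamma> \<sigma> \<Delta> \<Longrightarrow> el S \<Delta> \<Lambda> ts \<Longrightarrow> el S \<Gamma> \<Lambda> (map (sub \<sigma>) ts)"
  using el_sub[of \<Gamma> \<sigma> \<Delta> \<Lambda> ts] by (simp add: subT_closed)

lemma el_eq_comp:
  assumes "ctx S \<Delta>" and "ctx S \<Gamma>" and "ctx S \<Theta>" and "el_eq S \<Gamma> \<Delta> xs xs'" and "el_eq S \<Delta> \<Theta> ts ts'"
  shows "el_eq S \<Gamma> \<Theta> (map (inst 0 xs) ts) (map (inst 0 xs') ts')"
proof -
  have c: "ctx S (\<Theta> @ \<Gamma>)" "ctx S (\<Theta> @ \<Delta>)" using assms ctx_append_closed by auto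
  have "msub_eq S \<Gamma> (lsub xs Var) (lsub xs' Var) \<Delta>"
    using assms el_eq_length[OF assms(4)] by (simp add: el_eq_iff_msub_eq[symmetric])
  from el_sub_cong[OF this el_eq_right[OF assms(5) c(2)]]
  have "el_eq S \<Gamma> \<Theta> (map (inst 0 xs) ts') (map (inst 0 xs') ts')"
    using assms(3) by (simp add: subT_closed inst_eq_sub)
  moreover have "msub S \<Gamma> (lsub xs Var) \<Delta>"
    using el_closed_msub[OF assms(1,2) el_eq_left[OF assms(4)]] .
  from el_eq_sub[OF this assms(5)] have "el_eq S \<Gamma> \<Theta> (map (inst 0 xs) ts) (map (inst 0 xs) ts')"
    using assms(3) by (simp add: subT_closed inst_eq_sub)
  ultimately show ?thesis using el_eq_trans c by blast
qed

lemma inst_Vars: "scoped n e \<Longrightarrow> inst 0 (map Var [0..<n]) e = e"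
  using sub_cong_scoped[of n e "lsub (map Var [0..<n]) Var" Var] by (simp add: inst_eq_sub lsub_def)

lemma el_Vars_closed: "ctx S \<Lambda> \<Longrightarrow> el S \<Lambda> \<Lambda> (map Var [0..<length \<Lambda>])"
  using msub_el[OF _ msub_Var] by blast

end

context ML2
begin

lemma ctx_U_closed: "ctx S \<Lambda> \<Longrightarrow> ctx S (U \<Lambda>)"
  using ctx_U[of \<Lambda> "[]"] by simp

text \<open>On the variables of \<open>U\<close>, the substitution \<open>dg\<close> is the
  interleaved vector of reflexivities. Instantiating this typed vector at two equal lists gives the
  claim, and with it the typing of reflexivity for contexts.\<close>

lemma el_eq_refl_il:
  assumes L: "ctx S \<Lambda>" and c: "ctx S \<Gamma>" and e: "el_eq S \<Gamma> \<Lambda> xs ys"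
  shows "el_eq S \<Gamma> (U \<Lambda>) (il (map ReflT xs) xs xs) (il (map ReflT ys) ys ys)"
proof -
  let ?k = "length \<Lambda>" and ?V = "map Var [0..<length \<Lambda>] :: 's expr list"
  have "msub S \<Lambda> (dg ?k) (U \<Lambda>)" using msub_dg[of \<Lambda> "[]"] L by simp
  from msub_el[OF ctx_U_closed[OF L] this] have "el S \<Lambda> (U \<Lambda>) (il (map ReflT ?V) ?V ?V)"
    by (simp only: length_U dg_U_Vars)
  from el_eq_comp[OF L c ctx_U_closed[OF L] e el_eq_refl[OF this]]
  have "el_eq S \<Gamma> (U \<Lambda>) (map (inst 0 xs) (il (map ReflT ?V) ?V ?V)) (map (inst 0 ys) (il (map ReflT ?V) ?V ?V))" .
  moreover have "map (inst 0 ts) (il (map ReflT ?V) ?V ?V) = il (map ReflT ts) ts ts" if "length ts = ?k" for ts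
  proof -
    have "map (inst 0 ts) ?V = ts" using map_lsub_Vars[OF that] by (simp add: inst_eq_sub)
    moreover have "map (inst 0 ts) (map ReflT ?V) = map ReflT (map (inst 0 ts) ?V)" by (simp add: inst_eq_sub)
    ultimately show ?thesis by (simp only: map_il)
  qed
  ultimately show ?thesis using el_eq_length[OF e] by (simp del: map_map)
qed

lemma el_refl:
  assumes "ctx S \<Lambda>" and "ctx S \<Gamma>" and "el S \<Gamma> \<Lambda> xs"
  shows "el S \<Gamma> (Id_ctx \<Lambda> xs xs) (map ReflT xs)"
  using el_eq_left[OF el_eq_refl_il[OF assms(1,2) el_eq_refl[OF assms(3)]]] el_length[OF assms(3)]
  by (simp add: el_U(1)[OF assms(1)])

text \<open>Over a reflexive tail the transport in the entry is the identity, by its computation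
  rule evaluated at \<open>y' # xs\<close>.\<close>

lemma vertical_entry:
  assumes D: "ctx S (D # \<Lambda>)" and c: "ctx S \<Gamma>" and x: "el S \<Gamma> \<Lambda> xs"
    and y: "\<Gamma> \<turnstile> Tm y (inst 0 xs D)" and y': "\<Gamma> \<turnstile> Tm y' (inst 0 xs D)"
  shows "\<Gamma> \<turnstile> TyEq (IdT (inst 0 xs D) y y') (Id_entry D (map ReflT xs) xs xs y y')"
proof -
  let ?k = "length \<Lambda>" and ?V = "map Var [0..<length \<Lambda>] :: 's expr list" and ?t = "J_iter 1 (length \<Lambda>) (Var 0) :: 's expr"
  have L: "ctx S \<Lambda>" using D by simp
  have n: "length xs = ?k" by (rule el_length[OF x])
  have "msub S \<Gamma> (lsub (y' # xs) Var) (D # \<Lambda>)"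
    using el_closed_msub[OF L c x] y' by (simp add: lsub_Cons msub_scons inst_eq_sub)
  from msub_TmEq[OF transport_Tm(2)[OF D] this]
  have "\<Gamma> \<turnstile> TmEq (sub (lsub (y' # xs) Var) (sub (up_sub 1 (dg ?k)) ?t)) y' (inst 0 xs D)"
    by (simp add: lsub_Cons sub_lift inst_eq_sub)
  \<comment> \<open>Instantiating the diagonal at \<open>xs\<close> yields interleaved
    reflexivities; the two substitutions need to agree only on the finitely many variables of the
    transport term.\<close>
  moreover have "sub (lsub (y' # xs) Var) (sub (up_sub 1 (dg ?k)) ?t) = inst 0 (y' # il (map ReflT xs) xs xs) ?t"
    unfolding inst_eq_sub sub_sub
  proof (rule sub_cong_scoped[OF transport_scoped[OF D]])
    fix i assume i: "i < Suc (3 * ?k)"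
    have "map (sub (lsub xs Var)) (map (dg ?k) [0..<3 * ?k]) = il (map ReflT xs) xs xs"
    proof -
      have "map (sub (lsub xs Var)) (map ReflT ?V) = map ReflT (map (sub (lsub xs Var)) ?V)" by simp
      then show ?thesis unfolding dg_U_Vars map_il by (simp only: map_lsub_Vars[OF n])
    qed
    moreover have "map (sub (lsub xs Var)) (map (dg ?k) [0..<3 * ?k]) ! j = sub (lsub xs Var) (dg ?k j)" if "j < 3 * ?k" for j
      using that by simp
    ultimately have "sub (lsub xs Var) (dg ?k j) = il (map ReflT xs) xs xs ! j" if "j < 3 * ?k" for j
      using that by metis
    then show "sub (lsub (y' # xs) Var) (up_sub 1 (dg ?k) i) = lsub (y' # il (map ReflT xs) xs xs) Var i"
      using i n by (cases i) (simp_all add: up_sub_def lsub_Cons sub_lift, simp add: lsub_def)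
  qed
  ultimately have "\<Gamma> \<turnstile> TmEq y' (inst 0 (y' # il (map ReflT xs) xs xs) ?t) (inst 0 xs D)"
    using TmEq_sym by simp
  from Id_form_cong[OF TyEq_refl[OF presup_Tm[OF y]] TmEq_refl[OF y] this] show ?thesis
    by (simp add: Id_entry_def n)
qed

lemma el_vertical:
  assumes "ctx S (D # \<Lambda>)" and "ctx S \<Gamma>" and "el S \<Gamma> \<Lambda> xs"
    and "\<Gamma> \<turnstile> Tm y (inst 0 xs D)" and "\<Gamma> \<turnstile> Tm y' (inst 0 xs D)"
  shows "el S \<Gamma> (Id_ctx (D # \<Lambda>) (y # xs) (y' # xs)) (q # map ReflT xs) \<longleftrightarrow> (\<Gamma> \<turnstile> Tm q (IdT (inst 0 xs D) y y'))"
    and "el_eq S \<Gamma> (Id_ctx (D # \<Lambda>) (y # xs) (y' # xs)) (q # map ReflT xs) (q' # map ReflT xs) \<longleftrightarrow>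
      (\<Gamma> \<turnstile> TmEq q q' (IdT (inst 0 xs D) y y'))"
proof -
  have n: "length xs = length \<Lambda>" by (rule el_length[OF assms(3)])
  have r: "el S \<Gamma> (Id_ctx \<Lambda> xs xs) (map ReflT xs)" using el_refl assms by simp
  note V = vertical_entry[OF assms]
  show "el S \<Gamma> (Id_ctx (D # \<Lambda>) (y # xs) (y' # xs)) (q # map ReflT xs) \<longleftrightarrow> (\<Gamma> \<turnstile> Tm q (IdT (inst 0 xs D) y y'))"
    unfolding el_Id_ctx_Cons(1)[OF assms(1) n n] using r Tm_conv[OF _ V] Tm_conv[OF _ TyEq_sym[OF V]] by blast
  show "el_eq S \<Gamma> (Id_ctx (D # \<Lambda>) (y # xs) (y' # xs)) (q # map ReflT xs) (q' # map ReflT xs) \<longleftrightarrow>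
      (\<Gamma> \<turnstile> TmEq q q' (IdT (inst 0 xs D) y y'))"
    unfolding el_Id_ctx_Cons(2)[OF assms(1) n n] using el_eq_refl[OF r] TmEq_conv[OF _ V] TmEq_conv[OF _ TyEq_sym[OF V]] by blast
qed

text \<open>Uniqueness forces the formula: over the generic context the tail identifications and the
  eliminated family have the same type, and both become reflexivity on the diagonal. The vector
  \<rho> is taken up to equality with the projection because a chosen representative will stand in
  its place.\<close>

lemma ap_ctx_proj:
  assumes D: "ctx S (D # \<Lambda>)" and c: "ctx S \<Gamma>" and \<rho>: "el_eq S (D # \<Lambda>) \<Lambda> (proj \<Lambda>) \<rho>"
    and el: "el S \<Gamma> (U (D # \<Lambda>)) (il (q # ps) (y' # ys) (x # xs))"
    and n: "length xs = length \<Lambda>" "length ys = length \<Lambda>" "length ps = length \<Lambda>"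
  shows "el_eq S \<Gamma> (Id_ctx \<Lambda> xs ys) ps (ap_ctx \<rho> (x # xs) (y' # ys) (q # ps))"
proof -
  let ?k = "length \<Lambda>" and ?\<Phi> = "D # \<Lambda>"
  let ?X = "map (\<lambda>i. lift 3 (ux ?k i)) [0..<?k]" and ?Y = "map (\<lambda>i. lift 3 (uy ?k i)) [0..<?k]"
    and ?Z = "map (\<lambda>i. lift 3 (uz ?k i)) [0..<?k]"
  let ?\<Theta> = "Id_ctx \<Lambda> ?X ?Y" and ?J = "map (J_iter 0 (Suc ?k)) (map ReflT \<rho>)"
  have L: "ctx S \<Lambda>" using D by simp
  have cU: "ctx S (U ?\<Phi>)" by (rule ctx_U_closed[OF D])
  have D': "ctx S (?\<Phi> @ [])" using D by simp
  have "msub S (U ?\<Phi>) (\<lambda>i. ux (Suc ?k) (Suc i)) \<Lambda>" "msub S (U ?\<Phi>) (\<lambda>i. uy (Suc ?k) (Suc i)) \<Lambda>"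
    using msub_ux[OF D'] msub_uy[OF D'] by (simp_all only: append_Nil2 length_Cons msub_Cons)
  then have X: "el S (U ?\<Phi>) \<Lambda> ?X" and Y: "el S (U ?\<Phi>) \<Lambda> ?Y" using msub_el[OF L] by auto
  \<comment> \<open>The generic identification of the tail, with its end points, consists of the
    variables of \<open>U \<Lambda>\<close> moved past the three variables of the head.\<close>
  have XYZ: "il ?Z ?Y ?X = map (\<lambda>i. Var (i + 3)) [0..<3 * ?k]"
    using arg_cong[OF U_Vars[of ?k], of "map (lift 3)"] by (simp add: map_il comp_def)
  have "msub S (U ?\<Phi>) (\<lambda>i. Var (i + 3)) (U \<Lambda>)"
    using msub_shift[of "take 3 (U ?\<Phi>)" "U \<Lambda>"] cU by (simp add: numeral_3_eq_3)
  then have "el S (U ?\<Phi>) (U \<Lambda>) (il ?Z ?Y ?X)"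
    unfolding XYZ using msub_el[OF ctx_U_closed[OF L]] by fastforce
  then have Z: "el S (U ?\<Phi>) ?\<Theta> ?Z" using el_U(1)[OF L] by simp
  note \<Theta> = Id_ctx_ctx[OF L cU X Y]
  have dgX: "map (sub (dg (Suc ?k))) ?X = proj \<Lambda>" "map (sub (dg (Suc ?k))) ?Y = proj \<Lambda>"
    by (simp_all add: fun_cong[OF dg_ux] fun_cong[OF dg_uy] proj_eq lsub_Cons sub_lift numeral_3_eq_3 lift_sub[symmetric])
  have dgZ: "map (sub (dg (Suc ?k))) ?Z = map ReflT (proj \<Lambda>)"
    by (simp add: proj_eq lsub_Cons sub_lift numeral_3_eq_3 lift_sub[symmetric] dg_uz)
  have s\<Theta>: "subT (dg (Suc ?k)) ?\<Theta> = Id_ctx \<Lambda> (proj \<Lambda>) (proj \<Lambda>)"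
    using subT_Id_ctx[OF L, of ?X ?Y "dg (Suc ?k)"] dgX by simp
  have np: "length (proj \<Lambda>) = ?k" "length \<rho> = ?k" using el_eq_length[OF \<rho>] by auto
  have r: "el_eq S ?\<Phi> (Id_ctx \<Lambda> (proj \<Lambda>) (proj \<Lambda>)) (map ReflT (proj \<Lambda>)) (map ReflT \<rho>)"
    using el_eq_refl_il[OF L D \<rho>] np by (simp add: el_U(2)[OF L])
  have cp: "ctx S (Id_ctx \<Lambda> (proj \<Lambda>) (proj \<Lambda>) @ ?\<Phi>)"
    using Id_ctx_ctx[OF L D el_eq_left[OF \<rho>] el_eq_left[OF \<rho>]] by blast
  \<comment> \<open>The motive is formed with the projection itself, so reflexivity at \<rho> enters
    through its equality with reflexivity at the projection.\<close>
  have "el S (subT (dg (length ?\<Phi>)) [] @ ?\<Phi> @ []) (subT (up_sub 0 (dg (length ?\<Phi>))) ?\<Theta>) (map ReflT \<rho>)"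
    using el_eq_right[OF r cp] s\<Theta> by simp
  moreover have "ctx S (?\<Theta> @ [] @ U ?\<Phi> @ [])" using \<Theta> by simp
  ultimately have J: "el S (U ?\<Phi>) ?\<Theta> ?J"
    "el_eq S ?\<Phi> (Id_ctx \<Lambda> (proj \<Lambda>) (proj \<Lambda>)) (map (sub (dg (Suc ?k))) ?J) (map ReflT \<rho>)"
    using J_iter_tele[OF D', of 0 "[]" ?\<Theta> "map ReflT \<rho>"] s\<Theta> by (simp_all del: dg.simps J_iter.simps U.simps)
  have "el_eq S (subT (dg (length ?\<Phi>)) [] @ ?\<Phi> @ []) (subT (up_sub 0 (dg (length ?\<Phi>))) ?\<Theta>)
    (map (sub (up_sub 0 (dg (length ?\<Phi>)))) ?Z) (map (sub (up_sub 0 (dg (length ?\<Phi>)))) ?J)"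
    using el_eq_trans[OF r el_eq_sym[OF J(2) cp] cp] s\<Theta> dgZ by (simp del: dg.simps J_iter.simps)
  from Id_unique_tele[OF D' _ _ _ _ _ this] have "el_eq S (U ?\<Phi>) ?\<Theta> ?Z ?J"
    using \<Theta> Z J(1) by (simp del: U.simps)
  from el_eq_sub[OF el_closed_msub[OF cU c el] this]
  have e: "el_eq S \<Gamma> (subT (lsub (il (q # ps) (y' # ys) (x # xs)) Var) ?\<Theta>)
    (map (sub (lsub (il (q # ps) (y' # ys) (x # xs)) Var)) ?Z) (map (sub (lsub (il (q # ps) (y' # ys) (x # xs)) Var)) ?J)" .
  have l: "(\<lambda>i. lsub (il (q # ps) (y' # ys) (x # xs)) Var (i + 3)) = lsub (il ps ys xs) Var"
    by (simp add: lsub_Cons numeral_3_eq_3)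
  have sl: "sub (lsub (il (q # ps) (y' # ys) (x # xs)) Var) (lift 3 e) = sub (lsub (il ps ys xs) Var) e" for e
    unfolding sub_lift l ..
  have i: "map (lsub ts Var) [0..<?k] = ts" if "length ts = ?k" for ts :: "'s expr list"
    using map_lsub_Vars[OF that, of Var] by (simp add: comp_def)
  have ux: "sub (lsub (il ps ys xs) Var) (ux ?k i) = lsub xs Var i" "sub (lsub (il ps ys xs) Var) (uy ?k i) = lsub ys Var i" for i
    by (rule fun_cong[OF il_ux] fun_cong[OF il_uy]; simp add: n)+
  have iX: "map (sub (lsub (il (q # ps) (y' # ys) (x # xs)) Var)) ?X = xs"
    using i[OF n(1)] by (simp only: map_map comp_def sl ux)
  have iY: "map (sub (lsub (il (q # ps) (y' # ys) (x # xs)) Var)) ?Y = ys"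
    using i[OF n(2)] by (simp only: map_map comp_def sl ux)
  have iZ: "map (sub (lsub (il (q # ps) (y' # ys) (x # xs)) Var)) ?Z = ps"
    unfolding map_map comp_def sl using il_uz[of ps xs ys _ Var] n by (auto intro!: nth_equalityI)
  have "ap_ctx \<rho> (x # xs) (y' # ys) (q # ps) = map (inst 0 (il (q # ps) (y' # ys) (x # xs))) ?J"
    unfolding ap_ctx_def by (subst J_ctx_eq) (simp_all add: n del: il.simps)
  with e iX iY iZ subT_Id_ctx[OF L, of ?X ?Y] show ?thesis by (simp add: inst_eq_sub del: il.simps)
qed

end

section \<open>Composition of vertical identifications\<close>

lemma lsub_dg: "length ys = k \<Longrightarrow> (\<lambda>i. sub (lsub ys \<sigma>) (dg k i)) = lsub (il (map ReflT ys) ys ys) \<sigma>"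
proof (induction ys arbitrary: k)
  case (Cons y ys)
  have "sub (lsub (y # ys) \<sigma>) (dg (Suc (length ys)) i) = lsub (il (map ReflT (y # ys)) (y # ys) (y # ys)) \<sigma> i" for i
  proof (cases "i < 3")
    case True
    then have "i = 0 \<or> i = 1 \<or> i = 2" by auto
    then show ?thesis by (auto simp: lsub_Cons numeral_2_eq_2)
  next
    case False
    then have "i = Suc (Suc (Suc (i - 3)))" by simp
    then obtain j where "i = Suc (Suc (Suc j))" by blast
    then show ?thesis using fun_cong[OF Cons.IH[OF refl], of j] by (simp add: lsub_Cons sub_lift)
  qed
  with Cons.prems show ?case by auto
qed simp

lemma map_lsub_ux:
  assumes "length ps = k" and "length ys = k" and "length xs = k"
  shows "map (sub (lsub (il ps ys xs) \<sigma>)) (map (ux k) [0..<k]) = xs"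
    and "map (sub (lsub (il ps ys xs) \<sigma>)) (map (uy k) [0..<k]) = ys"
proof -
  have u: "sub (lsub (il ps ys xs) \<sigma>) (ux k i) = lsub xs \<sigma> i" "sub (lsub (il ps ys xs) \<sigma>) (uy k i) = lsub ys \<sigma> i" for i
    by (rule fun_cong[OF il_ux] fun_cong[OF il_uy]; simp add: assms)+
  have "map (lsub ts \<sigma>) [0..<k] = ts" if "length ts = k" for ts
    using map_lsub_Vars[OF that, of \<sigma>] by (simp add: comp_def)
  then show "map (sub (lsub (il ps ys xs) \<sigma>)) (map (ux k) [0..<k]) = xs"
    "map (sub (lsub (il ps ys xs) \<sigma>)) (map (uy k) [0..<k]) = ys"
    using assms by (simp_all only: map_map comp_def u)
qed

context ML2
begin

lemma msub_el_append:
  assumes "ctx S \<Lambda>" and "msub S \<Gamma>' \<sigma> (\<Lambda> @ \<Gamma>)"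
  shows "el S \<Gamma>' \<Lambda> (map \<sigma> [0..<length \<Lambda>])"
proof -
  have "\<sigma> = lsub (map \<sigma> [0..<length \<Lambda>]) (\<lambda>i. \<sigma> (i + length \<Lambda>))" by (rule ext) (simp add: lsub_def)
  then have "msub S \<Gamma>' (lsub (map \<sigma> [0..<length \<Lambda>]) (\<lambda>i. \<sigma> (i + length \<Lambda>))) (\<Lambda> @ \<Gamma>)" using assms(2) by metis
  then show ?thesis using assms(1) by (simp add: msub_lsub subT_closed)
qed

context
  fixes \<Gamma> \<Lambda> D v f
  assumes D: "ctx S (D # \<Lambda>)" and c: "ctx S \<Gamma>" and v: "el S \<Gamma> \<Lambda> v" and f: "\<Gamma> \<turnstile> Tm f (inst 0 v D)"
begin

private abbreviation "\<Phi> \<equiv> D # \<Lambda>"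
private abbreviation "n \<equiv> Suc (length \<Lambda>)"
private abbreviation "B \<equiv> inst 0 v D"
private abbreviation "W \<equiv> U \<Phi> @ \<Gamma>"
private abbreviation "FW \<equiv> map (lift (3 * n)) (f # v)"
text \<open>Data of the generic composition: \<open>\<Delta>\<close> holds p from the fixed vector
  \<open>f # v\<close> to x, \<open>\<Theta>\<close> is the type of the composite from
  \<open>f # v\<close> to y, and \<open>Js\<close> is the composite. The names ending in 0 are the
  same telescopes on the diagonal.\<close>

private abbreviation "\<Delta> \<equiv> Id_ctx \<Phi> FW (map (ux n) [0..<n])"
private abbreviation "\<Theta> \<equiv> Id_ctx \<Phi> (map (lift n) FW) (map (lift n) (map (uy n) [0..<n]))"
private abbreviation "\<Delta>0 \<equiv> Id_ctx \<Phi> (map (lift n) (f # v)) (map Var [0..<n])"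
private abbreviation "\<Theta>0 \<equiv> Id_ctx \<Phi> (map (lift n) (map (lift n) (f # v))) (map (lift n) (map Var [0..<n]))"
private abbreviation "Js \<equiv> map (J_iter n n) (map Var [0..<n])"

lemma len_v: "length v = length \<Lambda>"
  by (rule el_length[OF v])

lemma scoped_D: "scoped (length v) D"
  using ctx_scoped[of "[]"] D by (simp add: len_v)

lemma sub_lsub_il:
  assumes "length as = n" and "length ps = n" and "length ys = n" and "length xs = n"
  shows "sub (lsub (il ps ys xs) \<sigma>) (lift (3 * n) e) = sub \<sigma> e"
    and "map (sub (lsub (il ps ys xs) \<sigma>)) FW = map (sub \<sigma>) (f # v)"
    and "subT (lsub (il ps ys xs) \<sigma>) \<Delta> = Id_ctx \<Phi> (map (sub \<sigma>) (f # v)) xs"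
    and "subT (lsub (as @ il ps ys xs) \<sigma>) \<Theta> = Id_ctx \<Phi> (map (sub \<sigma>) (f # v)) ys"
proof -
  have l: "length (il ps ys xs) = 3 * n" using assms by simp
  show 1: "sub (lsub (il ps ys xs) \<sigma>) (lift (3 * n) e) = sub \<sigma> e" for e
    using sub_lsub_lift[of "il ps ys xs" \<sigma> e] by (simp only: l)
  then show 2: "map (sub (lsub (il ps ys xs) \<sigma>)) FW = map (sub \<sigma>) (f # v)" by (simp only: map_map comp_def)
  have 3: "map (sub (lsub (as @ il ps ys xs) \<sigma>)) (map (lift n) zs) = map (sub (lsub (il ps ys xs) \<sigma>)) zs" for zs
    unfolding lsub_append map_map comp_def using sub_lsub_lift[of as "lsub (il ps ys xs) \<sigma>"] assms(1) by simp
  show "subT (lsub (il ps ys xs) \<sigma>) \<Delta> = Id_ctx \<Phi> (map (sub \<sigma>) (f # v)) xs"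
    by (subst subT_Id_ctx[OF D]) (simp_all only: 2 map_lsub_ux[OF assms(2-)], simp_all add: len_v)
  show "subT (lsub (as @ il ps ys xs) \<sigma>) \<Theta> = Id_ctx \<Phi> (map (sub \<sigma>) (f # v)) ys"
    by (subst subT_Id_ctx[OF D]) (simp_all only: 3 2 map_lsub_ux[OF assms(2-)], simp_all add: len_v)
qed

text \<open>The facts on vertical identifications, stated in a context \<Psi> into which \<Gamma> is
  weakened by \<open>m\<close> variables; the generic comparison uses four variables, its diagonal
  two.\<close>

lemma vertical_at:
  assumes s: "msub S \<Psi> (\<lambda>i. Var (i + m)) \<Gamma>"
  shows "el S \<Psi> \<Lambda> (map (lift m) v)" and "inst 0 (map (lift m) v) D = lift m B"
    and "\<Psi> \<turnstile> Tm y (lift m B) \<Longrightarrow> el S \<Psi> \<Phi> (y # map (lift m) v)"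
    and "\<Psi> \<turnstile> Tm y (lift m B) \<Longrightarrow> \<Psi> \<turnstile> Tm y' (lift m B) \<Longrightarrow>
      el S \<Psi> (Id_ctx \<Phi> (y # map (lift m) v) (y' # map (lift m) v)) (q # map ReflT (map (lift m) v)) \<longleftrightarrow>
        (\<Psi> \<turnstile> Tm q (IdT (lift m B) y y'))"
    and "\<Psi> \<turnstile> Tm y (lift m B) \<Longrightarrow> \<Psi> \<turnstile> Tm y' (lift m B) \<Longrightarrow>
      el_eq S \<Psi> (Id_ctx \<Phi> (y # map (lift m) v) (y' # map (lift m) v)) (q # map ReflT (map (lift m) v)) (q' # map ReflT (map (lift m) v)) \<longleftrightarrow>
        (\<Psi> \<turnstile> TmEq q q' (IdT (lift m B) y y'))"
proof -
  have c\<Psi>: "ctx S \<Psi>" using s by (simp add: msub_def)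
  have L: "ctx S \<Lambda>" using D by simp
  show e: "el S \<Psi> \<Lambda> (map (lift m) v)" using el_closed_sub[OF L s v] by (simp only: lift_eq_sub)
  show i: "inst 0 (map (lift m) v) D = lift m B" unfolding lift_eq_sub inst_closed[OF scoped_D] ..
  show "\<Psi> \<turnstile> Tm y (lift m B) \<Longrightarrow> el S \<Psi> \<Phi> (y # map (lift m) v)" using e i by simp
  show "\<Psi> \<turnstile> Tm y (lift m B) \<Longrightarrow> \<Psi> \<turnstile> Tm y' (lift m B) \<Longrightarrow>
      el S \<Psi> (Id_ctx \<Phi> (y # map (lift m) v) (y' # map (lift m) v)) (q # map ReflT (map (lift m) v)) \<longleftrightarrow>
        (\<Psi> \<turnstile> Tm q (IdT (lift m B) y y'))"
    and "\<Psi> \<turnstile> Tm y (lift m B) \<Longrightarrow> \<Psi> \<turnstile> Tm y' (lift m B) \<Longrightarrow>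
      el_eq S \<Psi> (Id_ctx \<Phi> (y # map (lift m) v) (y' # map (lift m) v)) (q # map ReflT (map (lift m) v)) (q' # map ReflT (map (lift m) v)) \<longleftrightarrow>
        (\<Psi> \<turnstile> TmEq q q' (IdT (lift m B) y y'))"
    using el_vertical[OF D c\<Psi> e, of y y'] unfolding i by blast+
qed

text \<open>Composition is elimination on q with p both as post-context and as the value on the
  diagonal; typing and computation are those of \<open>J_iter_tele\<close>.\<close>

lemma Js:
  "el S (\<Delta> @ W) \<Theta> Js"
  "el_eq S (\<Delta>0 @ \<Phi> @ \<Gamma>) \<Theta>0 (map (sub (up_sub n (dg n))) Js) (map Var [0..<n])"
proof -
  have DG: "ctx S (\<Phi> @ \<Gamma>)" by (rule ctx_append_closed[OF D c])
  have cW: "ctx S W" by (rule ctx_U[OF DG])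
  have l\<Phi>: "length \<Phi> = n" by simp
  have F: "el S \<Gamma> \<Phi> (f # v)" using v f by simp
  have lU: "length (U \<Phi>) = 3 * n" by simp
  have "msub S W (\<lambda>i. Var (i + 3 * n)) \<Gamma>" using msub_shift[OF cW] by (simp only: lU)
  from el_closed_sub[OF D this F] have FW: "el S W \<Phi> FW" by (simp only: lift_eq_sub)
  have X: "el S W \<Phi> (map (ux n) [0..<n])" and Y: "el S W \<Phi> (map (uy n) [0..<n])"
    using msub_el_append[OF D msub_ux[OF DG]] msub_el_append[OF D msub_uy[OF DG]] by (simp_all only: l\<Phi>)
  have cD: "ctx S (\<Delta> @ W)" using Id_ctx_ctx[OF D cW FW X] by blast
  have l\<Delta>: "length \<Delta> = n" "length \<Delta>0 = n" by (subst length_Id_ctx; simp add: len_v)+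
  have sD: "msub S (\<Delta> @ W) (\<lambda>i. Var (i + n)) W" using msub_shift[OF cD] by (simp only: l\<Delta>)
  have c\<Theta>: "ctx S (\<Theta> @ \<Delta> @ U \<Phi> @ \<Gamma>)"
    using Id_ctx_ctx[OF D cD el_closed_sub[OF D sD FW] el_closed_sub[OF D sD Y]] by (simp only: lift_eq_sub)
  have dgl: "sub (dg n) (lift (3 * n) e) = lift n e" for e :: "'s expr"
    by (simp only: sub_lift dg_ge) (simp only: lift_eq_sub)
  have m: "map (sub (dg n)) FW = map (lift n) (f # v)" "map (sub (dg n)) (map (ux n) [0..<n]) = map Var [0..<n]"
    "map (sub (dg n)) (map (uy n) [0..<n]) = map Var [0..<n]"
    by (simp_all only: map_map comp_def dgl fun_cong[OF dg_ux] fun_cong[OF dg_uy])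
  have m': "map (sub (up_sub n (dg n))) (map (lift n) zs) = map (lift n) (map (sub (dg n)) zs)" for zs
    by (simp add: sub_up_sub_lift)
  have s\<Delta>: "subT (dg n) \<Delta> = \<Delta>0"
    by (subst subT_Id_ctx[OF D]) (simp_all only: m, simp_all add: len_v)
  have s\<Theta>: "subT (up_sub n (dg n)) \<Theta> = \<Theta>0"
    by (subst subT_Id_ctx[OF D]) (simp_all only: m' m, simp_all add: len_v)
  have c0: "ctx S (\<Delta>0 @ \<Phi> @ \<Gamma>)" using msub_ctx[OF msub_dg[OF DG] cD] by (simp only: l\<Phi> s\<Delta>)
  have "el S (\<Delta>0 @ \<Phi> @ \<Gamma>) (subT (\<lambda>i. Var (i + n)) \<Delta>0) (map Var [0..<n])"
    using el_Vars[OF c0] by (simp only: l\<Delta>)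
  moreover have "subT (\<lambda>i. Var (i + n)) \<Delta>0 = \<Theta>0"
    by (subst subT_Id_ctx[OF D]) (simp_all only: lift_eq_sub, simp_all add: len_v)
  ultimately have "el S (subT (dg (length \<Phi>)) \<Delta> @ \<Phi> @ \<Gamma>) (subT (up_sub n (dg (length \<Phi>))) \<Theta>) (map Var [0..<n])"
    by (simp only: l\<Phi> s\<Delta> s\<Theta>)
  from J_iter_tele[OF DG l\<Delta>(1)[symmetric] c\<Theta> this]
  show "el S (\<Delta> @ W) \<Theta> Js"
    "el_eq S (\<Delta>0 @ \<Phi> @ \<Gamma>) \<Theta>0 (map (sub (up_sub n (dg n))) Js) (map Var [0..<n])"
    by (simp_all only: l\<Phi> s\<Delta> s\<Theta>)
qed

text \<open>\<open>comp_ctx\<close> is an instance of \<open>Js\<close>, so congruence of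
  substitution covers arbitrary representatives of the cells and of their end points.\<close>

lemma comp_ctx_cong:
  assumes G: "el_eq S \<Gamma> (U \<Phi>) (il \<beta> H G) (il \<beta>' H' G')" and \<alpha>: "el_eq S \<Gamma> (Id_ctx \<Phi> (f # v) G) \<alpha> \<alpha>'"
    and l: "length \<beta> = n" "length H = n" "length G = n" "length \<beta>' = n" "length H' = n" "length G' = n"
  shows "el_eq S \<Gamma> (Id_ctx \<Phi> (f # v) H) (map (sub (lsub (\<alpha> @ il \<beta> H G) Var)) Js) (comp_ctx G' H' \<beta>' \<alpha>')"
proof -
  have la: "length \<alpha> = n" "length \<alpha>' = n"
    using el_eq_length[OF \<alpha>] length_Id_ctx[of "f # v" \<Phi> G] l len_v by simp_all
  have l\<Delta>: "length \<Delta> = n" by (subst length_Id_ctx; simp add: len_v)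
  have sV: "map (sub Var) (f # v) = f # v" by (simp add: map_idI)
  have lil: "length (il \<beta> H G) = length (U \<Phi>)" "length (il \<beta>' H' G') = length (U \<Phi>)" using l by simp_all
  have "msub_eq S \<Gamma> (lsub (il \<beta> H G) Var) (lsub (il \<beta>' H' G') Var) W"
    unfolding msub_eq_lsub[OF lil] using G msub_eq_refl[OF msub_Var[OF c]] by (simp only: subT_Var)
  moreover have "el_eq S \<Gamma> (subT (lsub (il \<beta> H G) Var) \<Delta>) \<alpha> \<alpha>'"
    unfolding sub_lsub_il(3)[OF la(1) l(1,2,3)] sV by (rule \<alpha>)
  ultimately have "msub_eq S \<Gamma> (lsub (\<alpha> @ il \<beta> H G) Var) (lsub (\<alpha>' @ il \<beta>' H' G') Var) (\<Delta> @ W)"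
    unfolding lsub_append using msub_eq_lsub[of \<alpha> \<Delta> \<alpha>' S \<Gamma> _ _ W] la l\<Delta> by presburger
  from el_sub_cong[OF this Js(1)]
  have "el_eq S \<Gamma> (Id_ctx \<Phi> (f # v) H) (map (sub (lsub (\<alpha> @ il \<beta> H G) Var)) Js) (map (sub (lsub (\<alpha>' @ il \<beta>' H' G') Var)) Js)"
    unfolding sub_lsub_il(4)[OF la(1) l(1,2,3)] sV .
  moreover have "comp_ctx G' H' \<beta>' \<alpha>' = map (sub (lsub (\<alpha>' @ il \<beta>' H' G') Var)) Js"
    unfolding comp_ctx_def by (subst J_ctx_eq) (simp_all only: la l inst_eq_sub)
  ultimately show ?thesis by simp
qed

text \<open>Composition in the identity context eliminates over all entries, while
  \<open>vcomp\<close> eliminates one type. The two are compared by uniqueness for generic x, y, q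
  in the type of the head, with p in the post-context and reflexivities in all tail positions: for
  reflexive q both give p with a reflexive tail.\<close>

lemma comp_vertical_generic:
  "el_eq S ([IdT (lift 3 B) (lift 3 f) (Var 2)] @ Id_tele B @ \<Gamma>)
    (Id_ctx \<Phi> (lift 4 f # map (lift 4) v) (Var 2 # map (lift 4) v))
    (vcomp (Var 3) (Var 2) (Var 1) (Var 0) # map ReflT (map (lift 4) v))
    (map (sub (lsub ((Var 0 # map ReflT (map (lift 4) v)) @
      il (Var 1 # map ReflT (map (lift 4) v)) (Var 2 # map (lift 4) v) (Var 3 # map (lift 4) v)) (\<lambda>i. Var (i + 4)))) Js)"
proof -
  let ?P = "[IdT (lift 3 B) (lift 3 f) (Var 2)]"
  let ?\<Psi> = "?P @ Id_tele B @ \<Gamma>" and ?\<Omega> = "[IdT (lift 1 B) (lift 1 f) (Var 0)] @ B # \<Gamma>"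
  let ?v = "map (lift 4) v" and ?w = "map (lift 2) v"
  let ?r = "map ReflT ?v" and ?q = "map ReflT ?w"
  let ?il = "il (Var 1 # ?r) (Var 2 # ?v) (Var 3 # ?v)"
  let ?\<tau> = "lsub ((Var 0 # ?r) @ ?il) (\<lambda>i. Var (i + 4))" and ?\<omega> = "lsub ((Var 0 # ?q) @ (Var 1 # ?w)) (\<lambda>i. Var (i + 2))"
  let ?\<Theta>' = "Id_ctx \<Phi> (lift 4 f # ?v) (Var 2 # ?v)" and ?\<Theta>'' = "Id_ctx \<Phi> (lift 2 f # ?w) (Var 1 # ?w)"
  let ?d = "up_sub 1 diag :: nat \<Rightarrow> 's expr"
  have B: "\<Gamma> \<turnstile> Ty B" by (rule presup_Tm[OF f])
  from presup_Ty_ctx[OF Id_from_Ty[OF f]] have c\<Psi>: "ctx S ?\<Psi>" by simp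
  have V: "?\<Psi> \<turnstile> Tm (Var 3) (lift 4 B)" "?\<Psi> \<turnstile> Tm (Var 2) (lift 4 B)"
    "?\<Psi> \<turnstile> Tm (Var 1) (IdT (lift 4 B) (Var 3) (Var 2))" "?\<Psi> \<turnstile> Tm (Var 0) (IdT (lift 4 B) (lift 4 f) (Var 3))"
    using variable[OF c\<Psi>, of 3] variable[OF c\<Psi>, of 2] variable[OF c\<Psi>, of 1] variable[OF c\<Psi>, of 0]
    by (simp_all add: lift_lift eval_nat_numeral)
  have f4: "?\<Psi> \<turnstile> Tm (lift 4 f) (lift 4 B)"
    using lift_judgement[OF f, of "?P @ Id_tele B"] c\<Psi> by (simp add: eval_nat_numeral)
  have sh: "msub S ?\<Psi> (\<lambda>i. Var (i + 4)) \<Gamma>" using msub_shift[of "?P @ Id_tele B" \<Gamma>] c\<Psi> by (simp add: eval_nat_numeral)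
  have "B # \<Gamma> \<turnstile> Ty (IdT (lift 1 B) (lift 1 f) (Var 0))"
    using Id_form[OF lift1_Tm[OF f B] Tm_Var0[OF B]] .
  from presup_Ty_ctx[OF this] have c0: "ctx S ?\<Omega>" by simp
  have V0: "?\<Omega> \<turnstile> Tm (Var 1) (lift 2 B)" "?\<Omega> \<turnstile> Tm (Var 0) (IdT (lift 2 B) (lift 2 f) (Var 1))"
    using variable[OF c0, of 1] variable[OF c0, of 0] by (simp_all add: lift_lift eval_nat_numeral)
  have f2: "?\<Omega> \<turnstile> Tm (lift 2 f) (lift 2 B)"
    using lift_judgement[OF f, of "[IdT (lift 1 B) (lift 1 f) (Var 0), B]"] c0 by (simp add: eval_nat_numeral)
  have sh0: "msub S ?\<Omega> (\<lambda>i. Var (i + 2)) \<Gamma>"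
    using msub_shift[of "[IdT (lift 1 B) (lift 1 f) (Var 0), B]" \<Gamma>] c0 by (simp add: eval_nat_numeral)
  have s4: "sub ?d (lift 4 e) = lift 2 e" for e :: "'s expr"
    by (simp add: sub_lift up_sub_def lsub_def eval_nat_numeral) (simp add: lift_eq_sub)
  have s4v: "map (sub ?d) ?v = ?w" "map (sub ?d) ?r = ?q" by (simp_all only: map_map comp_def s4 sub.simps)
  have sV: "sub ?d (Var 3) = Var 1" "sub ?d (Var 2) = Var 1" "sub ?d (Var 1) = ReflT (Var 1)" "sub ?d (Var 0) = Var 0"
    by (simp_all add: up_sub_def lsub_def eval_nat_numeral)
  have sP: "subT diag ?P = [IdT (lift 1 B) (lift 1 f) (Var 0)]"
    by (simp add: sub_lift lsub_def eval_nat_numeral) (simp add: lift_eq_sub)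
  have len: "length (Var i # ?r) = n" "length (Var i # ?v) = n" "length (e # ?v) = n" "length (Var i # ?q) = n" "length (Var i # ?w) = n"
    "length (e # ?w) = n" for i and e :: "'s expr"
    by (simp_all add: len_v)
  have l\<Phi>: "length \<Phi> = n" by simp
  have l\<Delta>: "length \<Delta> = n" "length \<Delta>0 = n" by (subst length_Id_ctx; simp add: len_v)+
  note at4 = vertical_at[OF sh] and at2 = vertical_at[OF sh0]
  have shf: "map (sub (\<lambda>i. Var (i + 4))) (f # v) = lift 4 f # ?v" "map (sub (\<lambda>i. Var (i + 2))) (f # v) = lift 2 f # ?w"
    by (simp_all add: lift_eq_sub)
  have "el S ?\<Psi> (U \<Phi>) ?il"
    unfolding el_U(1)[OF D len(2)[unfolded l\<Phi>[symmetric]] len(2)[unfolded l\<Phi>[symmetric]] len(1)[unfolded l\<Phi>[symmetric]]]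
    using at4(3)[OF V(1)] at4(3)[OF V(2)] at4(4)[OF V(1,2)] V(3) by blast
  then have "msub S ?\<Psi> (lsub ?il (\<lambda>i. Var (i + 4))) W"
    using msub_lsub[of ?il "U \<Phi>" S ?\<Psi> "\<lambda>i. Var (i + 4)" \<Gamma>] sh subT_closed[OF ctx_U_closed[OF D]] len by simp
  moreover have "el S ?\<Psi> (subT (lsub ?il (\<lambda>i. Var (i + 4))) \<Delta>) (Var 0 # ?r)"
    unfolding sub_lsub_il(3)[OF len(1) len(1) len(2) len(2)] shf using at4(4)[OF f4 V(1)] V(4) by blast
  ultimately have \<tau>: "msub S ?\<Psi> ?\<tau> (\<Delta> @ W)"
    unfolding lsub_append using msub_lsub[of "Var 0 # ?r" \<Delta> S ?\<Psi> _ W] len(1) l\<Delta> by presburger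
  have ts: "el S ?\<Psi> ?\<Theta>' (map (sub ?\<tau>) Js)"
    using el_sub[OF \<tau> Js(1)] unfolding sub_lsub_il(4)[OF len(1) len(1) len(2) len(2)] shf .
  have us: "el S ?\<Psi> ?\<Theta>' (vcomp (Var 3) (Var 2) (Var 1) (Var 0) # ?r)"
    using at4(4)[OF f4 V(2)] vcomp_generic(1)[OF f] by blast
  note \<Theta>' = Id_ctx_ctx[OF D c\<Psi> at4(3)[OF f4] at4(3)[OF V(2)]]
  have c1: "ctx S (?\<Theta>'' @ ?\<Omega>)" using Id_ctx_ctx[OF D c0 at2(3)[OF f2] at2(3)[OF V0(1)]] by blast
  have s\<Theta>': "subT ?d ?\<Theta>' = ?\<Theta>''"
    by (subst subT_Id_ctx[OF D]) (simp_all only: list.map s4v s4 sV len l\<Phi>)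
  have il0: "map (sub ?d) ((Var 0 # ?r) @ ?il) = (Var 0 # ?q) @ il (map ReflT (Var 1 # ?w)) (Var 1 # ?w) (Var 1 # ?w)"
    by (simp only: map_append map_il list.map s4v sV)
  have \<omega>0: "?\<omega> = lsub (Var 0 # ?q) (lsub (Var 1 # ?w) (\<lambda>i. Var (i + 2)))" by (rule lsub_append)
  have "sub ?d (Var (i + 4)) = Var (i + 2)" for i by (simp add: up_sub_def lsub_def)
  \<comment> \<open>Putting the one generic identification on the diagonal puts the whole context
    identification there, since its other components are reflexivities already. Thus the computation
    rule for \<open>Js\<close> applies.\<close>
  then have "(\<lambda>i. sub ?d (?\<tau> i)) = lsub (Var 0 # ?q) (lsub (il (map ReflT (Var 1 # ?w)) (Var 1 # ?w) (Var 1 # ?w)) (\<lambda>i. Var (i + 2)))"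
    unfolding sub_lsub unfolding il0 lsub_append by (simp only:)
  also have "\<dots> = (\<lambda>i. sub ?\<omega> (up_sub n (dg n) i))"
    unfolding \<omega>0 sub_lsub_up_sub[OF len(4)] lsub_dg[OF len(5)] ..
  finally have "map (sub ?d) (map (sub ?\<tau>) Js) = map (sub ?\<omega>) (map (sub (up_sub n (dg n))) Js)"
    by (simp only: map_map comp_def sub_sub)
  moreover have \<omega>1: "map (sub (lsub (Var 1 # ?w) (\<lambda>i. Var (i + 2)))) (map (lift n) (f # v)) = lift 2 f # ?w"
    unfolding shf(2)[symmetric] map_map comp_def using sub_lsub_lift[of "Var 1 # ?w" "\<lambda>i. Var (i + 2)"] len(5) by simp
  moreover have "msub S ?\<Omega> ?\<omega> (\<Delta>0 @ \<Phi> @ \<Gamma>)"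
  proof -
    have 1: "msub S ?\<Omega> (lsub (Var 1 # ?w) (\<lambda>i. Var (i + 2))) (\<Phi> @ \<Gamma>)"
      using msub_lsub[of "Var 1 # ?w" \<Phi> S ?\<Omega> "\<lambda>i. Var (i + 2)" \<Gamma>] sh0 subT_closed[OF D] len(5) l\<Phi> at2(3)[OF V0(1)] by simp
    have "subT (lsub (Var 1 # ?w) (\<lambda>i. Var (i + 2))) \<Delta>0 = ?\<Theta>''"
      by (subst subT_Id_ctx[OF D]) (simp_all only: map_lsub_Vars[OF len(5)] \<omega>1, simp_all add: len_v)
    then have "el S ?\<Omega> (subT (lsub (Var 1 # ?w) (\<lambda>i. Var (i + 2))) \<Delta>0) (Var 0 # ?q)"
      using at2(4)[OF f2 V0(1)] V0(2) by simp
    with 1 show ?thesis unfolding \<omega>0 using msub_lsub[of "Var 0 # ?q" \<Delta>0 S ?\<Omega> _ "\<Phi> @ \<Gamma>"] len(4) l\<Delta> by presburger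
  qed
  note el_eq_sub[OF this Js(2)]
  moreover have "subT ?\<omega> \<Theta>0 = ?\<Theta>''"
  proof -
    have 1: "sub ?\<omega> (lift n e) = sub (lsub (Var 1 # ?w) (\<lambda>i. Var (i + 2))) e" for e
      unfolding \<omega>0 using sub_lsub_lift[of "Var 0 # ?q"] len(4) by simp
    have 2: "map (sub ?\<omega>) (map (lift n) zs) = map (sub (lsub (Var 1 # ?w) (\<lambda>i. Var (i + 2)))) zs" for zs
      by (induction zs) (simp_all only: list.map 1)
    show ?thesis
      by (subst subT_Id_ctx[OF D]) (simp_all only: 2 \<omega>1 map_lsub_Vars[OF len(5)], simp_all add: len_v)
  qed
  moreover have "map (sub ?\<omega>) (map Var [0..<n]) = Var 0 # ?q" unfolding \<omega>0 by (rule map_lsub_Vars[OF len(4)])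
  ultimately have t: "el_eq S ?\<Omega> ?\<Theta>'' (map (sub ?d) (map (sub ?\<tau>) Js)) (Var 0 # ?q)" by (simp only:)
  have "el_eq S ?\<Omega> ?\<Theta>'' (vcomp (Var 1) (Var 1) (ReflT (Var 1)) (Var 0) # ?q) (Var 0 # ?q)"
    using at2(5)[OF f2 V0(1)] vcomp_generic(2)[OF f] by blast
  from el_eq_trans[OF this el_eq_sym[OF t c1] c1]
  have e: "el_eq S (subT diag ?P @ [B] @ \<Gamma>) (subT ?d ?\<Theta>') (map (sub ?d) (vcomp (Var 3) (Var 2) (Var 1) (Var 0) # ?r)) (map (sub ?d) (map (sub ?\<tau>) Js))"
    unfolding sP s\<Theta>' list.map sub_vcomp sV s4v by simp
  have cB: "ctx S ([B] @ \<Gamma>)" using presup_Ty_ctx[OF B] by simp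
  have 1: "1 = length ?P" by simp
  show ?thesis
    using Id_unique_tele[OF cB 1, unfolded U_single dg_single] \<Theta>' us ts e by blast
qed

text \<open>Specialises the generic comparison to given terms, then passes to arbitrary
  representatives of the cells by \<open>comp_ctx_cong\<close>.\<close>

lemma comp_ctx_vertical:
  assumes g: "\<Gamma> \<turnstile> Tm g B" and h: "\<Gamma> \<turnstile> Tm h B"
    and a: "\<Gamma> \<turnstile> Tm a (IdT B f g)" and b: "\<Gamma> \<turnstile> Tm b (IdT B g h)"
    and G: "el_eq S \<Gamma> (U \<Phi>) (il (b # map ReflT v) (h # v) (g # v)) (il \<beta>' H' G')"
    and \<alpha>: "el_eq S \<Gamma> (Id_ctx \<Phi> (f # v) (g # v)) (a # map ReflT v) \<alpha>'"
    and l: "length \<beta>' = n" "length H' = n" "length G' = n"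
  shows "el_eq S \<Gamma> (Id_ctx \<Phi> (f # v) (h # v)) (vcomp g h b a # map ReflT v) (comp_ctx G' H' \<beta>' \<alpha>')"
proof -
  let ?\<kappa> = "lsub [a, b, h, g] Var" and ?v = "map (lift 4) v"
  let ?r = "map ReflT ?v"
  let ?\<tau> = "lsub ((Var 0 # ?r) @ il (Var 1 # ?r) (Var 2 # ?v) (Var 3 # ?v)) (\<lambda>i. Var (i + 4))"
  let ?\<sigma> = "lsub ((a # map ReflT v) @ il (b # map ReflT v) (h # v) (g # v)) Var"
  have \<kappa>: "msub S \<Gamma> ?\<kappa> ([IdT (lift 3 B) (lift 3 f) (Var 2)] @ Id_tele B @ \<Gamma>)"
    using a b g h msub_Var[OF c] by (simp add: lsub_Cons msub_scons sub_lift eval_nat_numeral)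
  have s4: "sub ?\<kappa> (lift 4 e) = e" for e by (simp add: sub_lift lsub_Cons eval_nat_numeral)
  have s4v: "map (sub ?\<kappa>) ?v = v" "map (sub ?\<kappa>) ?r = map ReflT v" by (simp_all add: s4 comp_def)
  have sV: "sub ?\<kappa> (Var 3) = g" "sub ?\<kappa> (Var 2) = h" "sub ?\<kappa> (Var 1) = b" "sub ?\<kappa> (Var 0) = a"
    by (simp_all add: lsub_Cons eval_nat_numeral)
  have s\<Theta>: "subT ?\<kappa> (Id_ctx \<Phi> (lift 4 f # ?v) (Var 2 # ?v)) = Id_ctx \<Phi> (f # v) (h # v)"
    by (subst subT_Id_ctx[OF D]) (simp_all only: list.map s4v s4 sV, simp_all add: len_v)
  have il: "map (sub ?\<kappa>) ((Var 0 # ?r) @ il (Var 1 # ?r) (Var 2 # ?v) (Var 3 # ?v)) =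
      (a # map ReflT v) @ il (b # map ReflT v) (h # v) (g # v)"
    by (simp only: map_append map_il list.map s4v sV)
  have "sub ?\<kappa> (Var (i + 4)) = Var i" for i by (simp add: lsub_def)
  then have "(\<lambda>i. sub ?\<kappa> (?\<tau> i)) = ?\<sigma>" unfolding sub_lsub il by (simp only:)
  then have ts: "map (sub ?\<kappa>) (map (sub ?\<tau>) Js) = map (sub ?\<sigma>) Js" by (simp only: map_map comp_def sub_sub)
  have 1: "el_eq S \<Gamma> (Id_ctx \<Phi> (f # v) (h # v)) (vcomp g h b a # map ReflT v) (map (sub ?\<sigma>) Js)"
    using el_eq_sub[OF \<kappa> comp_vertical_generic] unfolding s\<Theta> ts list.map sub_vcomp sV s4v .
  have 2: "el_eq S \<Gamma> (Id_ctx \<Phi> (f # v) (h # v)) (map (sub ?\<sigma>) Js) (comp_ctx G' H' \<beta>' \<alpha>')"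
    by (rule comp_ctx_cong[OF G \<alpha>]) (simp_all add: len_v l)
  have "ctx S (Id_ctx \<Phi> (f # v) (h # v) @ \<Gamma>)" using Id_ctx_ctx[OF D c, of "f # v" "h # v"] v f h by simp
  from el_eq_trans[OF 1 2 this] show ?thesis .
qed

end

end

section \<open>The fibre and the slice over the identity\<close>

context dependent_type_theory
begin

lemma rep_el: "el S \<Gamma> \<Theta> ts \<Longrightarrow> el_eq S \<Gamma> \<Theta> ts (rep (el_class S \<Gamma> \<Theta> ts))"
  unfolding rep_def el_class_def mem_Collect_eq by (rule someI[of _ ts]) (rule el_eq_refl)

lemma rep_tm: "\<Gamma> \<turnstile> Tm a A \<Longrightarrow> \<Gamma> \<turnstile> TmEq a (rep (tm_class S \<Gamma> A a)) A"
  unfolding rep_def tm_class_def mem_Collect_eq by (rule someI[of _ a]) (rule TmEq_refl)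

lemma el_class_eq:
  "el_eq S \<Gamma> \<Theta> ts us \<Longrightarrow> ctx S (\<Theta> @ \<Gamma>) \<Longrightarrow> el_class S \<Gamma> \<Theta> ts = el_class S \<Gamma> \<Theta> us"
  unfolding el_class_def using el_eq_trans el_eq_sym by blast

lemma el_class_eqD: "el_class S \<Gamma> \<Theta> ts = el_class S \<Gamma> \<Theta> us \<Longrightarrow> el S \<Gamma> \<Theta> us \<Longrightarrow> el_eq S \<Gamma> \<Theta> ts us"
  unfolding el_class_def using el_eq_refl by blast

lemma tm_class_eq_iff: "\<Gamma> \<turnstile> Tm b A \<Longrightarrow> tm_class S \<Gamma> A a = tm_class S \<Gamma> A b \<longleftrightarrow> (\<Gamma> \<turnstile> TmEq a b A)"
  unfolding tm_class_def using TmEq_trans TmEq_sym TmEq_refl by blast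

lemma tm_class_conv: "\<Gamma> \<turnstile> TyEq A A' \<Longrightarrow> tm_class S \<Gamma> A a = tm_class S \<Gamma> A' a"
  unfolding tm_class_def using TmEq_conv TyEq_sym by blast

end

context ML2
begin

text \<open>A class sees its boundary only through the type at which its members are compared.
  Equality of the full interleaved vectors makes the two sets of members coincide, even when the
  boundaries are different raw terms.\<close>

lemma cell_eq:
  assumes L: "ctx S \<Lambda>" and c: "ctx S \<Gamma>" and e: "el_eq S \<Gamma> (U \<Lambda>) (il ps ys xs) (il ps' ys' xs')"
    and l: "length ps = length \<Lambda>" "length ys = length \<Lambda>" "length xs = length \<Lambda>"
      "length ps' = length \<Lambda>" "length ys' = length \<Lambda>" "length xs' = length \<Lambda>"
  shows "el_class S \<Gamma> (Id_ctx \<Lambda> xs ys) ps = el_class S \<Gamma> (Id_ctx \<Lambda> xs' ys') ps'"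
proof -
  have cU: "ctx S (U \<Lambda> @ \<Gamma>)" by (rule ctx_append_closed[OF ctx_U_closed[OF L] c])
  have "us \<in> el_class S \<Gamma> (Id_ctx \<Lambda> xs' ys') ps'"
    if us: "us \<in> el_class S \<Gamma> (Id_ctx \<Lambda> xs ys) ps" and e: "el_eq S \<Gamma> (U \<Lambda>) (il ps ys xs) (il ps' ys' xs')"
      and l: "length ps = length \<Lambda>" "length ys = length \<Lambda>" "length xs = length \<Lambda>"
        "length ps' = length \<Lambda>" "length ys' = length \<Lambda>" "length xs' = length \<Lambda>"
    for us xs ys ps xs' ys' ps'
  proof -
    have u: "el_eq S \<Gamma> (Id_ctx \<Lambda> xs ys) ps us" using us by (simp add: el_class_def)
    have lu: "length us = length \<Lambda>" using el_eq_length[OF u] l by simp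
    have x: "el_eq S \<Gamma> \<Lambda> xs xs'" "el_eq S \<Gamma> \<Lambda> ys ys'" using e l by (simp_all add: el_U(2)[OF L])
    have "el_eq S \<Gamma> (U \<Lambda>) (il ps ys xs) (il us ys' xs')" using x u l lu by (simp add: el_U(2)[OF L])
    from el_eq_trans[OF el_eq_sym[OF e cU] this cU] show ?thesis
      using l lu by (simp add: el_U(2)[OF L] el_class_def)
  qed
  from this[OF _ e l] this[OF _ el_eq_sym[OF e cU] l(4,5,6,1,2,3)] show ?thesis by blast
qed

text \<open>Arrows of the fibre are typed over chosen representatives of their end points;
  conversion of the identity type moves them to the given terms.\<close>

lemma fibre_term_cat:
  "term_cat (A # \<Gamma>) (lift 1 B) (fibre_hom S \<Gamma> A B) (tm_class S (A # \<Gamma>) (lift 1 B))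
    (\<lambda>f g. tm_class S (A # \<Gamma>) (IdT (lift 1 B) f g))"
proof -
  let ?G = "A # \<Gamma>" and ?T = "lift 1 B"
  let ?ob = "tm_class S ?G ?T" and ?arr = "\<lambda>f g. tm_class S ?G (IdT ?T f g)"
  have r: "?G \<turnstile> TmEq f (rep (?ob f)) ?T" if "?G \<turnstile> Tm f ?T" for f
    by (rule rep_tm[OF that])
  have I: "?G \<turnstile> TyEq (IdT ?T f g) (IdT ?T f' g')" if "?G \<turnstile> TmEq f f' ?T" "?G \<turnstile> TmEq g g' ?T" for f g f' g'
    using Id_form_cong[OF TyEq_refl that] presup_Tm presup_TmEq that by blast
  show ?thesis
    unfolding term_cat_def
  proof (intro conjI allI impI)
    show "Ob (fibre_hom S \<Gamma> A B) = {?ob f |f. ?G \<turnstile> Tm f ?T}" by (simp add: fibre_hom_def)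
    fix f g assume f: "?G \<turnstile> Tm f ?T" and g: "?G \<turnstile> Tm g ?T"
    show "?ob f = ?ob g \<longleftrightarrow> (?G \<turnstile> TmEq f g ?T)" by (rule tm_class_eq_iff[OF g])
    note I1 = I[OF r[OF f] r[OF g]]
    have "(?G \<turnstile> Tm p (IdT ?T (rep (?ob f)) (rep (?ob g)))) \<longleftrightarrow> (?G \<turnstile> Tm p (IdT ?T f g))" for p
      using Tm_conv I1 TyEq_sym by blast
    then show "Hom (fibre_hom S \<Gamma> A B) (?ob f) (?ob g) = {?arr f g p |p. ?G \<turnstile> Tm p (IdT ?T f g)}"
      using tm_class_conv[OF I1] by (simp add: fibre_hom_def)
    have "?G \<turnstile> TmEq (ReflT f) (ReflT (rep (?ob f))) (IdT ?T f f)" by (rule Id_intro_cong[OF r[OF f]])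
    then have "?arr f f (ReflT f) = ?arr f f (ReflT (rep (?ob f)))"
      using tm_class_eq_iff presup_TmEq by blast
    then show "Idt (fibre_hom S \<Gamma> A B) (?ob f) = ?arr f f (ReflT f)"
      using tm_class_conv[OF I[OF r[OF f] r[OF f]]] by (simp add: fibre_hom_def)
  next
    fix f g h p q
    assume f: "?G \<turnstile> Tm f ?T" and g: "?G \<turnstile> Tm g ?T" and h: "?G \<turnstile> Tm h ?T"
      and p: "?G \<turnstile> Tm p (IdT ?T f g)" and q: "?G \<turnstile> Tm q (IdT ?T g h)"
    let ?c = "vcomp (rep (?ob g)) (rep (?ob h)) (rep (?arr g h q)) (rep (?arr f g p))"
    have "?G \<turnstile> TmEq (vcomp g h q p) ?c (IdT ?T f h)"
      by (rule vcomp_cong[OF f r[OF g] r[OF h] rep_tm[OF p] rep_tm[OF q]])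
    then have "?arr f h (vcomp g h q p) = ?arr f h ?c" using tm_class_eq_iff presup_TmEq by blast
    then show "Cmp (fibre_hom S \<Gamma> A B) (?ob f) (?ob g) (?ob h) (?arr g h q) (?arr f g p) = ?arr f h (vcomp g h q p)"
      using tm_class_conv[OF I[OF r[OF f] r[OF h]]] by (simp add: fibre_hom_def vcomp_def)
  next
    fix f f' g g' p p'
    assume "?G \<turnstile> TmEq f f' ?T" "?G \<turnstile> TmEq g g' ?T" and p': "?G \<turnstile> Tm p' (IdT ?T f g)"
    then show "?arr f g p = ?arr f' g' p' \<longleftrightarrow> (?G \<turnstile> TmEq p p' (IdT ?T f g))"
      using tm_class_conv[OF I] tm_class_eq_iff[OF p'] by metis
  qed
qed

section \<open>The hom-category of the slice out of the identity\<close>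

context
  fixes \<Gamma> B
  assumes c: "ctx S \<Gamma>" and B: "\<Gamma> \<turnstile> Ty B"
begin

private abbreviation "v \<equiv> map Var [0..<length \<Gamma>]"
private abbreviation "\<Gamma>B \<equiv> B # \<Gamma>"
private abbreviation "\<pi> \<equiv> rep (el_class S \<Gamma>B \<Gamma> (proj \<Gamma>))"
private abbreviation "N \<equiv> Suc (length \<Gamma>)"
text \<open>Candidates for the cells of the slice: the section with head b, and the vertical
  identification with head q. Their tails are the variables of \<Gamma> and the reflexivities at
  these.\<close>

private abbreviation "ob b \<equiv> el_class S \<Gamma> \<Gamma>B (b # v)"
private abbreviation "arr b b' q \<equiv> el_class S \<Gamma> (Id_ctx \<Gamma>B (b # v) (b' # v)) (q # map ReflT v)"

lemma
  shows ctx_\<Gamma>B: "ctx S \<Gamma>B" and el_v: "el S \<Gamma> \<Gamma> v" and inst_v: "inst 0 v B = B"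
    and ctx_\<Gamma>B\<Gamma>: "ctx S (\<Gamma>B @ \<Gamma>)" and ctx_\<Gamma>\<Gamma>: "ctx S (\<Gamma> @ \<Gamma>)" and ctx_UU: "ctx S (U \<Gamma>B @ \<Gamma>)" "ctx S (U \<Gamma> @ \<Gamma>)"
    and proj: "el_eq S \<Gamma>B \<Gamma> (proj \<Gamma>) \<pi>"
proof -
  show P: "ctx S \<Gamma>B" using c B by simp
  show "el S \<Gamma> \<Gamma> v" by (rule el_Vars_closed[OF c])
  show "inst 0 v B = B" using inst_Vars scope[OF B] by simp
  show "ctx S (\<Gamma>B @ \<Gamma>)" "ctx S (\<Gamma> @ \<Gamma>)" by (rule ctx_append_closed[OF P c] ctx_append_closed[OF c c])+
  show "ctx S (U \<Gamma>B @ \<Gamma>)" "ctx S (U \<Gamma> @ \<Gamma>)"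
    by (rule ctx_append_closed[OF ctx_U_closed[OF P] c] ctx_append_closed[OF ctx_U_closed[OF c] c])+
  have "msub S \<Gamma>B (\<lambda>i. Var (Suc i)) \<Gamma>" using msub_shift[of "[B]" \<Gamma>] P by simp
  from rep_el[OF msub_el[OF c this]] show "el_eq S \<Gamma>B \<Gamma> (proj \<Gamma>) \<pi>" by (simp add: proj_eq)
qed

lemma el_ob: "\<Gamma> \<turnstile> Tm b B \<Longrightarrow> el S \<Gamma> \<Gamma>B (b # v)"
  using el_v inst_v by simp

lemma rep_ob: "\<Gamma> \<turnstile> Tm b B \<Longrightarrow> el_eq S \<Gamma> \<Gamma>B (b # v) (rep (ob b))"
  by (rule rep_el[OF el_ob])

lemma el_arr:
  assumes "\<Gamma> \<turnstile> Tm b B" and "\<Gamma> \<turnstile> Tm b' B"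
  shows "el S \<Gamma> (Id_ctx \<Gamma>B (b # v) (b' # v)) (q # map ReflT v) \<longleftrightarrow> (\<Gamma> \<turnstile> Tm q (IdT B b b'))"
    and "el_eq S \<Gamma> (Id_ctx \<Gamma>B (b # v) (b' # v)) (q # map ReflT v) (q' # map ReflT v) \<longleftrightarrow> (\<Gamma> \<turnstile> TmEq q q' (IdT B b b'))"
  using el_vertical[OF ctx_\<Gamma>B c el_v] assms unfolding inst_v by blast+

lemma proj_comp:
  assumes "el_eq S \<Gamma> \<Gamma>B (b # xs) F"
  shows "el_eq S \<Gamma> \<Gamma> xs (map (inst 0 F) \<pi>)"
proof -
  have "length xs = length \<Gamma>" using el_eq_length[OF assms] by simp
  then have "map (inst 0 (b # xs)) (proj \<Gamma>) = xs"
    using map_lsub_Vars[of xs "length \<Gamma>" Var] by (simp add: proj_eq inst_eq_sub lsub_Cons comp_def)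
  with el_eq_comp[OF ctx_\<Gamma>B c c assms proj] show ?thesis by simp
qed

text \<open>Composing with the projection returns the tail of a vector, so lying over the identity
  forces the tail to equal the variables of \<Gamma>; the head then acquires type \<open>B\<close>
  by conversion.\<close>

lemma Ob_slice:
  "{k \<in> Ob (ctx_hom S \<Gamma> \<Gamma>B). el_class S \<Gamma> \<Gamma> (map (inst 0 (rep k)) \<pi>) = el_class S \<Gamma> \<Gamma> v} = {ob b |b. \<Gamma> \<turnstile> Tm b B}"
proof (intro equalityI subsetI)
  fix k assume "k \<in> {ob b |b. \<Gamma> \<turnstile> Tm b B}"
  then obtain b where b: "\<Gamma> \<turnstile> Tm b B" and k: "k = ob b" by auto
  have "el_class S \<Gamma> \<Gamma> v = el_class S \<Gamma> \<Gamma> (map (inst 0 (rep k)) \<pi>)"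
    unfolding k by (rule el_class_eq[OF proj_comp[OF rep_ob[OF b]] ctx_\<Gamma>\<Gamma>])
  then show "k \<in> {k \<in> Ob (ctx_hom S \<Gamma> \<Gamma>B). el_class S \<Gamma> \<Gamma> (map (inst 0 (rep k)) \<pi>) = el_class S \<Gamma> \<Gamma> v}"
    using el_ob[OF b] by (auto simp: ctx_hom_def k)
next
  fix k assume "k \<in> {k \<in> Ob (ctx_hom S \<Gamma> \<Gamma>B). el_class S \<Gamma> \<Gamma> (map (inst 0 (rep k)) \<pi>) = el_class S \<Gamma> \<Gamma> v}"
  then obtain ts where ts: "el S \<Gamma> \<Gamma>B ts" and k: "k = el_class S \<Gamma> \<Gamma>B ts"
    and e: "el_class S \<Gamma> \<Gamma> (map (inst 0 (rep k)) \<pi>) = el_class S \<Gamma> \<Gamma> v" by (auto simp: ctx_hom_def)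
  obtain b xs where b: "ts = b # xs" using el_length[OF ts] by (cases ts) auto
  have "el_eq S \<Gamma> \<Gamma> xs (map (inst 0 (rep k)) \<pi>)" using proj_comp rep_el[OF ts] unfolding k b by blast
  moreover have "el_eq S \<Gamma> \<Gamma> (map (inst 0 (rep k)) \<pi>) v" by (rule el_class_eqD[OF e el_v])
  ultimately have x: "el_eq S \<Gamma> \<Gamma> xs v" using el_eq_trans ctx_\<Gamma>\<Gamma> by blast
  have bt: "\<Gamma> \<turnstile> Tm b (inst 0 xs B)" using ts b by simp
  have "msub_eq S \<Gamma> (lsub xs Var) (lsub v Var) \<Gamma>"
    using x el_eq_iff_msub_eq[OF c c, of xs v] el_eq_length[OF x] by simp
  from msub_eq_Ty[OF this B] have "\<Gamma> \<turnstile> TyEq (inst 0 xs B) B" using inst_v by (simp add: inst_eq_sub)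
  from Tm_conv[OF bt this] have "\<Gamma> \<turnstile> Tm b B" .
  moreover have "el_eq S \<Gamma> \<Gamma>B ts (b # v)" using x TmEq_refl[OF bt] b by simp
  then have "k = ob b" unfolding k by (rule el_class_eq[OF _ ctx_\<Gamma>B\<Gamma>])
  ultimately show "k \<in> {ob b |b. \<Gamma> \<turnstile> Tm b B}" by auto
qed

lemma refl_v: "el S \<Gamma> (Id_ctx \<Gamma> v v) (map ReflT v)"
  by (rule el_refl[OF c c el_v])

text \<open>The slice condition is an equation between classes built from representatives. By
  \<open>ap_ctx_proj\<close> its left side is the class of the tail identification
  \<open>ps\<close>, while its right side is the class of reflexivity.\<close>

lemma whisk_proj:
  assumes e: "el_eq S \<Gamma> (U \<Gamma>B) (il (q # ps) (b' # v) (b # v)) (il A F' F)"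
    and ps: "el S \<Gamma> (Id_ctx \<Gamma> v v) ps" and l: "length A = N" "length F = N" "length F' = N"
    and i: "el_eq S \<Gamma> \<Gamma> v i"
  shows "el_class S \<Gamma> (Id_ctx \<Gamma> (map (inst 0 F) \<pi>) (map (inst 0 F') \<pi>)) (ap_ctx \<pi> F F' A) =
      el_class S \<Gamma> (Id_ctx \<Gamma> i i) (map ReflT i) \<longleftrightarrow> el_eq S \<Gamma> (Id_ctx \<Gamma> v v) ps (map ReflT v)"
proof -
  have lp: "length ps = length \<Gamma>" using el_length[OF ps] by simp
  have li: "length i = length \<Gamma>" using el_eq_length[OF i] by simp
  obtain q1 ps1 y ys x xs where A: "A = q1 # ps1" and F': "F' = y # ys" and F: "F = x # xs"
    using l by (cases A; cases F; cases F') auto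
  have n: "length xs = length \<Gamma>" "length ys = length \<Gamma>" "length ps1 = length \<Gamma>" using l by (simp_all add: A F F')
  have FF: "el_eq S \<Gamma> \<Gamma>B (b # v) F" "el_eq S \<Gamma> \<Gamma>B (b' # v) F'"
    using e el_U(2)[OF ctx_\<Gamma>B, of "b # v" "b' # v" "q # ps" F F' A] lp l by simp_all
  have t: "el_eq S \<Gamma> (U \<Gamma>) (il ps v v) (il ps1 ys xs)" using e unfolding A F F' by simp
  have "el S \<Gamma> (U \<Gamma>B) (il (q1 # ps1) (y # ys) (x # xs))" using el_eq_right[OF e ctx_UU(1)] unfolding A F F' .
  from ap_ctx_proj[OF ctx_\<Gamma>B c proj this n]
  have a: "el_eq S \<Gamma> (Id_ctx \<Gamma> xs ys) ps1 (ap_ctx \<pi> F F' A)" unfolding A F F' .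
  have la: "length (ap_ctx \<pi> F F' A) = length \<Gamma>" using el_eq_length[OF a] n by simp
  have xy: "el_eq S \<Gamma> \<Gamma> v xs" "el_eq S \<Gamma> \<Gamma> v ys" using FF F F' by simp_all
  have "el_eq S \<Gamma> (U \<Gamma>) (il ps1 ys xs) (il (ap_ctx \<pi> F F' A) ys xs)"
    using a n la xy el_eq_refl el_eq_right[OF _ ctx_\<Gamma>\<Gamma>] by (simp add: el_U(2)[OF c])
  from el_eq_trans[OF t this ctx_UU(2)]
  have "el_eq S \<Gamma> (Id_ctx \<Gamma> v v) ps (ap_ctx \<pi> F F' A)" using n la lp by (simp add: el_U(2)[OF c])
  moreover have p: "el_eq S \<Gamma> \<Gamma> v (map (inst 0 F) \<pi>)" "el_eq S \<Gamma> \<Gamma> v (map (inst 0 F') \<pi>)"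
    using proj_comp FF by blast+
  moreover have l\<pi>: "length \<pi> = length \<Gamma>" using el_eq_length[OF proj] by simp
  ultimately have "el_eq S \<Gamma> (U \<Gamma>) (il ps v v) (il (ap_ctx \<pi> F F' A) (map (inst 0 F') \<pi>) (map (inst 0 F) \<pi>))"
    using la lp by (simp add: el_U(2)[OF c])
  from cell_eq[OF c c this]
  have 1: "el_class S \<Gamma> (Id_ctx \<Gamma> v v) ps =
      el_class S \<Gamma> (Id_ctx \<Gamma> (map (inst 0 F) \<pi>) (map (inst 0 F') \<pi>)) (ap_ctx \<pi> F F' A)"
    using la lp l\<pi> by simp
  have 2: "el_class S \<Gamma> (Id_ctx \<Gamma> v v) (map ReflT v) = el_class S \<Gamma> (Id_ctx \<Gamma> i i) (map ReflT i)"
    by (rule cell_eq[OF c c el_eq_refl_il[OF c c i]]) (simp_all add: li)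
  have "ctx S (Id_ctx \<Gamma> v v @ \<Gamma>)" using Id_ctx_ctx[OF c c el_v el_v] by blast
  then show ?thesis
    unfolding 1[symmetric] 2[symmetric] using el_class_eq el_class_eqD[OF _ refl_v] by blast
qed

lemma el_eq_cell:
  assumes b: "\<Gamma> \<turnstile> Tm b B" and b': "\<Gamma> \<turnstile> Tm b' B" and F: "el_eq S \<Gamma> \<Gamma>B (b # v) F" and F': "el_eq S \<Gamma> \<Gamma>B (b' # v) F'"
    and p: "length ps = N" "length qs = N"
  shows "el_eq S \<Gamma> (U \<Gamma>B) (il ps (b' # v) (b # v)) (il qs F' F) \<longleftrightarrow> el_eq S \<Gamma> (Id_ctx \<Gamma>B (b # v) (b' # v)) ps qs"
  using el_U(2)[OF ctx_\<Gamma>B, of "b # v" "b' # v" ps F F' qs] F F' p el_eq_length[OF F] el_eq_length[OF F'] by simp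

lemma Hom_slice:
  assumes b: "\<Gamma> \<turnstile> Tm b B" and b': "\<Gamma> \<turnstile> Tm b' B"
  shows "{m \<in> Hom (ctx_hom S \<Gamma> \<Gamma>B) (ob b) (ob b').
      el_class S \<Gamma> (Id_ctx \<Gamma> (map (inst 0 (rep (ob b))) \<pi>) (map (inst 0 (rep (ob b'))) \<pi>))
        (ap_ctx \<pi> (rep (ob b)) (rep (ob b')) (rep m)) = Idt (ctx_hom S \<Gamma> \<Gamma>) (el_class S \<Gamma> \<Gamma> v)} =
    {arr b b' q |q. \<Gamma> \<turnstile> Tm q (IdT B b b')}"
proof -
  let ?F = "rep (ob b)" and ?F' = "rep (ob b')" and ?i = "rep (el_class S \<Gamma> \<Gamma> v)"
  note F = rep_ob[OF b] and F' = rep_ob[OF b']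
  have lF: "length ?F = N" "length ?F' = N" using el_eq_length[OF F] el_eq_length[OF F'] by simp_all
  have i: "el_eq S \<Gamma> \<Gamma> v ?i" by (rule rep_el[OF el_v])
  have Idt: "Idt (ctx_hom S \<Gamma> \<Gamma>) (el_class S \<Gamma> \<Gamma> v) = el_class S \<Gamma> (Id_ctx \<Gamma> ?i ?i) (map ReflT ?i)"
    by (simp add: ctx_hom_def)
  have bv: "length (b # v) = N" "length (b' # v) = N" by simp_all
  have cI: "ctx S (Id_ctx \<Gamma>B (b # v) (b' # v) @ \<Gamma>)"
    using Id_ctx_ctx[OF ctx_\<Gamma>B c el_ob[OF b] el_ob[OF b']] by blast
  show ?thesis
    unfolding Idt
  proof (intro equalityI subsetI)
    fix m assume "m \<in> {arr b b' q |q. \<Gamma> \<turnstile> Tm q (IdT B b b')}"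
    then obtain q where q: "\<Gamma> \<turnstile> Tm q (IdT B b b')" and m: "m = arr b b' q" by auto
    have a: "el S \<Gamma> (Id_ctx \<Gamma>B (b # v) (b' # v)) (q # map ReflT v)" using el_arr(1)[OF b b'] q by blast
    have lq: "length (q # map ReflT v) = N" by simp
    have e: "el_eq S \<Gamma> (U \<Gamma>B) (il (q # map ReflT v) (b' # v) (b # v)) (il (q # map ReflT v) ?F' ?F)"
      using el_eq_cell[OF b b' F F' lq lq] el_eq_refl[OF a] by blast
    have "m = el_class S \<Gamma> (Id_ctx \<Gamma>B ?F ?F') (q # map ReflT v)"
      unfolding m by (rule cell_eq[OF ctx_\<Gamma>B c e]) (simp_all add: lF)
    moreover have "el S \<Gamma> (Id_ctx \<Gamma>B ?F ?F') (q # map ReflT v)"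
      using el_eq_right[OF e ctx_UU(1)] el_U(1)[OF ctx_\<Gamma>B, of ?F ?F' "q # map ReflT v"] lF lq by simp
    ultimately have "m \<in> Hom (ctx_hom S \<Gamma> \<Gamma>B) (ob b) (ob b')" by (auto simp: ctx_hom_def)
    moreover have A: "el_eq S \<Gamma> (Id_ctx \<Gamma>B (b # v) (b' # v)) (q # map ReflT v) (rep m)"
      unfolding m by (rule rep_el[OF a])
    have lm: "length (rep m) = N" using el_eq_length[OF A] by simp
    have "el_eq S \<Gamma> (U \<Gamma>B) (il (q # map ReflT v) (b' # v) (b # v)) (il (rep m) ?F' ?F)"
      using el_eq_cell[OF b b' F F' lq lm] A by blast
    note whisk_proj[OF this refl_v lm lF i]
    ultimately show "m \<in> {m \<in> Hom (ctx_hom S \<Gamma> \<Gamma>B) (ob b) (ob b').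
      el_class S \<Gamma> (Id_ctx \<Gamma> (map (inst 0 ?F) \<pi>) (map (inst 0 ?F') \<pi>)) (ap_ctx \<pi> ?F ?F' (rep m)) =
      el_class S \<Gamma> (Id_ctx \<Gamma> ?i ?i) (map ReflT ?i)}"
      using el_eq_refl[OF refl_v] by blast
  next
    fix m assume "m \<in> {m \<in> Hom (ctx_hom S \<Gamma> \<Gamma>B) (ob b) (ob b').
      el_class S \<Gamma> (Id_ctx \<Gamma> (map (inst 0 ?F) \<pi>) (map (inst 0 ?F') \<pi>)) (ap_ctx \<pi> ?F ?F' (rep m)) =
      el_class S \<Gamma> (Id_ctx \<Gamma> ?i ?i) (map ReflT ?i)}"
    then obtain \<alpha> where \<alpha>: "el S \<Gamma> (Id_ctx \<Gamma>B ?F ?F') \<alpha>" and m: "m = el_class S \<Gamma> (Id_ctx \<Gamma>B ?F ?F') \<alpha>"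
      and w: "el_class S \<Gamma> (Id_ctx \<Gamma> (map (inst 0 ?F) \<pi>) (map (inst 0 ?F') \<pi>)) (ap_ctx \<pi> ?F ?F' (rep m)) =
        el_class S \<Gamma> (Id_ctx \<Gamma> ?i ?i) (map ReflT ?i)"
      by (auto simp: ctx_hom_def)
    have l\<alpha>: "length \<alpha> = N" using el_length[OF \<alpha>] length_Id_ctx[of ?F \<Gamma>B ?F'] lF by simp
    then obtain q ps where q: "\<alpha> = q # ps" by (cases \<alpha>) auto
    have A: "el_eq S \<Gamma> (Id_ctx \<Gamma>B ?F ?F') \<alpha> (rep m)" unfolding m by (rule rep_el[OF \<alpha>])
    have lm: "length (rep m) = N" using el_eq_length[OF A] length_Id_ctx[of ?F \<Gamma>B ?F'] lF by simp
    have Fr: "el S \<Gamma> \<Gamma>B ?F" "el S \<Gamma> \<Gamma>B ?F'" using el_eq_right[OF F ctx_\<Gamma>B\<Gamma>] el_eq_right[OF F' ctx_\<Gamma>B\<Gamma>] .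
    have 1: "el_eq S \<Gamma> (U \<Gamma>B) (il \<alpha> ?F' ?F) (il (rep m) ?F' ?F)"
      using el_U(2)[OF ctx_\<Gamma>B, of ?F ?F' \<alpha> ?F ?F' "rep m"] A lF l\<alpha> lm el_eq_refl[OF Fr(1)] el_eq_refl[OF Fr(2)] by simp
    have 2: "el_eq S \<Gamma> (U \<Gamma>B) (il \<alpha> ?F' ?F) (il \<alpha> (b' # v) (b # v))"
      using el_U(2)[OF ctx_\<Gamma>B, of ?F ?F' \<alpha> "b # v" "b' # v" \<alpha>] lF l\<alpha> el_eq_refl[OF \<alpha>]
        el_eq_sym[OF F ctx_\<Gamma>B\<Gamma>] el_eq_sym[OF F' ctx_\<Gamma>B\<Gamma>] bv by simp
    from el_eq_trans[OF el_eq_sym[OF 2 ctx_UU(1)] 1 ctx_UU(1)]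
    have 3: "el_eq S \<Gamma> (U \<Gamma>B) (il (q # ps) (b' # v) (b # v)) (il (rep m) ?F' ?F)" unfolding q .
    have \<alpha>': "el S \<Gamma> (Id_ctx \<Gamma>B (b # v) (b' # v)) (q # ps)"
      using el_U(1)[OF ctx_\<Gamma>B, of "b # v" "b' # v" "q # ps" \<Gamma>] el_eq_left[OF 3] l\<alpha> bv q by simp
    have vl: "length v = length \<Gamma>" by simp
    have ps: "el S \<Gamma> (Id_ctx \<Gamma> v v) ps" and qt: "\<Gamma> \<turnstile> Tm q (Id_entry B ps v v b b')"
      using \<alpha>' unfolding el_Id_ctx_Cons(1)[OF ctx_\<Gamma>B vl vl] by blast+
    \<comment> \<open>The slice condition turns the tail of the identification into reflexivity,
      which leaves only the head q free.\<close>
    have "el_eq S \<Gamma> (Id_ctx \<Gamma> v v) ps (map ReflT v)" using whisk_proj[OF 3 ps lm lF i] w by blast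
    then have 4: "el_eq S \<Gamma> (Id_ctx \<Gamma>B (b # v) (b' # v)) (q # ps) (q # map ReflT v)"
      unfolding el_Id_ctx_Cons(2)[OF ctx_\<Gamma>B vl vl] using TmEq_refl[OF qt] by blast
    from el_eq_right[OF this cI] have "\<Gamma> \<turnstile> Tm q (IdT B b b')" using el_arr(1)[OF b b'] by blast
    moreover have "el_eq S \<Gamma> (U \<Gamma>B) (il (q # ps) (b' # v) (b # v)) (il (q # map ReflT v) (b' # v) (b # v))"
      using el_eq_cell[OF b b' el_eq_refl[OF el_ob[OF b]] el_eq_refl[OF el_ob[OF b']], of "q # ps" "q # map ReflT v"] 4 l\<alpha> q by simp
    from el_eq_trans[OF 2[unfolded q] this ctx_UU(1)]
    have "m = arr b b' q" unfolding m q by (rule cell_eq[OF ctx_\<Gamma>B c]) (use lF l\<alpha> q in simp_all)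
    ultimately show "m \<in> {arr b b' q |q. \<Gamma> \<turnstile> Tm q (IdT B b b')}" by auto
  qed
qed

text \<open>Composition is the substantial clause: \<open>comp_ctx_vertical\<close> reduces it to
  \<open>vcomp\<close>, whichever representatives were chosen for the cells and their
  boundaries.\<close>

lemma slice_term_cat:
  "term_cat \<Gamma> B (Hom2 (slice (ctx_two_cat S) \<Gamma>) (\<Gamma>, Id1 (ctx_two_cat S) \<Gamma>) (U_ob (E_functor S \<Gamma>) B)) (\<lambda>b. ob b) (\<lambda>b b' q. arr b b' q)"
proof -
  let ?D = "Hom2 (slice (ctx_two_cat S) \<Gamma>) (\<Gamma>, Id1 (ctx_two_cat S) \<Gamma>) (U_ob (E_functor S \<Gamma>) B)"
  have D: "Ob ?D = {k \<in> Ob (ctx_hom S \<Gamma> \<Gamma>B). el_class S \<Gamma> \<Gamma> (map (inst 0 (rep k)) \<pi>) = el_class S \<Gamma> \<Gamma> v}"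
    "Hom ?D k k' = {m \<in> Hom (ctx_hom S \<Gamma> \<Gamma>B) k k'. el_class S \<Gamma> (Id_ctx \<Gamma> (map (inst 0 (rep k)) \<pi>) (map (inst 0 (rep k')) \<pi>))
        (ap_ctx \<pi> (rep k) (rep k') (rep m)) = Idt (ctx_hom S \<Gamma> \<Gamma>) (el_class S \<Gamma> \<Gamma> v)}"
    "Idt ?D = Idt (ctx_hom S \<Gamma> \<Gamma>B)" "Cmp ?D = Cmp (ctx_hom S \<Gamma> \<Gamma>B)" for k k'
    by (simp_all add: slice_def ctx_two_cat_def E_functor_def)
  show ?thesis
    unfolding term_cat_def
  proof (intro conjI allI impI)
    show "Ob ?D = {ob b |b. \<Gamma> \<turnstile> Tm b B}" unfolding D(1) by (rule Ob_slice)
    fix f g assume f: "\<Gamma> \<turnstile> Tm f B" and g: "\<Gamma> \<turnstile> Tm g B"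
    have "el_eq S \<Gamma> \<Gamma>B (f # v) (g # v) \<longleftrightarrow> (\<Gamma> \<turnstile> TmEq f g B)" using el_eq_refl[OF el_v] inst_v by simp
    then show "ob f = ob g \<longleftrightarrow> (\<Gamma> \<turnstile> TmEq f g B)"
      using el_class_eq[OF _ ctx_\<Gamma>B\<Gamma>] el_class_eqD[OF _ el_ob[OF g]] by blast
    show "Hom ?D (ob f) (ob g) = {arr f g p |p. \<Gamma> \<turnstile> Tm p (IdT B f g)}" unfolding D(2) by (rule Hom_slice[OF f g])
    have "arr f f (ReflT f) = el_class S \<Gamma> (Id_ctx \<Gamma>B (rep (ob f)) (rep (ob f))) (map ReflT (rep (ob f)))"
      using el_eq_refl_il[OF ctx_\<Gamma>B c rep_ob[OF f]] el_eq_length[OF rep_ob[OF f]]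
      by (intro cell_eq[OF ctx_\<Gamma>B c]) simp_all
    then show "Idt ?D (ob f) = arr f f (ReflT f)" unfolding D(3) by (simp add: ctx_hom_def)
  next
    fix f g h p q
    assume f: "\<Gamma> \<turnstile> Tm f B" and g: "\<Gamma> \<turnstile> Tm g B" and h: "\<Gamma> \<turnstile> Tm h B"
      and p: "\<Gamma> \<turnstile> Tm p (IdT B f g)" and q: "\<Gamma> \<turnstile> Tm q (IdT B g h)"
    note F = rep_ob[OF f] and G = rep_ob[OF g] and H = rep_ob[OF h]
    have \<alpha>: "el_eq S \<Gamma> (Id_ctx \<Gamma>B (f # v) (g # v)) (p # map ReflT v) (rep (arr f g p))"
      by (rule rep_el) (use el_arr(1)[OF f g] p in blast)
    have \<beta>: "el_eq S \<Gamma> (Id_ctx \<Gamma>B (g # v) (h # v)) (q # map ReflT v) (rep (arr g h q))"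
      by (rule rep_el) (use el_arr(1)[OF g h] q in blast)
    have l: "length (rep (arr g h q)) = N" "length (rep (ob f)) = N" "length (rep (ob g)) = N" "length (rep (ob h)) = N"
      using el_eq_length[OF \<beta>] el_eq_length[OF F] el_eq_length[OF G] el_eq_length[OF H] by simp_all
    have "el_eq S \<Gamma> (U \<Gamma>B) (il (q # map ReflT v) (h # v) (g # v)) (il (rep (arr g h q)) (rep (ob h)) (rep (ob g)))"
      using el_eq_cell[OF g h G H, of "q # map ReflT v"] \<beta> l by simp
    from comp_ctx_vertical[OF ctx_\<Gamma>B c el_v, unfolded inst_v, OF f g h p q this \<alpha> l(1,4,3)]
    have e: "el_eq S \<Gamma> (Id_ctx \<Gamma>B (f # v) (h # v)) (vcomp g h q p # map ReflT v)
        (comp_ctx (rep (ob g)) (rep (ob h)) (rep (arr g h q)) (rep (arr f g p)))" .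
    then have lc: "length (comp_ctx (rep (ob g)) (rep (ob h)) (rep (arr g h q)) (rep (arr f g p))) = N"
      using el_eq_length by fastforce
    have "arr f h (vcomp g h q p) = el_class S \<Gamma> (Id_ctx \<Gamma>B (rep (ob f)) (rep (ob h)))
        (comp_ctx (rep (ob g)) (rep (ob h)) (rep (arr g h q)) (rep (arr f g p)))"
      by (rule cell_eq[OF ctx_\<Gamma>B c]) (use el_eq_cell[OF f h F H, of "vcomp g h q p # map ReflT v"] e lc l in simp_all)
    then show "Cmp ?D (ob f) (ob g) (ob h) (arr g h q) (arr f g p) = arr f h (vcomp g h q p)"
      unfolding D(4) by (simp add: ctx_hom_def)
  next
    fix f f' g g' p p'
    assume f: "\<Gamma> \<turnstile> TmEq f f' B" and g: "\<Gamma> \<turnstile> TmEq g g' B"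
      and p: "\<Gamma> \<turnstile> Tm p (IdT B f g)" and p': "\<Gamma> \<turnstile> Tm p' (IdT B f g)"
    have ft: "\<Gamma> \<turnstile> Tm f B" and gt: "\<Gamma> \<turnstile> Tm g B" using presup_TmEq f g by blast+
    have a: "el S \<Gamma> (Id_ctx \<Gamma>B (f # v) (g # v)) (p' # map ReflT v)" using el_arr(1)[OF ft gt] p' by blast
    have ff: "el_eq S \<Gamma> \<Gamma>B (f # v) (f' # v)" "el_eq S \<Gamma> \<Gamma>B (g # v) (g' # v)"
      using f g el_eq_refl[OF el_v] inst_v by simp_all
    have 1: "arr f g p' = arr f' g' p'"
      by (rule cell_eq[OF ctx_\<Gamma>B c]) (use el_eq_cell[OF ft gt ff, of "p' # map ReflT v" "p' # map ReflT v"] el_eq_refl[OF a] in simp_all)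
    have "ctx S (Id_ctx \<Gamma>B (f # v) (g # v) @ \<Gamma>)"
      using Id_ctx_ctx[OF ctx_\<Gamma>B c el_ob[OF ft] el_ob[OF gt]] by blast
    then have "arr f g p = arr f g p' \<longleftrightarrow> el_eq S \<Gamma> (Id_ctx \<Gamma>B (f # v) (g # v)) (p # map ReflT v) (p' # map ReflT v)"
      using el_class_eq el_class_eqD[OF _ a] by blast
    then show "arr f g p = arr f' g' p' \<longleftrightarrow> (\<Gamma> \<turnstile> TmEq p p' (IdT B f g))"
      using 1 el_arr(2)[OF ft gt] by simp
  qed
qed

text \<open>With both hom-categories presented by terms, it remains to see that composition with the
  unit sends the cell of a term to the cell of its value at \<open>StarT\<close>, through several
  layers of chosen representatives.\<close>

lemma unit_precomp_surjective_equivalence: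
  "surjective_equivalence (Hom2 (fibre_two_cat S \<Gamma>) UnitT B)
    (Hom2 (slice (ctx_two_cat S) \<Gamma>) (\<Gamma>, Id1 (ctx_two_cat S) \<Gamma>) (U_ob (E_functor S \<Gamma>) B))
    (precomp_functor (slice (ctx_two_cat S) \<Gamma>) (E_functor S \<Gamma>) (\<Gamma>, Id1 (ctx_two_cat S) \<Gamma>) UnitT
      (el_class S \<Gamma> (UnitT # \<Gamma>) (StarT # v)) B)"
proof -
  let ?G = "UnitT # \<Gamma>" and ?T = "lift 1 B"
  let ?P = "precomp_functor (slice (ctx_two_cat S) \<Gamma>) (E_functor S \<Gamma>) (\<Gamma>, Id1 (ctx_two_cat S) \<Gamma>) UnitT
      (el_class S \<Gamma> (UnitT # \<Gamma>) (StarT # v)) B"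
  let ?ob = "tm_class S ?G ?T" and ?arr = "\<lambda>f g. tm_class S ?G (IdT ?T f g)"
  let ?\<eta> = "rep (el_class S \<Gamma> ?G (StarT # v))"
  have H: "Hom2 (fibre_two_cat S \<Gamma>) UnitT B = fibre_hom S \<Gamma> UnitT B" by (simp add: fibre_two_cat_def)
  have cG: "ctx S ?G" using c Unit_form by simp
  have cGG: "ctx S (U \<Gamma>B @ ?G)" "ctx S (\<Gamma>B @ ?G)"
    using ctx_append_closed[OF ctx_U_closed[OF ctx_\<Gamma>B] cG] ctx_append_closed[OF ctx_\<Gamma>B cG] .
  have \<eta>: "el_eq S \<Gamma> ?G (StarT # v) ?\<eta>"
    by (rule rep_el) (use el_v Unit_intro[OF c] in \<open>simp add: inst_eq_sub\<close>)
  have pr: "el S ?G \<Gamma> (proj \<Gamma>)"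
    using msub_el[OF c, of ?G "\<lambda>i. Var (Suc i)"] msub_shift[of "[UnitT]" \<Gamma>] cG by (simp add: proj_eq)
  have lpr: "length (proj \<Gamma>) = length \<Gamma>" by (simp add: proj_eq)
  have iB: "inst 0 (proj \<Gamma>) B = ?T"
    using scope[OF B] unfolding inst_eq_sub lift_eq_sub scoped_judgement.simps
    by (rule sub_cong_scoped) (simp add: proj_eq lsub_def)
  have el_f: "el S ?G \<Gamma>B (f # proj \<Gamma>)" if "?G \<turnstile> Tm f ?T" for f using pr that iB by simp
  have star: "map (inst 0 (StarT # v)) (proj \<Gamma>) = v"
    using map_lsub_Vars[of v "length \<Gamma>" Var] by (simp add: proj_eq inst_eq_sub lsub_Cons comp_def)
  have "map (inst 0 (StarT # v)) (map ReflT (proj \<Gamma>)) = map ReflT (map (inst 0 (StarT # v)) (proj \<Gamma>))"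
    by (simp add: inst_eq_sub)
  then have star_r: "map (inst 0 (StarT # v)) (map ReflT (proj \<Gamma>)) = map ReflT v" unfolding star .
  \<comment> \<open>The unit lists all variables of \<Gamma> explicitly; on terms over
    \<open>UnitT # \<Gamma>\<close> this agrees with filling in \<open>StarT\<close> alone.\<close>
  have at_star: "inst 0 (StarT # v) e = at_star e" if "scoped N e" for e :: "'s expr"
    unfolding inst_eq_sub by (rule sub_cong_scoped[OF that]) (auto simp: lsub_Cons scons_def lsub_def split: nat.split)
  have stf: "inst 0 (StarT # v) f = at_star f" if "?G \<turnstile> Tm f A" for f A
    using at_star scope[OF that] by simp
  have rf: "el_eq S ?G \<Gamma>B (f # proj \<Gamma>) (rep (?ob f) # proj \<Gamma>)" if "?G \<turnstile> Tm f ?T" for f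
    using rep_tm[OF that] el_eq_refl[OF pr] iB by simp
  \<comment> \<open>Two choices are passed here: a representative of the class of f, then one of its
    image under \<open>E_functor\<close>.\<close>
  have rrf: "el_eq S ?G \<Gamma>B (f # proj \<Gamma>) (rep (el_class S ?G \<Gamma>B (rep (?ob f) # proj \<Gamma>)))" if "?G \<turnstile> Tm f ?T" for f
    using el_eq_trans[OF rf[OF that] rep_el[OF el_eq_right[OF rf[OF that] cGG(2)]] cGG(2)] .
  show ?thesis
    unfolding H
  proof (rule unit_surjective_equivalence[OF c B fibre_term_cat slice_term_cat])
    fix f assume f: "?G \<turnstile> Tm f ?T"
    have "el_eq S \<Gamma> \<Gamma>B (map (inst 0 (StarT # v)) (f # proj \<Gamma>)) (map (inst 0 ?\<eta>) (rep (el_class S ?G \<Gamma>B (rep (?ob f) # proj \<Gamma>))))"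
      by (rule el_eq_comp[OF cG c ctx_\<Gamma>B \<eta> rrf[OF f]])
    from el_class_eq[OF this ctx_\<Gamma>B\<Gamma>]
    show "FOb ?P (?ob f) = ob (at_star f)"
      using star stf[OF f] by (simp add: precomp_functor_def slice_def ctx_two_cat_def E_functor_def)
    fix g p assume g: "?G \<turnstile> Tm g ?T" and p: "?G \<turnstile> Tm p (IdT ?T f g)"
    let ?F = "rep (?ob f) # proj \<Gamma>" and ?H = "rep (?ob g) # proj \<Gamma>" and ?A = "rep (?arr f g p) # map ReflT (proj \<Gamma>)"
    let ?R = "rep (el_class S ?G (Id_ctx \<Gamma>B ?F ?H) ?A)"
    have 1: "el_eq S ?G (Id_ctx \<Gamma>B (f # proj \<Gamma>) (g # proj \<Gamma>)) (p # map ReflT (proj \<Gamma>)) ?A"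
      using el_vertical(2)[OF ctx_\<Gamma>B cG pr] f g rep_tm[OF p] unfolding iB by blast
    have lA: "length (p # map ReflT (proj \<Gamma>)) = length \<Gamma>B" "length ?A = length \<Gamma>B" "length (f # proj \<Gamma>) = length \<Gamma>B"
      "length ?F = length \<Gamma>B" "length (g # proj \<Gamma>) = length \<Gamma>B" "length ?H = length \<Gamma>B" by (simp_all add: lpr)
    have 2: "el_eq S ?G (U \<Gamma>B) (il (p # map ReflT (proj \<Gamma>)) (g # proj \<Gamma>) (f # proj \<Gamma>)) (il ?A ?H ?F)"
      unfolding el_U(2)[OF ctx_\<Gamma>B lA(3,5,1,4,6,2)] using 1 rf[OF f] rf[OF g] by blast
    have "el_class S ?G (Id_ctx \<Gamma>B (f # proj \<Gamma>) (g # proj \<Gamma>)) (p # map ReflT (proj \<Gamma>)) = el_class S ?G (Id_ctx \<Gamma>B ?F ?H) ?A"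
      by (rule cell_eq[OF ctx_\<Gamma>B cG 2 lA(1,5,3,2,6,4)])
    then have R: "el_eq S ?G (Id_ctx \<Gamma>B (f # proj \<Gamma>) (g # proj \<Gamma>)) (p # map ReflT (proj \<Gamma>)) ?R"
      using rep_el[OF el_eq_left[OF 1]] by simp
    have lR: "length ?R = length \<Gamma>B" using el_eq_length[OF R] lpr by simp
    have lr: "length (rep (el_class S ?G \<Gamma>B (rep (?ob e) # proj \<Gamma>))) = length \<Gamma>B" if "?G \<turnstile> Tm e ?T" for e
      using el_eq_length[OF rrf[OF that]] by simp
    \<comment> \<open>The chosen cell and both chosen boundaries form one vector over
      \<open>U\<close>, so that substituting the unit takes a single congruence.\<close>
    have 3: "el_eq S ?G (U \<Gamma>B) (il (p # map ReflT (proj \<Gamma>)) (g # proj \<Gamma>) (f # proj \<Gamma>))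
      (il ?R (rep (el_class S ?G \<Gamma>B ?H)) (rep (el_class S ?G \<Gamma>B ?F)))"
      unfolding el_U(2)[OF ctx_\<Gamma>B lA(3,5,1) lr[OF f] lr[OF g] lR] using R rrf[OF f] rrf[OF g] by blast
    have "el_eq S \<Gamma> (U \<Gamma>B) (il (at_star p # map ReflT v) (at_star g # v) (at_star f # v))
      (il (map (inst 0 ?\<eta>) ?R) (map (inst 0 ?\<eta>) (rep (el_class S ?G \<Gamma>B ?H))) (map (inst 0 ?\<eta>) (rep (el_class S ?G \<Gamma>B ?F))))"
      using el_eq_comp[OF cG c ctx_U_closed[OF ctx_\<Gamma>B] \<eta> 3]
      by (simp only: map_il list.map(2) star star_r stf[OF f] stf[OF g] stf[OF p])
    from cell_eq[OF ctx_\<Gamma>B c this]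
    show "FHom ?P (?ob f) (?ob g) (?arr f g p) = arr (at_star f) (at_star g) (at_star p)"
      using lr[OF f] lr[OF g] lR by (simp add: precomp_functor_def slice_def ctx_two_cat_def E_functor_def)
  qed
qed

end

end

theorem proposition4p3p1:
  fixes S :: "'s ttheory" and \<Gamma> :: "'s expr list"
  assumes "ML2 S" and "ctx S \<Gamma>"
  shows "\<exists>\<eta>. retract_bireflection (fibre_two_cat S \<Gamma>) (slice (ctx_two_cat S) \<Gamma>) (E_functor S \<Gamma>)
    (\<Gamma>, Id1 (ctx_two_cat S) \<Gamma>) UnitT \<eta>"
proof -
  interpret ML2 S by (rule assms(1))
  note c = assms(2)
  let ?\<eta> = "el_class S \<Gamma> (UnitT # \<Gamma>) (StarT # map Var [0..<length \<Gamma>])"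
  have "retract_bireflection (fibre_two_cat S \<Gamma>) (slice (ctx_two_cat S) \<Gamma>) (E_functor S \<Gamma>)
    (\<Gamma>, Id1 (ctx_two_cat S) \<Gamma>) UnitT ?\<eta>"
    unfolding retract_bireflection_def
  proof (intro conjI ballI)
    show "(\<Gamma>, Id1 (ctx_two_cat S) \<Gamma>) \<in> Ob2 (slice (ctx_two_cat S) \<Gamma>)"
      using c el_Vars_closed[OF c] by (auto simp: slice_def ctx_two_cat_def ctx_hom_def)
    show "UnitT \<in> Ob2 (fibre_two_cat S \<Gamma>)" using Unit_form[OF c] by (simp add: fibre_two_cat_def)
    show "?\<eta> \<in> Ob (Hom2 (slice (ctx_two_cat S) \<Gamma>) (\<Gamma>, Id1 (ctx_two_cat S) \<Gamma>) (U_ob (E_functor S \<Gamma>) UnitT))"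
      unfolding term_cat_Ob[OF slice_term_cat[OF c Unit_form[OF c]]] using Unit_intro[OF c] by blast
    fix B assume "B \<in> Ob2 (fibre_two_cat S \<Gamma>)"
    then have "\<Gamma> \<turnstile>\<^bsub>S\<^esub> Ty B" by (simp add: fibre_two_cat_def)
    from unit_precomp_surjective_equivalence[OF c this]
    show "surjective_equivalence (Hom2 (fibre_two_cat S \<Gamma>) UnitT B)
      (Hom2 (slice (ctx_two_cat S) \<Gamma>) (\<Gamma>, Id1 (ctx_two_cat S) \<Gamma>) (U_ob (E_functor S \<Gamma>) B))
      (precomp_functor (slice (ctx_two_cat S) \<Gamma>) (E_functor S \<Gamma>) (\<Gamma>, Id1 (ctx_two_cat S) \<Gamma>) UnitT ?\<eta> B)" .
  qed
  then show ?thesis by blast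
qed

end
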